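(* Let $G$ be a closed subgroup of $O(4)$ whose action on the unit sphere $S^3\subset\mathbb{R}^4$ is not transitive. Then $$\operatorname{diam}(S^3/G)\ \geq\ \frac{\alpha}{2},\qquad \text{where } \alpha=\arccos\!\left(\frac{\tan(3\pi/10)}{\sqrt{3}}\right).$$
   Context: $S^3$ is the round unit sphere with its standard (angular) Riemannian distance $d$, on which $O(4)$ acts by isometries in the standard way. The orbit space $S^3/G$ carries the orbital distance: the distance between two orbits is $\min_{g,h\in G} d(gx,hy)$. The diameter is the supremum of the distances between points of $S^3/G$. *)

theory Defs
  imports "HOL-Analysis.Analysis" "HOL-Algebra.Group_Action"
begin

definition orthogonal_group :: "(real^'n^'n) monoid" where
  "orthogonal_group =
     \<lparr>carrier = {A. orthogonal_matrix A}, monoid.mult = (**), one = mat 1\<rparr>"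

text \<open>An action in the sense of the locale \<^locale>\<open>group_action\<close> must consist of extensional
  bijections, hence the restriction to the sphere.\<close>

definition sphere_action :: "real^'n^'n \<Rightarrow> real^'n \<Rightarrow> real^'n" where
  "sphere_action A = (\<lambda>x\<in>sphere 0 1. A *v x)"

abbreviation subgroup_of_O :: "(real^'n^'n) set \<Rightarrow> (real^'n^'n) monoid" where
  "subgroup_of_O G \<equiv> orthogonal_group\<lparr>carrier := G\<rparr>"

definition sphere_orbit_space :: "(real^'n^'n) set \<Rightarrow> (real^'n) set set" where
  "sphere_orbit_space G = orbits (subgroup_of_O G) (sphere 0 1) sphere_action"

text \<open>The geodesic distance of the round unit sphere; only meaningful for unit vectors.\<close>

definition sphere_dist :: "real^'n \<Rightarrow> real^'n \<Rightarrow> real" where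
  "sphere_dist x y = arccos (x \<bullet> y)"

text \<open>For two orbits of a closed subgroup the infimum is a minimum; see
  \<open>orbital_dist_attained\<close> below.\<close>

definition orbital_dist :: "(real^'n) set \<Rightarrow> (real^'n) set \<Rightarrow> real" where
  "orbital_dist X Y = Inf {sphere_dist p q | p q. p \<in> X \<and> q \<in> Y}"

text \<open>The set is nonempty and bounded, so its real supremum is meaningful; see
  \<open>orbital_dist_set_nonempty\<close> and \<open>orbital_dist_set_bdd_above\<close> below.\<close>

definition sphere_orbit_space_diameter :: "(real^'n^'n) set \<Rightarrow> real" where
  "sphere_orbit_space_diameter G =
     Sup {orbital_dist X Y | X Y. X \<in> sphere_orbit_space G \<and> Y \<in> sphere_orbit_space G}"

lemma group_orthogonal_group: "group (orthogonal_group :: (real^'n^'n) monoid)"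
proof (rule groupI)
  fix A :: "real^'n^'n" assume A: "A \<in> carrier orthogonal_group"
  show "\<exists>B\<in>carrier orthogonal_group. B \<otimes>\<^bsub>orthogonal_group\<^esub> A = \<one>\<^bsub>orthogonal_group\<^esub>"
    using A by (intro bexI[of _ "transpose A"])
      (auto simp: orthogonal_group_def orthogonal_matrix_def)
qed (auto simp: orthogonal_group_def orthogonal_matrix_mul orthogonal_matrix_id matrix_mul_assoc)

lemma subgroup_orthogonal_group_iff:
  fixes G :: "(real^'n^'n) set"
  shows "subgroup G orthogonal_group \<longleftrightarrow>
    (\<forall>A\<in>G. orthogonal_matrix A) \<and> mat 1 \<in> G \<and> (\<forall>A\<in>G. \<forall>B\<in>G. A ** B \<in> G) \<and>
    (\<forall>A\<in>G. transpose A \<in> G)"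
proof -
  interpret group "orthogonal_group :: (real^'n^'n) monoid" by (rule group_orthogonal_group)
  have inv: "inv\<^bsub>orthogonal_group\<^esub> A = transpose A" if "orthogonal_matrix A" for A :: "real^'n^'n"
    using that by (intro inv_equality) (auto simp: orthogonal_group_def orthogonal_matrix_def)
  show ?thesis
    unfolding subgroup_def
    by (auto simp: orthogonal_group_def inv[unfolded orthogonal_group_def] subset_iff)
qed

lemma norm_orthogonal_matrix:
  fixes A :: "real^'n^'n"
  assumes "orthogonal_matrix A"
  shows "norm (A *v x) = norm x"
  using assms orthogonal_transformation_matrix[of "(*v) A"]
  by (simp add: orthogonal_transformation)

lemma sphere_action_group_action:
  fixes G :: "(real^'n^'n) set"
  assumes G: "subgroup G orthogonal_group"
  shows "group_action (subgroup_of_O G) (sphere 0 1) sphere_action"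
proof -
  let ?S = "sphere 0 1 :: (real^'n) set"
  note G' = G[unfolded subgroup_orthogonal_group_iff]
  have Bij: "sphere_action A \<in> Bij ?S" if "A \<in> G" for A
  proof -
    have tA: "transpose A ** A = mat 1" "A ** transpose A = mat 1"
      using G' that by (auto simp: orthogonal_matrix_def)
    have "bij_betw (sphere_action A) ?S ?S"
      by (rule bij_betwI[where g = "sphere_action (transpose A)"])
        (use G' that in \<open>auto simp: sphere_action_def norm_orthogonal_matrix
          matrix_vector_mul_assoc tA simp del: transpose_matrix_vector\<close>)
    then show ?thesis by (auto simp: Bij_def sphere_action_def)
  qed
  have hom: "sphere_action \<in> hom (subgroup_of_O G) (BijGroup ?S)"
  proof (rule homI)
    fix A B assume "A \<in> carrier (subgroup_of_O G)" "B \<in> carrier (subgroup_of_O G)"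
    then have AB: "A \<in> G" "B \<in> G" by auto
    show "sphere_action (A \<otimes>\<^bsub>subgroup_of_O G\<^esub> B) =
        sphere_action A \<otimes>\<^bsub>BijGroup ?S\<^esub> sphere_action B"
      using AB G' Bij[OF AB(1)] Bij[OF AB(2)]
      by (auto simp: BijGroup_def orthogonal_group_def sphere_action_def compose_def fun_eq_iff
          matrix_vector_mul_assoc norm_orthogonal_matrix)
  qed (use Bij in \<open>auto simp: BijGroup_def\<close>)
  have "group (subgroup_of_O G)"
    using G group_orthogonal_group by (rule subgroup.subgroup_is_group)
  then show ?thesis
    using hom by (simp add: group_action_def group_hom_def group_hom_axioms_def group_BijGroup)
qed

lemma sphere_orbit_space_eq:
  "sphere_orbit_space G = {(\<lambda>A. A *v x) ` G | x. norm x = 1}"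
  by (force simp: sphere_orbit_space_def orbits_def orbit_def sphere_action_def)

lemma compact_orthogonal_matrices: "compact {A :: real^'n^'n. orthogonal_matrix A}"
proof (rule compact_eq_bounded_closed[THEN iffD2], rule conjI)
  have "norm A \<le> sqrt (real CARD('n))" if "orthogonal_matrix A" for A :: "real^'n^'n"
  proof -
    have "norm (A $ i) = 1" for i
      using that by (simp add: orthogonal_matrix_orthonormal_rows row_def)
    then show ?thesis
      by (subst norm_vec_def) (simp add: L2_set_def)
  qed
  then show "bounded {A :: real^'n^'n. orthogonal_matrix A}"
    unfolding bounded_iff by auto
  have "closed {A :: real^'n^'n. (\<chi> i j. \<Sum>k\<in>UNIV. A $ k $ i * A $ k $ j) = mat 1}"
    by (intro closed_Collect_eq continuous_intros)
  then show "closed {A :: real^'n^'n. orthogonal_matrix A}"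
    by (simp add: orthogonal_matrix matrix_matrix_mult_def transpose_def)
qed

lemma orbital_dist_attained:
  fixes G :: "(real^'n^'n) set"
  assumes "subgroup G orthogonal_group" "closed G" "norm x = 1" "norm y = 1"
  obtains A B where "A \<in> G" "B \<in> G"
    "orbital_dist ((\<lambda>A. A *v x) ` G) ((\<lambda>A. A *v y) ` G) = sphere_dist (A *v x) (B *v y)"
    "\<And>A' B'. A' \<in> G \<Longrightarrow> B' \<in> G \<Longrightarrow>
       sphere_dist (A *v x) (B *v y) \<le> sphere_dist (A' *v x) (B' *v y)"
proof -
  note G' = assms(1)[unfolded subgroup_orthogonal_group_iff]
  have cG: "compact G"
    using compact_Int_closed[OF compact_orthogonal_matrices assms(2)] G'
    by (simp add: Int_absorb1 subset_iff)
  have cont: "continuous_on (G \<times> G) (\<lambda>p. sphere_dist (fst p *v x) (snd p *v y))"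
    unfolding sphere_dist_def
  proof (intro continuous_on_arccos ballI)
    show "continuous_on (G \<times> G) (\<lambda>p. (fst p *v x) \<bullet> (snd p *v y))"
      unfolding matrix_vector_mult_def by (intro continuous_intros)
    fix p assume "p \<in> G \<times> G"
    then have "norm (fst p *v x) = 1" "norm (snd p *v y) = 1"
      using G' assms by (auto simp: norm_orthogonal_matrix)
    then have "\<bar>(fst p *v x) \<bullet> (snd p *v y)\<bar> \<le> 1"
      using Cauchy_Schwarz_ineq2[of "fst p *v x" "snd p *v y"] by simp
    then show "-1 \<le> (fst p *v x) \<bullet> (snd p *v y) \<and> (fst p *v x) \<bullet> (snd p *v y) \<le> 1"
      by linarith
  qed
  obtain A B where AB: "A \<in> G" "B \<in> G"
    and min: "\<And>A' B'. A' \<in> G \<Longrightarrow> B' \<in> G \<Longrightarrow>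
      sphere_dist (A *v x) (B *v y) \<le> sphere_dist (A' *v x) (B' *v y)"
    using continuous_attains_inf[OF compact_Times[OF cG cG] _ cont] G' by fastforce
  have "orbital_dist ((\<lambda>A. A *v x) ` G) ((\<lambda>A. A *v y) ` G) = sphere_dist (A *v x) (B *v y)"
    unfolding orbital_dist_def by (rule cInf_eq_minimum) (use AB min in auto)
  with AB min that show ?thesis by blast
qed

lemma orbital_dist_set_nonempty:
  "{orbital_dist X Y | X Y. X \<in> sphere_orbit_space G \<and> Y \<in> sphere_orbit_space G} \<noteq> {}"
proof -
  have "norm (axis undefined 1 :: real^'n) = 1" by simp
  then show ?thesis unfolding sphere_orbit_space_eq by blast
qed

lemma orbital_dist_set_bdd_above:
  fixes G :: "(real^'n^'n) set"
  assumes "subgroup G orthogonal_group" "closed G"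
  shows "bdd_above
    {orbital_dist X Y | X Y. X \<in> sphere_orbit_space G \<and> Y \<in> sphere_orbit_space G}"
proof (rule bdd_aboveI)
  fix d assume "d \<in> {orbital_dist X Y | X Y. X \<in> sphere_orbit_space G \<and> Y \<in> sphere_orbit_space G}"
  then obtain x y :: "real^'n" where xy: "norm x = 1" "norm y = 1"
    and d: "d = orbital_dist ((\<lambda>A. A *v x) ` G) ((\<lambda>A. A *v y) ` G)"
    unfolding sphere_orbit_space_eq by blast
  note G' = assms(1)[unfolded subgroup_orthogonal_group_iff]
  from orbital_dist_attained[OF assms xy] obtain A B where AB: "A \<in> G" "B \<in> G"
    and d': "d = sphere_dist (A *v x) (B *v y)"
    unfolding d by metis
  have "norm (A *v x) = 1" "norm (B *v y) = 1"
    using G' AB xy by (auto simp: norm_orthogonal_matrix)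
  then have "\<bar>(A *v x) \<bullet> (B *v y)\<bar> \<le> 1"
    using Cauchy_Schwarz_ineq2[of "A *v x" "B *v y"] by simp
  then show "d \<le> pi"
    unfolding d' sphere_dist_def by (intro arccos_ubound) linarith+
qed

end

theory Submission
  imports Defs
begin

text \<open>
  Identify \<open>\<real>\<^sup>4\<close> with the quaternions. An orthogonal map is \<open>x \<mapsto> a x b\<inverse>\<close> or \<open>x \<mapsto> a x\<^sup>* b\<inverse>\<close> with unit
  quaternions \<open>a\<close>, \<open>b\<close>, so \<open>G\<close> gives a closed group \<open>H\<close> of pairs, with closed projections \<open>L\<close> and \<open>R\<close>. It suffices
  to find two points such that every element of \<open>G\<close> moves the first at least \<open>\<alpha>/2\<close> away from the second.

  A closed group of unit quaternions is everything, or preserves a line in \<open>\<real>\<^sup>3\<close>, or is conjugate to the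
  binary tetrahedral, octahedral or icosahedral group. In the last case, a noncentral rotation of smallest
  angle has order 3, 4 or 5 by a commutator estimate, and the real parts of products then determine the angles between
  the axes of that order.

  If \<open>L\<close> or \<open>R\<close> is everything, then \<open>G\<close> is transitive or the rotations in \<open>G\<close> preserve some \<open>{\<plusminus>w}\<close>. If \<open>L\<close> preserves a
  line, the Hopf fibration reduces the claim to \<open>R\<close> acting on the 2-sphere; there the icosahedral
  group, with a 5-fold and a 3-fold axis at angle \<open>\<alpha>\<close>, is the sharp case. If both are polyhedral, \<open>5 + 2i\<close> is far from all
  products. An orientation reversing \<open>x \<mapsto> a x\<^sup>* b\<inverse>\<close> in \<open>G\<close> forces \<open>G a \<subseteq> L a\<close>, so that the same bounds apply.
\<close>

section \<open>Quaternions\<close>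

text \<open>Neither Lie theory nor tables of finite groups enter. If a closed group accumulates at
  the identity, limits of powers of small elements give a circle subgroup directly. A finite group
  is recovered from real parts: the commutator of two short rotations about different axes is
  shorter still, so the least half-angle exceeds \<open>pi / 6\<close>; few real parts remain, and
  the real part of a product fixes the angle between the axes. Suitably conjugated, the group
  contains the 24 Hurwitz units, whose covering radius on the 3-sphere is \<open>pi / 4\<close>, so
  its elements of real part at least \<open>sqrt 2 / 2\<close> determine it. The same factorization
  makes the final estimates finite.

  The half in \<alpha>/2 comes from the Hopf map onto the 2-sphere, which can double angles. For two
  polyhedral groups a single hole is enough because the tetrahedral group lies in both others: in
  standard position every product is, up to inversion, one of an octahedral and an icosahedral
  element.\<close>

definition quat :: "real \<Rightarrow> real \<Rightarrow> real \<Rightarrow> real \<Rightarrow> real^4" where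
  "quat a b c d = (\<chi> i. if i = 1 then a else if i = 2 then b else if i = 3 then c else d)"

lemma quat_nth [simp]:
  "quat a b c d $ 1 = a" "quat a b c d $ 2 = b" "quat a b c d $ 3 = c" "quat a b c d $ 4 = d"
  by (simp_all add: quat_def)

lemma quat_eq_iff:
  "x = y \<longleftrightarrow> x $ 1 = y $ 1 \<and> x $ 2 = y $ 2 \<and> x $ 3 = y $ 3 \<and> x $ 4 = y $ 4" for x y :: "real^4"
  by (simp add: vec_eq_iff forall_4)

lemma inner_quat:
  "x \<bullet> y = x $ 1 * y $ 1 + x $ 2 * y $ 2 + x $ 3 * y $ 3 + x $ 4 * y $ 4" for x y :: "real^4"
  by (simp add: inner_vec_def sum_4)

definition qmul :: "real^4 \<Rightarrow> real^4 \<Rightarrow> real^4" (infixl "\<star>" 70) where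
  "x \<star> y = quat
     (x $ 1 * y $ 1 - x $ 2 * y $ 2 - x $ 3 * y $ 3 - x $ 4 * y $ 4)
     (x $ 1 * y $ 2 + x $ 2 * y $ 1 + x $ 3 * y $ 4 - x $ 4 * y $ 3)
     (x $ 1 * y $ 3 - x $ 2 * y $ 4 + x $ 3 * y $ 1 + x $ 4 * y $ 2)
     (x $ 1 * y $ 4 + x $ 2 * y $ 3 - x $ 3 * y $ 2 + x $ 4 * y $ 1)"

definition qcnj :: "real^4 \<Rightarrow> real^4" where
  "qcnj x = quat (x $ 1) (- x $ 2) (- x $ 3) (- x $ 4)"

definition q1 :: "real^4" where "q1 = quat 1 0 0 0"
definition qi :: "real^4" where "qi = quat 0 1 0 0"
definition qj :: "real^4" where "qj = quat 0 0 1 0"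
definition qk :: "real^4" where "qk = quat 0 0 0 1"

lemmas qbase = q1_def qi_def qj_def qk_def
lemmas qexpand = quat_eq_iff qmul_def qcnj_def

lemma qcnj_nth [simp]:
  "qcnj x $ 1 = x $ 1" "qcnj x $ 2 = - x $ 2" "qcnj x $ 3 = - x $ 3" "qcnj x $ 4 = - x $ 4"
  by (simp_all add: qcnj_def)

lemma qmul_assoc: "x \<star> y \<star> z = x \<star> (y \<star> z)"
  by (simp add: qexpand algebra_simps)

lemma qmul_one [simp]: "q1 \<star> x = x" "x \<star> q1 = x"
  by (simp_all add: qexpand q1_def)

lemma bilinear_qmul: "bilinear (\<star>)"
  unfolding bilinear_def by (auto intro!: linearI simp: qexpand algebra_simps)

lemma bounded_bilinear_qmul: "bounded_bilinear (\<star>)"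
  using bilinear_qmul bilinear_conv_bounded_bilinear by blast

interpretation qmul: bounded_bilinear "(\<star>)"
  by (rule bounded_bilinear_qmul)

lemmas qmul_simps = qmul.add_left qmul.add_right qmul.diff_left qmul.diff_right
  qmul.minus_left qmul.minus_right qmul.scaleR_left qmul.scaleR_right

lemma linear_qcnj: "linear qcnj"
  by (auto intro!: linearI simp: qexpand)

lemma qcnj_simps [simp]:
  "qcnj (- x) = - qcnj x" "qcnj (qcnj x) = x" "qcnj q1 = q1" "qcnj (r *\<^sub>R x) = r *\<^sub>R qcnj x"
  "qcnj (x + y) = qcnj x + qcnj y" "qcnj (x - y) = qcnj x - qcnj y"
  by (simp_all add: qexpand q1_def)

lemma qcnj_mul [simp]: "qcnj (x \<star> y) = qcnj y \<star> qcnj x"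
  by (simp add: qexpand algebra_simps)

lemma inner_qcnj [simp]: "qcnj x \<bullet> qcnj y = x \<bullet> y"
  by (simp add: inner_quat)

lemma inner_qcnj_left: "qcnj x \<bullet> y = x \<bullet> qcnj y"
  by (simp add: inner_quat)

lemma norm_qcnj [simp]: "norm (qcnj x) = norm x"
  by (simp add: norm_eq_sqrt_inner)

lemma qmul_qcnj: "x \<star> qcnj x = (x \<bullet> x) *\<^sub>R q1" "qcnj x \<star> x = (x \<bullet> x) *\<^sub>R q1"
  by (simp_all add: qexpand q1_def inner_quat algebra_simps)

lemma inner_qmul_left: "(x \<star> y) \<bullet> z = y \<bullet> (qcnj x \<star> z)"
  by (simp add: inner_quat qmul_def algebra_simps)

lemma inner_qmul_right: "(x \<star> y) \<bullet> z = x \<bullet> (z \<star> qcnj y)"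
  by (simp add: inner_quat qmul_def algebra_simps)

lemma inner_q1: "x \<bullet> q1 = x $ 1" "q1 \<bullet> x = x $ 1"
  by (simp_all add: inner_quat q1_def)

lemma norm_qmul [simp]: "norm (x \<star> y) = norm x * norm y"
proof -
  have "(x \<star> y) \<bullet> (x \<star> y) = (x \<bullet> x) * (y \<bullet> y)"
    by (simp add: inner_quat qmul_def algebra_simps)
  then show ?thesis
    by (simp add: norm_eq_sqrt_inner real_sqrt_mult)
qed

lemma norm_qbase [simp]: "norm q1 = 1" "norm qi = 1" "norm qj = 1" "norm qk = 1"
  by (simp_all add: norm_eq_sqrt_inner inner_quat qbase)

lemma qmul_unit [simp]:
  assumes "norm a = 1"
  shows "a \<star> qcnj a = q1" "qcnj a \<star> a = q1"
    "a \<star> (qcnj a \<star> x) = x" "qcnj a \<star> (a \<star> x) = x"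
    "x \<star> a \<star> qcnj a = x" "x \<star> qcnj a \<star> a = x"
proof -
  have "a \<bullet> a = 1" using assms by (simp add: norm_eq_1)
  then show *: "a \<star> qcnj a = q1" "qcnj a \<star> a = q1" by (simp_all add: qmul_qcnj)
  show "a \<star> (qcnj a \<star> x) = x" "qcnj a \<star> (a \<star> x) = x"
    by (metis * qmul_assoc qmul_one(1))+
  show "x \<star> a \<star> qcnj a = x" "x \<star> qcnj a \<star> a = x"
    by (simp_all add: * qmul_assoc)
qed

lemma inner_unit_mult:
  assumes "norm g = 1"
  shows "(g \<star> x) \<bullet> (g \<star> y) = x \<bullet> y" "(x \<star> g) \<bullet> (y \<star> g) = x \<bullet> y"
  using assms by (simp add: inner_qmul_left, simp add: inner_qmul_right)

lemma inner_conj: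
  assumes "norm g = 1"
  shows "(g \<star> x \<star> qcnj g) \<bullet> (g \<star> y \<star> qcnj g) = x \<bullet> y"
  using assms by (simp add: inner_unit_mult)

lemma conj_nth_1:
  assumes "norm g = 1"
  shows "(g \<star> x \<star> qcnj g) $ 1 = x $ 1"
  using inner_conj[OF assms, of x q1] assms by (simp add: inner_q1)

section \<open>Imaginary units, polar form and conjugation\<close>

definition pure_units :: "(real^4) set" where
  "pure_units = {u. norm u = 1 \<and> u $ 1 = 0}"

lemma pure_unitsI: "norm u = 1 \<Longrightarrow> u $ 1 = 0 \<Longrightarrow> u \<in> pure_units"
  by (simp add: pure_units_def)

lemma pure_units_minus [simp]: "- u \<in> pure_units \<longleftrightarrow> u \<in> pure_units"
  by (simp add: pure_units_def)

lemma pure_units_qbase [simp]: "qi \<in> pure_units" "qj \<in> pure_units" "qk \<in> pure_units"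
  by (simp_all add: pure_units_def) (simp_all add: qbase)

lemma pure_unitsD [simp]: "u \<in> pure_units \<Longrightarrow> norm u = 1" "u \<in> pure_units \<Longrightarrow> u $ 1 = 0"
  by (simp_all add: pure_units_def)

lemma pure_units_inner_self [simp]: "u \<in> pure_units \<Longrightarrow> u \<bullet> u = 1"
  using norm_eq_1 pure_unitsD(1) by blast

lemma pure_units_qcnj: "u \<in> pure_units \<Longrightarrow> qcnj u = - u"
  by (simp add: quat_eq_iff)

lemma pure_units_sq:
  assumes "u \<in> pure_units"
  shows "u \<star> u = - q1"
proof -
  have "u \<star> u = - (u \<star> qcnj u)"
    using assms by (simp add: pure_units_qcnj qmul.minus_right)
  also have "u \<star> qcnj u = q1"
    using assms by (simp add: qmul_unit(1))
  finally show ?thesis .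
qed

lemma conj_pure_units: "norm g = 1 \<Longrightarrow> u \<in> pure_units \<Longrightarrow> g \<star> u \<star> qcnj g \<in> pure_units"
  by (intro pure_unitsI) (simp_all add: conj_nth_1)

lemma pure_units_inner_bound: "u \<in> pure_units \<Longrightarrow> v \<in> pure_units \<Longrightarrow> \<bar>u \<bullet> v\<bar> \<le> 1"
  using Cauchy_Schwarz_ineq2[of u v] by simp

lemma pure_units_inner_eq_1:
  assumes "u \<in> pure_units" "v \<in> pure_units" "\<bar>u \<bullet> v\<bar> = 1"
  shows "v = u \<or> v = - u"
proof -
  have "norm (u - v) ^ 2 = 2 - 2 * (u \<bullet> v)" "norm (u + v) ^ 2 = 2 + 2 * (u \<bullet> v)"
    using assms by (simp_all add: power2_norm_eq_inner inner_diff_left inner_diff_right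
        inner_add_left inner_add_right inner_commute)
  moreover have "u \<bullet> v = 1 \<or> u \<bullet> v = -1" using assms(3) by linarith
  ultimately have "norm (u - v) = 0 \<or> norm (u + v) = 0" by auto
  then have "u - v = 0 \<or> u + v = 0" by simp
  then show ?thesis by (metis add_eq_0_iff eq_iff_diff_eq_0)
qed

text \<open>For a pure unit \<open>u\<close> this is the exponential of \<open>t\<close> times
  \<open>u\<close>. Conjugation by it rotates imaginary space about \<open>u\<close> by
  \<open>2 * t\<close>, so the angles below are half the rotation angles.\<close>

definition qcis :: "real^4 \<Rightarrow> real \<Rightarrow> real^4" where
  "qcis u t = cos t *\<^sub>R q1 + sin t *\<^sub>R u"

lemma qcis_0 [simp]: "qcis u 0 = q1"
  by (simp add: qcis_def)

lemma qcis_pi [simp]: "qcis u pi = - q1"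
  by (simp add: qcis_def)

lemma qcis_pi_half [simp]: "qcis u (pi / 2) = u"
  by (simp add: qcis_def)

lemma qcis_nth_1 [simp]: "u \<in> pure_units \<Longrightarrow> qcis u t $ 1 = cos t"
  by (simp add: qcis_def q1_def)

lemma qcis_minus: "qcis (- u) t = qcis u (- t)"
  by (simp add: qcis_def)

lemma qcis_add: "u \<in> pure_units \<Longrightarrow> qcis u s \<star> qcis u t = qcis u (s + t)"
  by (simp add: qcis_def qmul_simps pure_units_sq cos_add sin_add algebra_simps)

lemma qcnj_qcis: "u \<in> pure_units \<Longrightarrow> qcnj (qcis u t) = qcis u (- t)"
  by (simp add: qcis_def pure_units_qcnj)

lemma norm_qcis [simp]: "u \<in> pure_units \<Longrightarrow> norm (qcis u t) = 1"
proof -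
  assume u: "u \<in> pure_units"
  then have "qcis u t \<bullet> qcis u t = 1"
    by (simp add: qcis_def inner_add_left inner_add_right inner_q1) (simp add: q1_def flip: power2_eq_square)
  then show ?thesis by (simp add: norm_eq_1)
qed

lemma conj_qcis:
  "norm g = 1 \<Longrightarrow> g \<star> qcis u t \<star> qcnj g = qcis (g \<star> u \<star> qcnj g) t"
  by (simp add: qcis_def qmul_simps)

lemma Re_qcis_mul:
  assumes "u \<in> pure_units" "v \<in> pure_units"
  shows "(qcis u s \<star> qcis v t) $ 1 = cos s * cos t - sin s * sin t * (u \<bullet> v)"
  using assms by (simp add: qcis_def qmul_def q1_def inner_quat algebra_simps)

text \<open>The two products differ only in the sign of the cross product of the imaginary parts. By
  Lagrange's identity the bracket after the factor 2 is the squared length of that cross product.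
  Both the commutator formula and the Hopf estimate rest on this.\<close>

lemma inner_qmul_swap:
  "(x \<star> y) \<bullet> (y \<star> x) = (x \<bullet> x) * (y \<bullet> y) - 2 * ((x \<bullet> x - (x $ 1)\<^sup>2) * (y \<bullet> y - (y $ 1)\<^sup>2)
     - (x \<bullet> y - x $ 1 * y $ 1)\<^sup>2)"
  by (simp add: inner_quat qmul_def) algebra

lemma Re_qcis_commutator:
  assumes u: "u \<in> pure_units" and v: "v \<in> pure_units"
  shows "(qcis u s \<star> qcis v t \<star> qcnj (qcis u s) \<star> qcnj (qcis v t)) $ 1
    = 1 - 2 * (sin s)\<^sup>2 * (sin t)\<^sup>2 * (1 - (u \<bullet> v)\<^sup>2)"
proof -
  \<comment> \<open>\<open>qcnj x \<star> qcnj y\<close> is the conjugate of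
    \<open>y \<star> x\<close>, so the real part of the commutator is an inner product.\<close>
  have *: "(x \<star> y \<star> qcnj x \<star> qcnj y) $ 1 = (x \<star> y) \<bullet> (y \<star> x)" for x y
    by (simp add: inner_quat qmul_def algebra_simps)
  have n: "qcis u s \<bullet> qcis u s = 1" "qcis v t \<bullet> qcis v t = 1"
    using u v by (simp_all flip: norm_eq_1)
  have "qcis u s \<bullet> qcis v t - cos s * cos t = sin s * sin t * (u \<bullet> v)"
    using u v by (simp add: qcis_def inner_add_left inner_add_right inner_q1) (simp add: q1_def)
  then show ?thesis
    unfolding * inner_qmul_swap n using u v
    by (simp add: sin_squared_eq power_mult_distrib algebra_simps)
qed

lemma unit_quat_polar:
  assumes "norm g = 1"
  obtains u t where "u \<in> pure_units" "0 \<le> t" "t \<le> pi" "g = qcis u t"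
proof -
  define t where "t = arccos (g $ 1)"
  have g1: "\<bar>g $ 1\<bar> \<le> 1" using assms component_le_norm_cart[of g 1] by simp
  then have t: "0 \<le> t" "t \<le> pi" "cos t = g $ 1"
    by (auto simp: t_def arccos_lbound arccos_ubound abs_le_iff)
  define v where "v = g - cos t *\<^sub>R q1"
  have v1: "v $ 1 = 0" by (simp add: v_def t q1_def)
  have "v \<bullet> v = 1 - (cos t)\<^sup>2"
    using assms by (simp add: v_def inner_diff_left inner_diff_right inner_q1 t norm_eq_1)
      (simp add: q1_def power2_eq_square algebra_simps)
  then have vs: "norm v = sin t"
    using t sin_squared_eq[of t]
    by (metis norm_eq_sqrt_inner real_sqrt_abs abs_of_nonneg sin_ge_zero)
  show ?thesis
  proof (cases "sin t = 0")
    case True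
    then have "v = 0" using vs by simp
    \<comment> \<open>At \<open>q1\<close> and \<open>- q1\<close> the axis is not determined;
      \<open>qi\<close> is an arbitrary choice.\<close>
    then have "g = qcis qi t" by (simp add: v_def qcis_def True)
    then show ?thesis using that[OF pure_units_qbase(1) t(1,2)] by blast
  next
    case False
    define u where "u = (1 / sin t) *\<^sub>R v"
    have "u \<in> pure_units" using False vs v1 t by (intro pure_unitsI) (simp_all add: u_def sin_ge_zero)
    moreover have "g = qcis u t" using False by (simp add: u_def qcis_def v_def)
    ultimately show ?thesis using that t by blast
  qed
qed

text \<open>\<open>q1 - v \<star> u\<close> intertwines the two: times \<open>u\<close> on the
  right, or \<open>v\<close> times it on the left, is \<open>u + v\<close>. It vanishes only for
  \<open>v = - u\<close>. Its explicit form is exported because commutation with \<open>qi\<close>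
  has to be read off from it later.\<close>

lemma pure_units_transitive_aux:
  assumes u: "u \<in> pure_units" and v: "v \<in> pure_units" and "v \<noteq> - u"
  obtains r where "r \<noteq> 0" "norm (r *\<^sub>R (q1 - v \<star> u)) = 1"
    "(r *\<^sub>R (q1 - v \<star> u)) \<star> u \<star> qcnj (r *\<^sub>R (q1 - v \<star> u)) = v"
proof -
  define g where "g = q1 - v \<star> u"
  have "v \<star> u \<noteq> q1"
  proof
    assume "v \<star> u = q1"
    then have "v \<star> u \<star> u = u" by simp
    then show False using assms(3) u by (simp add: qmul_assoc pure_units_sq qmul_simps) (metis minus_minus)
  qed
  then have "g \<noteq> 0" by (simp add: g_def)
  define r where "r = 1 / norm g"
  define h where "h = r *\<^sub>R g"
  have h: "norm h = 1" "r \<noteq> 0" using \<open>g \<noteq> 0\<close> by (simp_all add: h_def r_def)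
  have "g \<star> u = v \<star> g"
    using u v by (simp add: g_def qmul_simps qmul_assoc pure_units_sq)
      (simp add: pure_units_sq flip: qmul_assoc, simp add: qmul_simps)
  then have "h \<star> u \<star> qcnj h = v \<star> h \<star> qcnj h" by (simp add: h_def qmul_simps)
  also have "\<dots> = v" using h by simp
  finally show ?thesis using that[of r] h by (simp add: h_def g_def)
qed

lemma pure_units_transitive:
  assumes u: "u \<in> pure_units" and v: "v \<in> pure_units"
  obtains g where "norm g = 1" "g \<star> u \<star> qcnj g = v"
proof (cases "v = - u")
  case False
  then show ?thesis using pure_units_transitive_aux[OF u v] that by metis
next
  case True
  \<comment> \<open>Antipodal vectors are joined through an intermediate \<open>p\<close> that is
    antipodal to neither.\<close>
  obtain p where p: "p \<in> pure_units" "p \<noteq> - u" "v \<noteq> - p"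
  proof (cases "u = qi \<or> u = - qi")
    case True
    then have "qj \<noteq> - u" "v \<noteq> - qj" using \<open>v = - u\<close> by (auto simp: qexpand qbase)
    then show ?thesis using that by (meson pure_units_qbase)
  next
    case False
    then have "qi \<noteq> - u" "v \<noteq> - qi" using \<open>v = - u\<close> by (metis minus_minus)+
    then show ?thesis using that by (meson pure_units_qbase)
  qed
  obtain g where g: "norm g = 1" "g \<star> u \<star> qcnj g = p"
    using pure_units_transitive_aux[OF u p(1,2)] by metis
  obtain h where h: "norm h = 1" "h \<star> p \<star> qcnj h = v"
    using pure_units_transitive_aux[OF p(1) v p(3)] by metis
  have "(h \<star> g) \<star> u \<star> qcnj (h \<star> g) = v"
    using h(2) unfolding g(2)[symmetric] by (simp add: qmul_assoc)
  then show ?thesis using that[of "h \<star> g"] g h by simp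
qed

lemma pure_units_pair_to_ij:
  assumes u: "u \<in> pure_units" and v: "v \<in> pure_units" and "u \<bullet> v = 0"
  obtains g where "norm g = 1" "g \<star> u \<star> qcnj g = qi" "g \<star> v \<star> qcnj g = qj"
proof -
  obtain g where g: "norm g = 1" "g \<star> u \<star> qcnj g = qi"
    using pure_units_transitive[OF u pure_units_qbase(1)] .
  define w where "w = g \<star> v \<star> qcnj g"
  have w: "w \<in> pure_units" using conj_pure_units g v by (simp add: w_def)
  have "w \<bullet> qi = 0"
    using inner_conj[OF g(1), of v u] g(2) assms(3) by (simp add: w_def inner_commute)
  then have w2: "w $ 2 = 0" by (simp add: inner_quat qi_def)
  \<comment> \<open>\<open>w\<close> lies in the plane of \<open>qj\<close> and \<open>qk\<close>,
    so the intertwiner \<open>q1 - qj \<star> w\<close> has only a real and a \<open>qi\<close>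
    part: it carries \<open>w\<close> to \<open>qj\<close> and leaves \<open>qi\<close>
    fixed.\<close>
  have "\<exists>h. norm h = 1 \<and> h \<star> w \<star> qcnj h = qj \<and> h \<star> qi \<star> qcnj h = qi"
  proof (cases "w = - qj")
    case True
    then show ?thesis by (intro exI[of _ qi]) (simp, simp add: qexpand qbase)
  next
    case False
    then have "qj \<noteq> - w" by (metis minus_minus)
    from pure_units_transitive_aux[OF w pure_units_qbase(2) this] obtain r where
      r: "norm (r *\<^sub>R (q1 - qj \<star> w)) = 1"
        "(r *\<^sub>R (q1 - qj \<star> w)) \<star> w \<star> qcnj (r *\<^sub>R (q1 - qj \<star> w)) = qj" by blast
    define h where "h = r *\<^sub>R (q1 - qj \<star> w)"
    have "h \<star> qi = qi \<star> h"
      using w w2 by (simp add: h_def qmul_simps) (simp add: qexpand qbase)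
    then have "h \<star> qi \<star> qcnj h = qi" using r(1) unfolding h_def[symmetric] by simp
    then show ?thesis using r unfolding h_def[symmetric] by blast
  qed
  then obtain h where h: "norm h = 1" "h \<star> w \<star> qcnj h = qj" "h \<star> qi \<star> qcnj h = qi" by blast
  show ?thesis
  proof (rule that[of "h \<star> g"])
    show "h \<star> g \<star> u \<star> qcnj (h \<star> g) = qi" using h(3) unfolding g(2)[symmetric] by (simp add: qmul_assoc)
    show "h \<star> g \<star> v \<star> qcnj (h \<star> g) = qj" using h(2) unfolding w_def by (simp add: qmul_assoc)
  qed (use g h in simp)
qed

text \<open>Gram-Schmidt reduces the claim to an orthonormal pair. The outcome is a normal form in
  which the inner product is the only invariant of two non-parallel axes.\<close>

lemma pure_units_pair_transitive_ij:
  assumes u: "u \<in> pure_units" and v: "v \<in> pure_units" and b: "\<bar>u \<bullet> v\<bar> < 1"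
  obtains g where "norm g = 1" "g \<star> u \<star> qcnj g = qi"
    "g \<star> v \<star> qcnj g = (u \<bullet> v) *\<^sub>R qi + sqrt (1 - (u \<bullet> v)\<^sup>2) *\<^sub>R qj"
proof -
  define c where "c = u \<bullet> v"
  define s where "s = sqrt (1 - c\<^sup>2)"
  have "c\<^sup>2 < 1" using b by (simp add: c_def abs_square_less_1)
  then have s: "s > 0" "s\<^sup>2 = 1 - c\<^sup>2" by (simp_all add: s_def)
  define w where "w = (1 / s) *\<^sub>R (v - c *\<^sub>R u)"
  have "(v - c *\<^sub>R u) \<bullet> (v - c *\<^sub>R u) = s\<^sup>2"
    using u v unfolding s(2)
    by (simp add: inner_diff_left inner_diff_right c_def inner_commute power2_eq_square)
  then have "norm (v - c *\<^sub>R u) = s" using s(1) by (simp only: norm_eq_sqrt_inner) simp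
  then have w: "w \<in> pure_units"
    using u v s(1) by (intro pure_unitsI) (simp_all add: w_def)
  have "u \<bullet> w = 0" using u by (simp add: w_def inner_diff_right c_def)
  from pure_units_pair_to_ij[OF u w this] obtain g where
    g: "norm g = 1" "g \<star> u \<star> qcnj g = qi" "g \<star> w \<star> qcnj g = qj" .
  have "v = c *\<^sub>R u + s *\<^sub>R w" using s by (simp add: w_def)
  then have "g \<star> v \<star> qcnj g = c *\<^sub>R (g \<star> u \<star> qcnj g) + s *\<^sub>R (g \<star> w \<star> qcnj g)"
    by (metis qmul.add_left qmul.add_right qmul.scaleR_left qmul.scaleR_right)
  then show ?thesis using that[of g] g by (simp add: c_def s_def)
qed

lemma pure_units_pair_transitive:
  assumes "u \<in> pure_units" "v \<in> pure_units" "u' \<in> pure_units" "v' \<in> pure_units"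
    and "\<bar>u \<bullet> v\<bar> < 1" "u \<bullet> v = u' \<bullet> v'"
  obtains g where "norm g = 1" "g \<star> u \<star> qcnj g = u'" "g \<star> v \<star> qcnj g = v'"
proof -
  obtain a where a: "norm a = 1" "a \<star> u \<star> qcnj a = qi"
    "a \<star> v \<star> qcnj a = (u \<bullet> v) *\<^sub>R qi + sqrt (1 - (u \<bullet> v)\<^sup>2) *\<^sub>R qj"
    using pure_units_pair_transitive_ij assms by blast
  obtain b where b: "norm b = 1" "b \<star> u' \<star> qcnj b = qi"
    "b \<star> v' \<star> qcnj b = (u \<bullet> v) *\<^sub>R qi + sqrt (1 - (u \<bullet> v)\<^sup>2) *\<^sub>R qj"
    using pure_units_pair_transitive_ij[of u' v'] assms by (metis)
  have *: "(qcnj b \<star> a) \<star> x \<star> qcnj (qcnj b \<star> a) = y"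
    if "a \<star> x \<star> qcnj a = b \<star> y \<star> qcnj b" for x y
  proof -
    have "(qcnj b \<star> a) \<star> x \<star> qcnj (qcnj b \<star> a) = qcnj b \<star> (a \<star> x \<star> qcnj a) \<star> b"
      by (simp add: qmul_assoc)
    also have "\<dots> = y" unfolding that using b(1) by (simp add: qmul_assoc)
    finally show ?thesis .
  qed
  show ?thesis
    by (rule that[of "qcnj b \<star> a"]) (use a b * in simp_all)
qed

section \<open>Groups of unit quaternions\<close>

definition unit_group :: "(real^4) set \<Rightarrow> bool" where
  "unit_group L \<longleftrightarrow> L \<subseteq> sphere 0 1 \<and> q1 \<in> L \<and> (\<forall>x\<in>L. \<forall>y\<in>L. x \<star> y \<in> L) \<and> (\<forall>x\<in>L. qcnj x \<in> L)"

lemma unit_groupD: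
  assumes "unit_group L"
  shows "x \<in> L \<Longrightarrow> norm x = 1" "q1 \<in> L" "x \<in> L \<Longrightarrow> y \<in> L \<Longrightarrow> x \<star> y \<in> L" "x \<in> L \<Longrightarrow> qcnj x \<in> L"
  using assms by (auto simp: unit_group_def)

lemma unit_group_conj: "unit_group L \<Longrightarrow> g \<in> L \<Longrightarrow> x \<in> L \<Longrightarrow> g \<star> x \<star> qcnj g \<in> L"
  by (simp add: unit_groupD)

lemma unit_group_minus: "unit_group L \<Longrightarrow> - q1 \<in> L \<Longrightarrow> x \<in> L \<Longrightarrow> - x \<in> L"
  using unit_groupD(3)[of L "- q1" x] by (simp add: qmul.minus_left)

definition conj_set :: "real^4 \<Rightarrow> (real^4) set \<Rightarrow> (real^4) set" where
  "conj_set c L = (\<lambda>x. c \<star> x \<star> qcnj c) ` L"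

lemma conj_setI: "x \<in> L \<Longrightarrow> c \<star> x \<star> qcnj c \<in> conj_set c L"
  by (simp add: conj_set_def)

lemma conj_inverse: "norm c = 1 \<Longrightarrow> qcnj c \<star> (c \<star> x \<star> qcnj c) \<star> c = x"
  by (simp add: qmul_assoc)

lemma conj_mult: "norm c = 1 \<Longrightarrow> (c \<star> x \<star> qcnj c) \<star> (c \<star> y \<star> qcnj c) = c \<star> (x \<star> y) \<star> qcnj c"
  by (simp add: qmul_assoc)

lemma conj_set_conj_set: "conj_set a (conj_set b L) = conj_set (a \<star> b) L"
  by (auto simp: conj_set_def image_image qmul_assoc)

lemma conj_set_inverse:
  assumes "norm c = 1"
  shows "conj_set (qcnj c) (conj_set c L) = L" "conj_set c (conj_set (qcnj c) L) = L"
  using assms by (simp_all add: conj_set_conj_set) (simp_all add: conj_set_def)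

lemma conj_set_sphere:
  assumes "norm c = 1"
  shows "conj_set c L = sphere 0 1 \<longleftrightarrow> L = sphere 0 1"
proof -
  have *: "conj_set a (sphere 0 1) \<subseteq> sphere 0 1" if "norm a = 1" for a
    using that by (auto simp: conj_set_def)
  have "conj_set c (sphere 0 1) = sphere 0 1"
  proof
    have "conj_set c (conj_set (qcnj c) (sphere 0 1)) \<subseteq> conj_set c (sphere 0 1)"
      unfolding conj_set_def[of c] by (rule image_mono) (use *[of "qcnj c"] assms in simp)
    then show "sphere 0 1 \<subseteq> conj_set c (sphere 0 1)" by (simp add: conj_set_inverse assms)
  qed (rule *[OF assms])
  then show ?thesis by (metis assms conj_set_inverse(1))
qed

lemma unit_group_conj_set:
  assumes "norm c = 1" "unit_group L"
  shows "unit_group (conj_set c L)"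
proof -
  have "q1 \<in> conj_set c L"
    using conj_setI[of q1 L c] assms by (simp add: unit_groupD(2))
  moreover have "x \<star> y \<in> conj_set c L" if "x \<in> conj_set c L" "y \<in> conj_set c L" for x y
    using that assms by (auto simp: conj_set_def conj_mult unit_groupD)
  moreover have "qcnj x \<in> conj_set c L" if x: "x \<in> conj_set c L" for x
  proof -
    obtain a where a: "a \<in> L" "x = c \<star> a \<star> qcnj c" using x by (auto simp: conj_set_def)
    then have "qcnj x = c \<star> qcnj a \<star> qcnj c" by (simp add: qmul_assoc)
    then show ?thesis using a assms by (auto simp: conj_set_def unit_groupD)
  qed
  ultimately show ?thesis
    using assms by (auto simp: unit_group_def conj_set_def)
qed

text \<open>\<open>(a, b)\<close> stands for the rotation
  \<open>x \<mapsto> a \<star> x \<star> qcnj b\<close>, with \<open>(- q1, - q1)\<close>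
  representing the identity. With \<open>L \<times> L\<close> or \<open>L \<times> {q1}\<close> the
  same lemmas serve single groups.\<close>

definition pair_group :: "((real^4) \<times> (real^4)) set \<Rightarrow> bool" where
  "pair_group H \<longleftrightarrow> H \<subseteq> sphere 0 1 \<times> sphere 0 1 \<and> (q1, q1) \<in> H \<and>
     (\<forall>a b c d. (a, b) \<in> H \<longrightarrow> (c, d) \<in> H \<longrightarrow> (a \<star> c, b \<star> d) \<in> H) \<and>
     (\<forall>a b. (a, b) \<in> H \<longrightarrow> (qcnj a, qcnj b) \<in> H)"

lemma pair_groupD:
  assumes "pair_group H"
  shows "(a, b) \<in> H \<Longrightarrow> norm a = 1" "(a, b) \<in> H \<Longrightarrow> norm b = 1" "(q1, q1) \<in> H"
    "(a, b) \<in> H \<Longrightarrow> (c, d) \<in> H \<Longrightarrow> (a \<star> c, b \<star> d) \<in> H" "(a, b) \<in> H \<Longrightarrow> (qcnj a, qcnj b) \<in> H"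
proof -
  have "H \<subseteq> sphere 0 1 \<times> sphere 0 1" using assms by (simp add: pair_group_def)
  then show "(a, b) \<in> H \<Longrightarrow> norm a = 1" "(a, b) \<in> H \<Longrightarrow> norm b = 1" by auto
qed (use assms[unfolded pair_group_def] in blast)+

lemma pair_group_cis_multiple:
  assumes H: "pair_group H" and u: "u \<in> pure_units" "v \<in> pure_units" and t: "(qcis u t, qcis v s) \<in> H"
  shows "(qcis u (of_int n * t), qcis v (of_int n * s)) \<in> H"
proof -
  have *: "(qcis u (real m * t), qcis v (real m * s)) \<in> H" for m
  proof (induction m)
    case (Suc m)
    then show ?case using pair_groupD(4)[OF H t Suc] u by (simp add: qcis_add algebra_simps)
  qed (use H in \<open>simp add: pair_groupD\<close>)
  show ?thesis
  proof (cases "n \<ge> 0")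
    case True
    then show ?thesis using *[of "nat n"] by simp
  next
    case False
    then show ?thesis using pair_groupD(5)[OF H *[of "nat (-n)"]] u by (simp add: qcnj_qcis)
  qed
qed

lemma unit_group_cis_multiple:
  assumes L: "unit_group L" and u: "u \<in> pure_units" and t: "qcis u t \<in> L"
  shows "qcis u (of_int n * t) \<in> L"
proof -
  have "pair_group (L \<times> L)"
    using unit_groupD[OF L] by (auto simp: pair_group_def)
  from pair_group_cis_multiple[OF this u u, of t t n] show ?thesis using t by simp
qed

text \<open>Such a group acts on imaginary space through the stabilizer of a line, a copy of O(2);
  cyclic, dihedral and circle groups are of this kind.\<close>

definition preserves_line :: "(real^4) set \<Rightarrow> bool" where
  "preserves_line L \<longleftrightarrow> (\<exists>u\<in>pure_units. \<forall>g\<in>L. g \<star> u \<star> qcnj g = u \<or> g \<star> u \<star> qcnj g = - u)"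

section \<open>Criteria for a subgroup to be the whole 3-sphere\<close>

lemma unit_group_full:
  assumes L: "unit_group L" and "c < 1"
    and near: "\<And>q. norm q = 1 \<Longrightarrow> q $ 1 \<ge> c \<Longrightarrow> q \<in> L"
  shows "L = sphere 0 1"
proof
  show "L \<subseteq> sphere 0 1" using L by (simp add: unit_group_def)
  show "sphere 0 1 \<subseteq> L"
  proof
    fix g :: "real^4" assume "g \<in> sphere 0 1"
    then obtain u t where u: "u \<in> pure_units" and g: "g = qcis u t"
      by (metis unit_quat_polar mem_sphere_0)
    \<comment> \<open>Every \<open>g\<close> has roots arbitrarily close to \<open>q1\<close>:
      divide its polar angle by a large integer.\<close>
    have "(\<lambda>n. cos (t * inverse (real (Suc n)))) \<longlonglongrightarrow> cos (t * 0)"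
      by (intro tendsto_intros LIMSEQ_inverse_real_of_nat)
    then have "eventually (\<lambda>n. cos (t * inverse (real (Suc n))) > c) sequentially"
      using \<open>c < 1\<close> by (intro order_tendstoD(1)) auto
    then obtain n where "cos (t * inverse (real (Suc n))) > c"
      by (meson eventually_happens sequentially_bot)
    then have "qcis u (t * inverse (real (Suc n))) \<in> L"
      using u by (intro near) auto
    from unit_group_cis_multiple[OF L u this, of "int (Suc n)"]
    moreover have "of_int (int (Suc n)) * (t * inverse (real (Suc n))) = t" by simp
    ultimately show "g \<in> L" unfolding g by metis
  qed
qed

lemma conj_if_same_Re:
  assumes "norm p = 1" "norm q = 1" "p $ 1 = q $ 1"
  obtains g where "norm g = 1" "g \<star> p \<star> qcnj g = q"
proof -
  obtain u s where u: "u \<in> pure_units" "0 \<le> s" "s \<le> pi" "p = qcis u s"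
    using unit_quat_polar[OF assms(1)] .
  obtain v t where v: "v \<in> pure_units" "0 \<le> t" "t \<le> pi" "q = qcis v t"
    using unit_quat_polar[OF assms(2)] .
  have "s = t" using assms(3) u v cos_inj_pi by simp
  obtain g where "norm g = 1" "g \<star> u \<star> qcnj g = v" using pure_units_transitive[OF u(1) v(1)] .
  then show ?thesis using that[of g] u v \<open>s = t\<close> by (simp add: conj_qcis)
qed

lemma pure_units_with_inner:
  assumes u: "u \<in> pure_units" and "\<bar>d\<bar> \<le> 1"
  obtains w where "w \<in> pure_units" "u \<bullet> w = d"
proof -
  obtain g where g: "norm g = 1" "g \<star> qi \<star> qcnj g = u"
    using pure_units_transitive[OF pure_units_qbase(1) u] .
  define x where "x = quat 0 d (sqrt (1 - d\<^sup>2)) 0"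
  have d: "d\<^sup>2 \<le> 1" using assms(2) by (simp add: abs_square_le_1)
  then have "x \<bullet> x = 1" by (simp add: x_def inner_quat flip: power2_eq_square)
  then have x: "x \<in> pure_units" by (intro pure_unitsI) (simp_all add: norm_eq_1 x_def)
  have "u \<bullet> (g \<star> x \<star> qcnj g) = qi \<bullet> x"
    using inner_conj[OF g(1)] g(2) by metis
  then show ?thesis
    using that[of "g \<star> x \<star> qcnj g"] conj_pure_units[OF g(1) x]
    by (simp add: inner_quat qi_def x_def)
qed

text \<open>Products of \<open>k\<close> with inverses of its conjugates have real part
  \<open>(cos t)\<^sup>2 + (sin t)\<^sup>2 * d\<close>, where the cosine \<open>d\<close> between
  the axes takes every value in [-1, 1]. The real part is the only conjugation invariant, so
  \<open>K\<close> contains a neighbourhood of \<open>q1\<close>.\<close>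

lemma normal_noncentral_full:
  assumes K: "unit_group K" and normal: "\<And>a k. norm a = 1 \<Longrightarrow> k \<in> K \<Longrightarrow> a \<star> k \<star> qcnj a \<in> K"
    and k: "k \<in> K" "k \<noteq> q1" "k \<noteq> - q1"
  shows "K = sphere 0 1"
proof -
  obtain u t where u: "u \<in> pure_units" and kt: "k = qcis u t" "0 \<le> t" "t \<le> pi"
    using unit_quat_polar unit_groupD(1)[OF K k(1)] by metis
  have "t \<noteq> 0" "t \<noteq> pi" using k kt by auto
  then have s: "sin t > 0" using kt by (intro sin_gt_zero) auto
  define c where "c = 1 - 2 * (sin t)\<^sup>2"
  show ?thesis
  proof (rule unit_group_full[OF K])
    show "c < 1" using s by (simp add: c_def)
    fix q :: "real^4" assume q: "norm q = 1" "q $ 1 \<ge> c"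
    have q1: "q $ 1 \<le> 1" using component_le_norm_cart[of q 1] q by simp
    define d where "d = (q $ 1 - (cos t)\<^sup>2) / (sin t)\<^sup>2"
    have "q $ 1 - (cos t)\<^sup>2 \<le> (sin t)\<^sup>2" "- ((sin t)\<^sup>2) \<le> q $ 1 - (cos t)\<^sup>2"
      using q1 q(2) by (simp_all add: c_def cos_squared_eq)
    then have "\<bar>d\<bar> \<le> 1" using s by (simp add: d_def abs_le_iff divide_simps)
    from pure_units_with_inner[OF u this] obtain w where w: "w \<in> pure_units" "u \<bullet> w = d" .
    obtain g where g: "norm g = 1" "g \<star> u \<star> qcnj g = w" using pure_units_transitive[OF u w(1)] .
    then have wK: "qcis w t \<in> K"
      using normal[OF g(1) k(1)] by (simp add: kt conj_qcis)
    define p where "p = qcis u t \<star> qcnj (qcis w t)"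
    have p: "p \<in> K" using wK k kt K by (auto simp: p_def unit_groupD)
    have "p $ 1 = q $ 1"
      using s w u by (simp add: p_def qcnj_qcis Re_qcis_mul d_def) (simp add: power2_eq_square)
    then obtain h where "norm h = 1" "h \<star> p \<star> qcnj h = q"
      using conj_if_same_Re q(1) unit_groupD(1)[OF K p] by metis
    then show "q \<in> K" using normal p by metis
  qed
qed

lemma rotate_plane:
  fixes a b e f :: real
  assumes "a\<^sup>2 + b\<^sup>2 = e\<^sup>2 + f\<^sup>2"
  obtains t where "a = e * cos t - f * sin t" "b = e * sin t + f * cos t"
proof -
  obtain r s where rs: "Complex a b = rcis r s" "r = cmod (Complex a b)" by (metis rcis_cmod_Arg)
  obtain r' s' where rs': "Complex e f = rcis r' s'" "r' = cmod (Complex e f)" by (metis rcis_cmod_Arg)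
  have "cmod (Complex a b) = cmod (Complex e f)" using assms by (simp add: cmod_def)
  then have "r = r'" using rs(2) rs'(2) by simp
  then have *: "Complex a b = Complex e f * cis (s - s')"
    unfolding rs(1) rs'(1) by (simp add: rcis_def cis_mult)
  show ?thesis
    by (rule that[of "s - s'"]) (use arg_cong[OF *, of Re] arg_cong[OF *, of Im] in \<open>simp_all add: algebra_simps\<close>)
qed

text \<open>Euler angles: multiplication by \<open>qcis qi x\<close> on the left and
  \<open>qcis qi y\<close> on the right turns the plane of \<open>q1\<close> and \<open>qi\<close>
  by \<open>x + y\<close> and the plane of \<open>qj\<close> and \<open>qk\<close> by
  \<open>x - y\<close>. So it is enough to find a point of the second circle whose projections to
  the two planes are as long as those of \<open>q\<close>.\<close>

lemma two_circles_full_aux: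
  assumes L: "unit_group L" and i: "\<And>x. qcis qi x \<in> L"
    and v: "\<And>x. qcis (c *\<^sub>R qi + sqrt (1 - c\<^sup>2) *\<^sub>R qj) x \<in> L" and c: "\<bar>c\<bar> < 1"
  shows "L = sphere 0 1"
proof (rule unit_group_full[OF L c])
  fix q :: "real^4" assume q: "norm q = 1" "\<bar>c\<bar> \<le> q $ 1"
  have c2: "c\<^sup>2 < 1" using c by (simp add: abs_square_less_1)
  have nq: "(q $ 1)\<^sup>2 + (q $ 2)\<^sup>2 + (q $ 3)\<^sup>2 + (q $ 4)\<^sup>2 = 1"
    using q(1) by (simp add: norm_eq_1 inner_quat power2_eq_square)
  have "c\<^sup>2 \<le> (q $ 1)\<^sup>2" using q(2) by (simp add: abs_le_square_iff[symmetric])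
  \<comment> \<open>\<open>d\<close> is the squared cosine of the parameter on the second circle:
    there the squared length in the first plane is \<open>d + c\<^sup>2 * (1 - d)\<close>, which
    runs from \<open>c\<^sup>2\<close> to 1. This explains the threshold
    \<open>\<bar>c\<bar>\<close> for the real part.\<close>
  define d where "d = ((q $ 1)\<^sup>2 + (q $ 2)\<^sup>2 - c\<^sup>2) / (1 - c\<^sup>2)"
  have "(q $ 1)\<^sup>2 + (q $ 2)\<^sup>2 \<le> 1" using nq zero_le_power2[of "q $ 3"] zero_le_power2[of "q $ 4"] by linarith
  then have d: "0 \<le> d" "d \<le> 1"
    using \<open>c\<^sup>2 \<le> (q $ 1)\<^sup>2\<close> c2 by (simp_all add: d_def add_increasing2)
  define t where "t = arccos (sqrt d)"
  have "sqrt d \<le> 1" using d by simp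
  moreover have "-1 \<le> sqrt d" using real_sqrt_ge_zero[OF d(1)] by linarith
  ultimately have t: "(cos t)\<^sup>2 = d" using d by (simp add: t_def)
  define s where "s = sqrt (1 - c\<^sup>2)"
  have s: "s\<^sup>2 = 1 - c\<^sup>2" using c2 by (simp add: s_def)
  define p where "p = qcis (c *\<^sub>R qi + s *\<^sub>R qj) t"
  have p: "p $ 1 = cos t" "p $ 2 = c * sin t" "p $ 3 = s * sin t" "p $ 4 = 0"
    by (simp_all add: p_def qcis_def qbase)
  have pd: "d * (1 - c\<^sup>2) = (q $ 1)\<^sup>2 + (q $ 2)\<^sup>2 - c\<^sup>2" using c2 by (simp add: d_def)
  have 1: "(q $ 1)\<^sup>2 + (q $ 2)\<^sup>2 = (p $ 1)\<^sup>2 + (p $ 2)\<^sup>2"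
    using pd by (simp add: p power_mult_distrib t sin_squared_eq algebra_simps)
  have "(p $ 3)\<^sup>2 = (1 - c\<^sup>2) * (1 - d)"
    by (simp add: p power_mult_distrib t sin_squared_eq s)
  also have "\<dots> = 1 - (q $ 1)\<^sup>2 - (q $ 2)\<^sup>2"
    using pd by (simp add: algebra_simps)
  finally have 2: "(q $ 3)\<^sup>2 + (q $ 4)\<^sup>2 = (p $ 3)\<^sup>2 + (p $ 4)\<^sup>2"
    using nq by (simp add: p)
  obtain \<theta> where th: "q $ 1 = p $ 1 * cos \<theta> - p $ 2 * sin \<theta>" "q $ 2 = p $ 1 * sin \<theta> + p $ 2 * cos \<theta>"
    using rotate_plane[OF 1] .
  obtain \<eta> where et: "q $ 3 = p $ 3 * cos \<eta> - p $ 4 * sin \<eta>" "q $ 4 = p $ 3 * sin \<eta> + p $ 4 * cos \<eta>"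
    using rotate_plane[OF 2] .
  define x where "x = (\<theta> + \<eta>) / 2"
  define y where "y = (\<theta> - \<eta>) / 2"
  have xy: "\<theta> = x + y" "\<eta> = x - y" by (simp_all add: x_def y_def field_simps)
  have "q = qcis qi x \<star> p \<star> qcis qi y"
    unfolding quat_eq_iff th et xy by (simp add: qmul_def qcis_def qbase p(4) cos_add sin_add cos_diff sin_diff algebra_simps)
  moreover have "p \<in> L" using v by (simp add: p_def s_def)
  ultimately show "q \<in> L" using i L by (simp add: unit_groupD)
qed

lemma circle_not_preserved_full:
  assumes L: "unit_group L" and u: "u \<in> pure_units" and circ: "\<And>x. qcis u x \<in> L"
    and g: "g \<in> L" "g \<star> u \<star> qcnj g \<noteq> u" "g \<star> u \<star> qcnj g \<noteq> - u"
  shows "L = sphere 0 1"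
proof -
  define v where "v = g \<star> u \<star> qcnj g"
  have ng: "norm g = 1" using L g unit_groupD by blast
  then have v: "v \<in> pure_units" using u conj_pure_units by (simp add: v_def)
  have cv: "qcis v x \<in> L" for x
    using unit_group_conj[OF L g(1) circ[of x]] ng by (simp add: v_def conj_qcis)
  have "\<bar>u \<bullet> v\<bar> \<noteq> 1" using pure_units_inner_eq_1[OF u v] g by (auto simp: v_def)
  then have c: "\<bar>u \<bullet> v\<bar> < 1" using pure_units_inner_bound[OF u v] by simp
  obtain a where a: "norm a = 1" "a \<star> u \<star> qcnj a = qi"
    "a \<star> v \<star> qcnj a = (u \<bullet> v) *\<^sub>R qi + sqrt (1 - (u \<bullet> v)\<^sup>2) *\<^sub>R qj"
    using pure_units_pair_transitive_ij[OF u v c] .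
  have "conj_set a L = sphere 0 1"
  proof (rule two_circles_full_aux[OF _ _ _ c])
    show "unit_group (conj_set a L)" using a L by (simp add: unit_group_conj_set)
    show "qcis qi x \<in> conj_set a L" for x
      using conj_setI[OF circ[of x], of a] a by (simp add: conj_qcis)
    show "qcis ((u \<bullet> v) *\<^sub>R qi + sqrt (1 - (u \<bullet> v)\<^sup>2) *\<^sub>R qj) x \<in> conj_set a L" for x
      using conj_setI[OF cv[of x], of a] a by (simp add: conj_qcis)
  qed
  then show ?thesis using conj_set_sphere[OF a(1)] by blast
qed

section \<open>Circle subgroups of closed groups\<close>

lemma compact_pure_units: "compact pure_units"
proof -
  have "pure_units = sphere 0 1 \<inter> {u. u $ 1 = 0}" unfolding pure_units_def by auto
  moreover have "closed {u :: real^4. u $ 1 = 0}"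
    by (intro closed_Collect_eq continuous_intros)
  ultimately show ?thesis by (metis compact_Int_closed compact_sphere)
qed

lemma unit_quat_polar_arccos:
  assumes "norm g = 1"
  obtains u where "u \<in> pure_units" "g = qcis u (arccos (g $ 1))"
  using assms by (metis unit_quat_polar qcis_nth_1 arccos_cos)

lemma arccos_Re_tendsto_0:
  fixes l :: "nat \<Rightarrow> real^4"
  assumes "l \<longlonglongrightarrow> q1" "\<And>n. norm (l n) = 1"
  shows "(\<lambda>n. arccos (l n $ 1)) \<longlonglongrightarrow> 0"
proof -
  have "(\<lambda>n. l n $ 1) \<longlonglongrightarrow> q1 $ 1" using assms(1) by (rule tendsto_vec_nth)
  then have "(\<lambda>n. l n $ 1) \<longlonglongrightarrow> 1" by (simp add: q1_def)
  moreover have "l n $ 1 \<in> {-1..1}" for n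
    using component_le_norm_cart[of "l n" 1] assms(2)[of n] by auto
  ultimately have "(\<lambda>n. arccos (l n $ 1)) \<longlonglongrightarrow> arccos 1"
    by (intro continuous_on_tendsto_compose[OF continuous_on_arccos']) auto
  then show ?thesis by simp
qed

text \<open>A direct substitute for the closed subgroup theorem. In polar form the axes and the
  ratio of the two angles converge along a subsequence, and suitable powers then converge to any
  point of the limiting one-parameter group. Dividing by the sum of both angles keeps the limit
  nontrivial even if one component shrinks much faster than the other.\<close>

lemma pair_group_one_parameter:
  assumes H: "pair_group H" and "closed H"
    and near: "\<And>\<epsilon>. \<epsilon> > 0 \<Longrightarrow> \<exists>l r. (l, r) \<in> H \<and> (l, r) \<noteq> (q1, q1) \<and> dist l q1 < \<epsilon> \<and> dist r q1 < \<epsilon>"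
  obtains u v \<kappa> \<mu> where "u \<in> pure_units" "v \<in> pure_units" "0 \<le> \<kappa>" "0 \<le> \<mu>" "\<kappa> + \<mu> = 1"
    "\<And>x. (qcis u (\<kappa> * x), qcis v (\<mu> * x)) \<in> H"
proof -
  have "\<forall>n. \<exists>l r. (l, r) \<in> H \<and> (l, r) \<noteq> (q1, q1) \<and> dist l q1 < inverse (real (Suc n)) \<and> dist r q1 < inverse (real (Suc n))"
    by (intro allI near) simp
  then obtain l r where lr: "\<And>n. (l n, r n) \<in> H" "\<And>n. (l n, r n) \<noteq> (q1, q1)"
      "\<And>n. dist (l n) q1 < inverse (real (Suc n))" "\<And>n. dist (r n) q1 < inverse (real (Suc n))"
    by metis
  have conv: "f \<longlonglongrightarrow> q1" if "\<And>n. dist (f n) q1 < inverse (real (Suc n))" for f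
    unfolding tendsto_dist_iff[of f]
    by (rule real_tendsto_sandwich[OF _ _ tendsto_const LIMSEQ_inverse_real_of_nat])
      (use that in \<open>auto intro!: always_eventually simp: less_imp_le simp del: of_nat_Suc\<close>)
  have nrm: "norm (l n) = 1" "norm (r n) = 1" for n using lr(1) H pair_groupD by blast+
  define t where "t n = arccos (l n $ 1)" for n
  define s where "s n = arccos (r n $ 1)" for n
  define \<rho> where "\<rho> n = t n + s n" for n
  have t0: "t \<longlonglongrightarrow> 0" "s \<longlonglongrightarrow> 0"
    unfolding t_def s_def using arccos_Re_tendsto_0 conv lr nrm by metis+
  then have \<rho>0: "\<rho> \<longlonglongrightarrow> 0" unfolding \<rho>_def using tendsto_add by fastforce
  have comp: "\<bar>l n $ 1\<bar> \<le> 1" "\<bar>r n $ 1\<bar> \<le> 1" for n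
    using component_le_norm_cart[of "l n" 1] component_le_norm_cart[of "r n" 1] nrm by simp_all
  then have pos: "t n \<ge> 0" "s n \<ge> 0" for n
    by (auto simp: t_def s_def abs_le_iff intro!: arccos_lbound)
  have "\<exists>a b. a \<in> pure_units \<and> b \<in> pure_units \<and> l n = qcis a (t n) \<and> r n = qcis b (s n)" for n
    unfolding t_def s_def using unit_quat_polar_arccos nrm by metis
  then obtain a b where ab: "\<And>n. a n \<in> pure_units" "\<And>n. b n \<in> pure_units"
     "\<And>n. l n = qcis (a n) (t n)" "\<And>n. r n = qcis (b n) (s n)"
    by metis
  have \<rho>: "\<rho> n > 0" for n
  proof -
    have "t n \<noteq> 0 \<or> s n \<noteq> 0" using lr(2)[of n] ab by auto
    then show ?thesis using pos[of n] by (auto simp: \<rho>_def)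
  qed
  define z where "z n = (a n, b n, t n / \<rho> n)" for n
  have "compact (pure_units \<times> pure_units \<times> {0..1::real})"
    by (intro compact_Times compact_pure_units compact_Icc)
  moreover have "\<And>n. z n \<in> pure_units \<times> pure_units \<times> {0..1::real}"
    using ab pos \<rho> by (auto simp: z_def divide_simps) (auto simp: \<rho>_def)
  ultimately obtain z' k where z': "z' \<in> pure_units \<times> pure_units \<times> {0..1::real}" "strict_mono (k :: nat \<Rightarrow> nat)" "(z \<circ> k) \<longlonglongrightarrow> z'"
    unfolding compact_def by metis
  obtain u v \<kappa> where uv: "z' = (u, v, \<kappa>)" by (metis prod_cases3)
  have lim: "(\<lambda>n. a (k n)) \<longlonglongrightarrow> u" "(\<lambda>n. b (k n)) \<longlonglongrightarrow> v" "(\<lambda>n. t (k n) / \<rho> (k n)) \<longlonglongrightarrow> \<kappa>"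
    using tendsto_fst[OF z'(3)] tendsto_fst[OF tendsto_snd[OF z'(3)]] tendsto_snd[OF tendsto_snd[OF z'(3)]]
    by (simp_all add: uv z_def o_def)
  have "s n / \<rho> n = 1 - t n / \<rho> n" for n using \<rho>[of n] by (simp add: field_simps \<rho>_def)
  then have lims: "(\<lambda>n. s (k n) / \<rho> (k n)) \<longlonglongrightarrow> 1 - \<kappa>"
    using tendsto_diff[OF tendsto_const lim(3)] by simp
  have \<rho>k: "(\<lambda>n. \<rho> (k n)) \<longlonglongrightarrow> 0" using LIMSEQ_subseq_LIMSEQ[OF \<rho>0 z'(2)] by (simp add: o_def)
  have "(qcis u (\<kappa> * x), qcis v ((1 - \<kappa>) * x)) \<in> H" for x
  proof -
    \<comment> \<open>The exponent brings the total angle \<open>m n * \<rho> (k n)\<close> to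
      within one step \<open>\<rho> (k n)\<close> of \<open>x\<close>.\<close>
    define m where "m n = \<lfloor>x / \<rho> (k n)\<rfloor>" for n
    have m: "\<bar>of_int (m n) * \<rho> (k n) - x\<bar> \<le> \<rho> (k n)" for n
    proof -
      have "of_int (m n) \<le> x / \<rho> (k n)" "x / \<rho> (k n) \<le> of_int (m n) + 1" unfolding m_def by linarith+
      then show ?thesis using \<rho>[of "k n"] by (simp add: field_simps abs_le_iff)
    qed
    have "(\<lambda>n. of_int (m n) * \<rho> (k n) - x) \<longlonglongrightarrow> 0"
      by (rule Lim_null_comparison[OF _ \<rho>k]) (use m in auto)
    then have mx: "(\<lambda>n. of_int (m n) * \<rho> (k n)) \<longlonglongrightarrow> x" by (simp add: LIM_zero_iff)
    have lim': "(\<lambda>n. of_int (m n) * f (k n)) \<longlonglongrightarrow> c * x" if "(\<lambda>n. f (k n) / \<rho> (k n)) \<longlonglongrightarrow> c" for f c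
    proof -
      have "of_int (m n) * f (k n) = (f (k n) / \<rho> (k n)) * (of_int (m n) * \<rho> (k n))" for n
        using \<rho>[of "k n"] by simp
      then show ?thesis using tendsto_mult[OF that mx] by simp
    qed
    have lm: "(\<lambda>n. (qcis (a (k n)) (of_int (m n) * t (k n)), qcis (b (k n)) (of_int (m n) * s (k n))))
       \<longlonglongrightarrow> (qcis u (\<kappa> * x), qcis v ((1 - \<kappa>) * x))"
      unfolding qcis_def by (intro tendsto_intros lim' lims lim)
    have "\<And>n. (qcis (a (k n)) (of_int (m n) * t (k n)), qcis (b (k n)) (of_int (m n) * s (k n))) \<in> H"
      using pair_group_cis_multiple[OF H ab(1,2)] lr(1) ab(3,4) by metis
    then show ?thesis by (rule closed_sequentially[OF \<open>closed H\<close> _ lm])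
  qed
  then show ?thesis using that[of u v \<kappa> "1 - \<kappa>"] z'(1) by (simp add: uv)
qed

lemma unit_group_one_parameter:
  assumes L: "unit_group L" and "closed L"
    and near: "\<And>\<epsilon>. \<epsilon> > 0 \<Longrightarrow> \<exists>l\<in>L. l \<noteq> q1 \<and> dist l q1 < \<epsilon>"
  obtains u where "u \<in> pure_units" "\<And>x. qcis u x \<in> L"
proof -
  have "pair_group (L \<times> {q1})" using L by (auto simp: pair_group_def unit_group_def)
  moreover have "closed (L \<times> {q1})" using \<open>closed L\<close> by (simp add: closed_Times)
  moreover have "\<exists>l r. (l, r) \<in> L \<times> {q1} \<and> (l, r) \<noteq> (q1, q1) \<and> dist l q1 < \<epsilon> \<and> dist r q1 < \<epsilon>" if "\<epsilon> > 0" for \<epsilon>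
    using near[OF that] that by auto
  ultimately obtain u v \<kappa> \<mu> where *: "u \<in> pure_units" "v \<in> pure_units" "0 \<le> \<kappa>" "0 \<le> \<mu>" "\<kappa> + \<mu> = 1"
      "\<And>x. (qcis u (\<kappa> * x), qcis v (\<mu> * x)) \<in> L \<times> {q1}"
    using pair_group_one_parameter[of "L \<times> {q1}"] by metis
  \<comment> \<open>The second component is constantly \<open>q1\<close>, so its speed must vanish;
    otherwise it would reach \<open>- q1\<close>.\<close>
  have "\<mu> = 0"
  proof (rule ccontr)
    assume "\<mu> \<noteq> 0"
    then have "qcis v pi = q1" using *(6)[of "pi / \<mu>"] by simp
    then show False by (simp add: quat_eq_iff q1_def)
  qed
  then show ?thesis using that[of u] * by simp
qed

section \<open>The binary polyhedral groups\<close>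

definition phi :: real where "phi = (1 + sqrt 5) / 2"

lemma phi_sq: "phi * phi = phi + 1"
  by (simp add: phi_def field_simps)

lemma phi_bounds: "1.618 < phi" "phi < 1.6181"
proof -
  have "2.236 < sqrt 5" by (rule real_less_rsqrt) (simp add: power2_eq_square)
  moreover have "sqrt 5 < 2.2362" by (rule real_less_lsqrt) (simp_all add: power2_eq_square)
  ultimately show "1.618 < phi" "phi < 1.6181" by (simp_all add: phi_def)
qed

lemma sqrt_2_bounds: "1.4142 < sqrt 2" "sqrt 2 < 1.4143"
  by (rule real_less_rsqrt, simp add: power2_eq_square, rule real_less_lsqrt, simp_all add: power2_eq_square)

lemma cos_pi_fifth: "cos (pi / 5) = phi / 2"
proof -
  define c where "c = cos (pi / 5)"
  have c0: "c > 0" unfolding c_def by (rule cos_gt_zero) auto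
  \<comment> \<open>Three and two fifths of \<open>pi\<close> add up to \<open>pi\<close>. The
    resulting cubic for the cosine has the extraneous root -1, which is split off below.\<close>
  have "cos (3 * (pi / 5)) = - cos (2 * (pi / 5))"
    using cos_minus_pi[of "2 * (pi / 5)"] cos_minus[of "2 * (pi / 5) - pi"] by (simp add: field_simps)
  then have "4 * c ^ 3 - 3 * c = - (2 * c\<^sup>2 - 1)"
    unfolding cos_treble_cos cos_double_cos c_def .
  then have "(c + 1) * (4 * c\<^sup>2 - 2 * c - 1) = 0"
    by (simp add: algebra_simps power2_eq_square power3_eq_cube)
  then have "4 * c\<^sup>2 - 2 * c - 1 = 0" using c0 by simp
  then have "(4 * c - 1)\<^sup>2 = 5" by (simp add: power2_eq_square algebra_simps)
  then have "(4 * c - 1)\<^sup>2 = (sqrt 5)\<^sup>2" by simp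
  then have "4 * c - 1 = sqrt 5 \<or> 4 * c - 1 = - sqrt 5" by (simp only: power2_eq_iff)
  moreover have "4 * c - 1 \<noteq> - sqrt 5" using c0 phi_bounds(1) by (auto simp: phi_def)
  ultimately show ?thesis by (simp add: c_def phi_def)
qed

lemma sin_pi_fifth_sq: "(sin (pi / 5))\<^sup>2 = (3 - phi) / 4"
  by (subst sin_squared_eq) (use phi_sq in \<open>simp add: cos_pi_fifth power2_eq_square field_simps\<close>)

lemma cos_two_pi_fifths: "cos (2 * pi / 5) = (phi - 1) / 2"
proof -
  have "cos (2 * pi / 5) = 2 * (phi / 2)\<^sup>2 - 1"
    using cos_double_cos[of "pi / 5"] by (simp add: cos_pi_fifth)
  also have "\<dots> = (phi - 1) / 2" using phi_sq by (simp add: power2_eq_square field_simps)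
  finally show ?thesis .
qed

text \<open>This normalizes the icosahedron vertex \<open>(0, 1, phi)\<close> and its variants, as
  \<open>1 + phi\<^sup>2 = phi + 2\<close>.\<close>

definition ico_h :: real where "ico_h = 1 / sqrt (phi + 2)"

lemma ico_h_sq: "ico_h * ico_h * (phi + 2) = 1" and ico_h_pos: "ico_h > 0"
  using phi_bounds by (simp_all add: ico_h_def flip: real_sqrt_mult)

lemma ico_h_sin: "ico_h * sin (pi / 5) = (phi - 1) / 2"
proof -
  have "(ico_h * sin (pi / 5))\<^sup>2 = ico_h * ico_h * ((3 - phi) / 4)"
    by (simp add: power_mult_distrib sin_pi_fifth_sq power2_eq_square[of ico_h])
  also have "3 - phi = (phi + 2) * (phi - 1)\<^sup>2"
    using phi_sq by (simp add: power2_eq_square algebra_simps)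
  also have "ico_h * ico_h * ((phi + 2) * (phi - 1)\<^sup>2 / 4) = (ico_h * ico_h * (phi + 2)) * ((phi - 1) / 2)\<^sup>2"
    by (simp add: power2_eq_square)
  finally have "(ico_h * sin (pi / 5))\<^sup>2 = ((phi - 1) / 2)\<^sup>2" by (simp add: ico_h_sq)
  moreover have "0 \<le> ico_h * sin (pi / 5)"
    using ico_h_pos by (intro mult_nonneg_nonneg sin_ge_zero) auto
  ultimately show ?thesis by (rule power2_eq_imp_eq) (use phi_bounds in simp)
qed

lemma ico_axis_pure: "quat 0 0 ico_h (phi * ico_h) \<in> pure_units" "quat 0 0 (- ico_h) (phi * ico_h) \<in> pure_units"
proof -
  have "ico_h * ico_h + phi * ico_h * (phi * ico_h) = ico_h * ico_h * (1 + phi * phi)"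
    by (simp add: algebra_simps)
  also have "\<dots> = 1" using ico_h_sq by (simp add: phi_sq add.commute)
  finally show "quat 0 0 ico_h (phi * ico_h) \<in> pure_units" "quat 0 0 (- ico_h) (phi * ico_h) \<in> pure_units"
    by (auto intro!: pure_unitsI simp: norm_eq_1 inner_quat)
qed

text \<open>These are the 24 Hurwitz units, the vertices of a 24-cell: eight on the coordinate axes
  and sixteen with all coordinates plus or minus 1/2.\<close>

definition binary_tetrahedral :: "(real^4) set" where
  "binary_tetrahedral = {x. norm x = 1 \<and> (\<forall>i. x $ i \<in> {0, 1/2, -1/2, 1, -1})}"

definition octahedral_axes :: "(real^4) set" where
  "octahedral_axes = {u \<in> pure_units. \<forall>i. u $ i \<in> {0, 1, -1}}"

text \<open>The twelve vertices of a regular icosahedron, that is, its oriented 5-fold axes; the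
  absolute values absorb the signs.\<close>

definition icosahedral_axes :: "(real^4) set" where
  "icosahedral_axes = {u. u $ 1 = 0 \<and> (\<bar>u $ 2\<bar>, \<bar>u $ 3\<bar>, \<bar>u $ 4\<bar>) \<in>
     {(0, ico_h, phi * ico_h), (phi * ico_h, 0, ico_h), (ico_h, phi * ico_h, 0)}}"

text \<open>Intended as the elements of the group within angle \<open>pi / 4\<close> of
  \<open>q1\<close>; Hurwitz units as right factors then produce all the others.\<close>

definition octahedral_caps :: "(real^4) set" where
  "octahedral_caps = insert q1 ((\<lambda>v. qcis v (pi / 4)) ` octahedral_axes)"

definition icosahedral_caps :: "(real^4) set" where
  "icosahedral_caps = insert q1 ((\<lambda>v. qcis v (pi / 5)) ` icosahedral_axes)"

text \<open>Defined as plain sets of products: that they are groups is never proved directly, but follows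
  once such a set is identified with a conjugate of a given group.\<close>

definition binary_octahedral :: "(real^4) set" where
  "binary_octahedral = {e \<star> t |e t. e \<in> octahedral_caps \<and> t \<in> binary_tetrahedral}"

definition binary_icosahedral :: "(real^4) set" where
  "binary_icosahedral = {e \<star> t |e t. e \<in> icosahedral_caps \<and> t \<in> binary_tetrahedral}"

abbreviation qw :: "real^4" where "qw \<equiv> quat (1/2) (1/2) (1/2) (1/2)"

lemma binary_tetrahedral_cases:
  assumes "x \<in> binary_tetrahedral"
  shows "x \<in> {q1, - q1, qi, - qi, qj, - qj, qk, - qk} \<or> (\<forall>i. \<bar>x $ i\<bar> = 1/2)"
proof -
  have n: "x $ 1 * x $ 1 + x $ 2 * x $ 2 + x $ 3 * x $ 3 + x $ 4 * x $ 4 = 1"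
    using assms by (simp add: binary_tetrahedral_def norm_eq_1 inner_quat)
  have c: "\<bar>x $ i\<bar> = 0 \<or> \<bar>x $ i\<bar> = 1/2 \<or> \<bar>x $ i\<bar> = 1" for i
    using assms by (auto simp: binary_tetrahedral_def)
  have s: "x $ i * x $ i = \<bar>x $ i\<bar> * \<bar>x $ i\<bar>" for i by simp
  have v: "(\<bar>x $ 1\<bar> = 1/2 \<and> \<bar>x $ 2\<bar> = 1/2 \<and> \<bar>x $ 3\<bar> = 1/2 \<and> \<bar>x $ 4\<bar> = 1/2) \<or>
     (\<bar>x $ 1\<bar> = 1 \<and> x $ 2 = 0 \<and> x $ 3 = 0 \<and> x $ 4 = 0) \<or>
     (x $ 1 = 0 \<and> \<bar>x $ 2\<bar> = 1 \<and> x $ 3 = 0 \<and> x $ 4 = 0) \<or>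
     (x $ 1 = 0 \<and> x $ 2 = 0 \<and> \<bar>x $ 3\<bar> = 1 \<and> x $ 4 = 0) \<or>
     (x $ 1 = 0 \<and> x $ 2 = 0 \<and> x $ 3 = 0 \<and> \<bar>x $ 4\<bar> = 1)"
    using c[of 1] c[of 2] c[of 3] c[of 4] n unfolding s
    by (elim disjE) simp_all
  have e: "(\<bar>y\<bar> = 1) = (y = 1 \<or> y = -1)" for y :: real by auto
  show ?thesis
    using v by (auto simp: quat_eq_iff forall_4 qbase e)
qed

lemma binary_tetrahedral_subset:
  assumes L: "unit_group L" and m: "- q1 \<in> L" and g: "qi \<in> L" "qj \<in> L" "qw \<in> L"
  shows "binary_tetrahedral \<subseteq> L"
proof
  fix x assume x: "x \<in> binary_tetrahedral"
  have neg: "- y \<in> L" if "y \<in> L" for y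
    using unit_group_minus[OF L m that] .
  have "qi \<star> qj = qk" by (simp add: qexpand qbase)
  then have k: "qk \<in> L" using g L by (metis unit_groupD(3))
  have w: "qcnj qw \<in> L" using g L by (simp add: unit_groupD)
  have mult: "y \<star> z \<in> L" if "y \<in> L" "z \<in> L" for y z using that L by (simp add: unit_groupD)
  note halves = g(3) mult[OF g(3) g(1)] mult[OF g(3) g(2)] mult[OF g(3) k]
    w mult[OF w g(1)] mult[OF w g(2)] mult[OF w k]
  show "x \<in> L"
    using binary_tetrahedral_cases[OF x]
  proof
    assume "x \<in> {q1, - q1, qi, - qi, qj, - qj, qk, - qk}"
    then show ?thesis using L m g k neg unit_groupD(2)[OF L] by auto
  next
    assume h: "\<forall>i. \<bar>x $ i\<bar> = 1/2"
    have u: "- quat a b c d = quat (-a) (-b) (-c) (-d)" "qcnj (quat a b c d) = quat a (-b) (-c) (-d)" for a b c d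
      by (simp_all add: quat_eq_iff)
    have xq: "x = quat (x $ 1) (x $ 2) (x $ 3) (x $ 4)" by (simp add: quat_eq_iff)
    define h :: real where "h = 1/2"
    have pos: "quat h h h h \<in> L" "quat (-h) h h (-h) \<in> L" "quat (-h) (-h) h h \<in> L"
      "quat (-h) h (-h) h \<in> L" "quat h (-h) (-h) (-h) \<in> L" "quat h h (-h) h \<in> L"
      "quat h h h (-h) \<in> L" "quat h (-h) h h \<in> L"
      using halves by (simp_all add: qmul_def qbase u h_def)
    have all: "quat a b c d \<in> L" if "a \<in> {h,-h}" "b \<in> {h,-h}" "c \<in> {h,-h}" "d \<in> {h,-h}" for a b c d
      using that pos pos[THEN neg] unfolding u by auto
    have hx: "x $ i \<in> {h, - h}" for i
      using spec[OF h, of i] by (auto simp: h_def abs_if split: if_splits)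
    show ?thesis
      by (subst xq, rule all) (rule hx)+
  qed
qed

lemma binary_tetrahedral_qcnj:
  assumes "x \<in> binary_tetrahedral"
  shows "qcnj x \<in> binary_tetrahedral"
proof -
  have "qcnj x $ i \<in> {0, 1/2, -1/2, 1, -1}" for i
  proof -
    have "qcnj x $ i = x $ i \<or> qcnj x $ i = - x $ i" using exhaust_4[of i] by auto
    moreover have "x $ i \<in> {0, 1/2, -1/2, 1, -1}" using assms by (simp add: binary_tetrahedral_def)
    ultimately show ?thesis by auto
  qed
  then show ?thesis using assms by (simp add: binary_tetrahedral_def)
qed

text \<open>The covering radius of the 24-cell is \<open>pi / 4\<close>. Either some coordinate has
  size at least \<open>sqrt 2 / 2\<close> and a vertex on that axis is close, or all are smaller;
  then their absolute values add up to at least \<open>sqrt 2\<close>, and the vertex with matching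
  signs is close.\<close>

lemma binary_tetrahedral_covering:
  assumes "norm g = 1"
  obtains t where "t \<in> binary_tetrahedral" "(g \<star> t) $ 1 \<ge> sqrt 2 / 2"
proof -
  note witness = that
  have *: thesis if "s \<in> binary_tetrahedral" "g \<bullet> s \<ge> sqrt 2 / 2" for s
  proof (rule witness)
    show "qcnj s \<in> binary_tetrahedral" using that(1) by (rule binary_tetrahedral_qcnj)
    show "(g \<star> qcnj s) $ 1 \<ge> sqrt 2 / 2"
      using that(2) by (simp add: qmul_def inner_quat algebra_simps)
  qed
  show thesis
  proof (cases "\<exists>i. \<bar>g $ i\<bar> \<ge> sqrt 2 / 2")
    case True
    then obtain i where i: "\<bar>g $ i\<bar> \<ge> sqrt 2 / 2" ..
    define r where "r = (if g $ i \<ge> 0 then 1 else - 1 :: real)"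
    show thesis
    proof (rule *)
      show "axis i r \<in> binary_tetrahedral"
        by (auto simp: binary_tetrahedral_def norm_eq_1 inner_axis_axis r_def) (auto simp: axis_def split: if_splits)
      show "g \<bullet> axis i r \<ge> sqrt 2 / 2"
        using i by (auto simp: inner_axis r_def)
    qed
  next
    case False
    define s :: "real^4" where "s = (\<chi> i. if g $ i \<ge> 0 then 1/2 else -1/2)"
    show thesis
    proof (rule *)
      have "s \<bullet> s = 1" by (simp add: s_def inner_vec_def sum_4)
      then show "s \<in> binary_tetrahedral"
        by (auto simp: binary_tetrahedral_def norm_eq_1 s_def)
      have "1 = (\<Sum>i\<in>UNIV. \<bar>g $ i\<bar> * \<bar>g $ i\<bar>)"
        using assms by (simp add: norm_eq_1 inner_vec_def)
      also have "\<dots> \<le> (\<Sum>i\<in>UNIV. sqrt 2 / 2 * \<bar>g $ i\<bar>)"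
        using False by (intro sum_mono mult_right_mono) (auto simp: not_le less_imp_le)
      also have "\<dots> = sqrt 2 * (\<Sum>i\<in>UNIV. \<bar>g $ i\<bar> / 2)"
        by (simp add: sum_distrib_left)
      also have "(\<Sum>i\<in>UNIV. \<bar>g $ i\<bar> / 2) = g \<bullet> s"
        by (simp add: inner_vec_def s_def) (intro sum.cong; simp)
      finally have "1 \<le> sqrt 2 * (g \<bullet> s)" .
      then have "sqrt 2 * 1 \<le> sqrt 2 * (sqrt 2 * (g \<bullet> s))" by (intro mult_left_mono) auto
      moreover have "sqrt 2 * (sqrt 2 * (g \<bullet> s)) = (sqrt 2 * sqrt 2) * (g \<bullet> s)" by (simp only: mult.assoc)
      ultimately show "g \<bullet> s \<ge> sqrt 2 / 2" by simp
    qed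
  qed
qed

section \<open>Classification of closed groups of unit quaternions\<close>

text \<open>A tetrahedral factor moves every element into the cap around \<open>q1\<close>. Hence a
  group containing the Hurwitz units is known as soon as its elements of real part at least
  \<open>sqrt 2 / 2\<close> are.\<close>

lemma unit_group_eq_caps:
  assumes L: "unit_group L" and T: "binary_tetrahedral \<subseteq> L" and P: "P \<subseteq> L"
    and cap: "\<And>g. g \<in> L \<Longrightarrow> g $ 1 \<ge> sqrt 2 / 2 \<Longrightarrow> g \<in> P"
  shows "L = {e \<star> t |e t. e \<in> P \<and> t \<in> binary_tetrahedral}"
proof
  show "{e \<star> t |e t. e \<in> P \<and> t \<in> binary_tetrahedral} \<subseteq> L"
    using assms by (auto intro!: unit_groupD(3)[OF L])
  show "L \<subseteq> {e \<star> t |e t. e \<in> P \<and> t \<in> binary_tetrahedral}"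
  proof
    fix g assume g: "g \<in> L"
    obtain t where t: "t \<in> binary_tetrahedral" "(g \<star> t) $ 1 \<ge> sqrt 2 / 2"
      using binary_tetrahedral_covering unit_groupD(1)[OF L g] by blast
    have "g \<star> t \<in> P" using t T L g by (intro cap) (auto simp: unit_groupD)
    moreover have "qcnj t \<in> binary_tetrahedral"
      using t(1) by (rule binary_tetrahedral_qcnj)
    moreover have "g = (g \<star> t) \<star> qcnj t"
      using t(1) by (simp add: binary_tetrahedral_def)
    ultimately show "g \<in> {e \<star> t |e t. e \<in> P \<and> t \<in> binary_tetrahedral}" by blast
  qed
qed

text \<open>Pigeonhole in disguise: some multiple \<open>j t\<close> with \<open>j \<le> 5\<close> is within \<open>\<pi>/6\<close> of \<open>\<pi>\<int>\<close>, hence lies in it.\<close>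

lemma unit_group_angles:
  assumes L: "unit_group L" and m: "- q1 \<in> L"
    and gap: "\<And>g. g \<in> L \<Longrightarrow> \<bar>g $ 1\<bar> \<ge> sqrt 3 / 2 \<Longrightarrow> g = q1 \<or> g = - q1"
    and u: "u \<in> pure_units" and t: "qcis u t \<in> L" "0 < t" "t \<le> pi / 2"
  shows "t \<in> {pi / 2, pi / 3, pi / 4, pi / 5, 2 * pi / 5}"
proof -
  have far: "s = 0 \<or> \<bar>s\<bar> > pi / 6" if s: "qcis u s \<in> L" for s
  proof (rule ccontr)
    assume *: "\<not> (s = 0 \<or> \<bar>s\<bar> > pi / 6)"
    then have "cos (pi / 6) \<le> cos \<bar>s\<bar>" by (intro cos_monotone_0_pi_le) auto
    then have "\<bar>qcis u s $ 1\<bar> \<ge> sqrt 3 / 2" using u by (simp add: cos_30)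
    then have "qcis u s = q1 \<or> qcis u s = - q1" by (rule gap[OF s])
    then have "qcis u s $ 1 = q1 $ 1 \<or> qcis u s $ 1 = (- q1) $ 1" by metis
    then have "cos s = 1 \<or> cos s = - 1" using u by (simp add: q1_def)
    then have "(sin s)\<^sup>2 = 0" by (auto simp: sin_squared_eq)
    then have "sin s = 0" by simp
    moreover have "sin \<bar>s\<bar> > 0" using * by (intro sin_gt_zero) (auto intro: le_less_trans)
    ultimately show False by (simp add: abs_if split: if_splits)
  qed
  have shift: "qcis u (of_int j * t - pi) \<in> L" for j
  proof -
    have "qcis u (of_int j * t - pi) = - qcis u (of_int j * t)"
      by (simp add: qcis_def cos_diff sin_diff)
    also have "\<dots> = - q1 \<star> qcis u (of_int j * t)" by (simp add: qmul.minus_left)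
    finally show ?thesis using unit_groupD(3)[OF L m unit_group_cis_multiple[OF L u t(1)]] by simp
  qed
  have "qcis u (of_int j * t - 2 * pi) \<in> L" for j
  proof -
    have "qcis u (of_int j * t - 2 * pi) = qcis u (of_int j * t)"
      by (simp add: qcis_def cos_diff sin_diff)
    then show ?thesis using unit_group_cis_multiple[OF L u t(1)] by simp
  qed
  \<comment> \<open>For \<open>0 < t \<le> pi / 2\<close> at least one of these six angles is within
    \<open>pi / 6\<close> of 0 and must vanish. It cannot be \<open>t\<close>; the other five yield
    the five listed values, \<open>5 * t\<close> being compared both with \<open>pi\<close> and with
    \<open>2 * pi\<close>.\<close>
  note far' = far[OF t(1)] far[OF shift[of 2]] far[OF shift[of 3]] far[OF shift[of 4]]
    far[OF shift[of 5]] far[OF this[of 5]]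
  show ?thesis using far' t(2,3) pi_gt_zero by (simp only: of_int_numeral insert_iff empty_iff) argo
qed

text \<open>Conjugating the element of least angle to another axis and forming the commutator gives
  a noncentral element of real part \<open>1 - 2 * e\<close>. If the half-angle were at most
  \<open>pi / 6\<close>, then \<open>e \<le> (sin t)\<^sup>2 / 4\<close>, and this real part would
  exceed \<open>cos t\<close>, against maximality.\<close>

lemma unit_group_commutator_gap:
  assumes L: "unit_group L" and a: "a \<in> L" "0 \<le> a $ 1" "a \<noteq> q1"
    and max: "\<And>g. g \<in> L \<Longrightarrow> g \<noteq> q1 \<Longrightarrow> g \<noteq> - q1 \<Longrightarrow> \<bar>g $ 1\<bar> \<le> a $ 1"
    and not_line: "\<not> preserves_line L"
  shows "a $ 1 < sqrt 3 / 2"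
proof (rule ccontr)
  assume "\<not> a $ 1 < sqrt 3 / 2"
  then have ge: "a $ 1 \<ge> sqrt 3 / 2" by simp
  obtain u t where u: "u \<in> pure_units" and at: "a = qcis u t" "0 \<le> t" "t \<le> pi"
    using unit_quat_polar unit_groupD(1)[OF L a(1)] by metis
  obtain g where g: "g \<in> L" "g \<star> u \<star> qcnj g \<noteq> u" "g \<star> u \<star> qcnj g \<noteq> - u"
    using not_line u unfolding preserves_line_def by blast
  define v where "v = g \<star> u \<star> qcnj g"
  have ng: "norm g = 1" using L g unit_groupD by blast
  then have v: "v \<in> pure_units" using u conj_pure_units by (simp add: v_def)
  have b: "qcis v t \<in> L"
    using unit_group_conj[OF L g(1) a(1)] ng by (simp add: v_def conj_qcis at)
  have d: "(u \<bullet> v)\<^sup>2 < 1"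
  proof -
    have "\<bar>u \<bullet> v\<bar> \<noteq> 1" using pure_units_inner_eq_1[OF u v] g by (auto simp: v_def)
    then show ?thesis using pure_units_inner_bound[OF u v] by (simp add: abs_square_less_1)
  qed
  define c where "c = cos t"
  have c: "c = a $ 1" using u by (simp add: c_def at)
  have c3: "c\<^sup>2 \<ge> 3 / 4"
    using power_mono[OF ge, of 2] by (simp add: c power_divide)
  have "t \<noteq> 0" using a(3) at by auto
  moreover have "t \<noteq> pi" using a(2) c by (auto simp: c_def)
  ultimately have "sin t > 0" using at by (intro sin_gt_zero) auto
  then have s: "(sin t)\<^sup>2 > 0" by simp
  have s1: "(sin t)\<^sup>2 = 1 - c\<^sup>2" by (simp add: sin_squared_eq c_def)
  define k where "k = qcis u t \<star> qcis v t \<star> qcnj (qcis u t) \<star> qcnj (qcis v t)"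
  define e where "e = (sin t)\<^sup>2 * (sin t)\<^sup>2 * (1 - (u \<bullet> v)\<^sup>2)"
  have k1: "k $ 1 = 1 - 2 * e"
    using Re_qcis_commutator[OF u v, of t t] by (simp add: k_def e_def)
  have e0: "e > 0" using s d unfolding e_def by (intro mult_pos_pos) auto
  have "e \<le> (sin t)\<^sup>2 * (sin t)\<^sup>2 * 1" unfolding e_def by (intro mult_left_mono) auto
  then have e1: "e \<le> (1 - c\<^sup>2) * (1 - c\<^sup>2)" by (simp add: s1)
  have "(1 - c\<^sup>2) * (1 - c\<^sup>2) \<le> 1 / 4 * (1 - c\<^sup>2)"
    using c3 s s1 by (intro mult_right_mono) auto
  then have e2: "e \<le> (1 - c\<^sup>2) / 4" using e1 by simp
  then have "e \<le> 1 / 16" using c3 by simp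
  have "k \<in> L" using a b at L by (simp add: k_def unit_groupD)
  moreover have "k \<noteq> q1" "k \<noteq> - q1"
    using k1 e0 \<open>e \<le> 1 / 16\<close> by (auto simp: q1_def)
  ultimately have "\<bar>k $ 1\<bar> \<le> c" using max c by simp
  then have "1 - c \<le> (1 - c) * (1 + c) / 2"
    using k1 e2 by (simp add: power2_eq_square algebra_simps)
  moreover
  have "c < 1" using s s1 c a(2) by (simp add: power_less_one_iff)
  then have "(1 - c) * (1 - c) > 0" by simp
  ultimately show False by (simp add: algebra_simps)
qed

section \<open>Groups whose only elements near the centre are central\<close>

lemma pure_units_from_polar:
  assumes L: "unit_group L" and m: "- q1 \<in> L" and g: "g \<in> L"
  obtains u t where "u \<in> pure_units" "0 \<le> t" "t \<le> pi / 2" "qcis u t \<in> L" "\<bar>g $ 1\<bar> = cos t"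
    "g = qcis u t \<or> g = - qcis u t"
proof -
  obtain u t where u: "u \<in> pure_units" and gt: "g = qcis u t" "0 \<le> t" "t \<le> pi"
    using unit_quat_polar unit_groupD(1)[OF L g] by metis
  show ?thesis
  proof (cases "t \<le> pi / 2")
    case True
    then show ?thesis using that[OF u gt(2) True] g gt u by (simp add: cos_ge_zero)
  next
    case False
    have c: "qcis (- u) (pi - t) = - g" by (simp add: gt qcis_def)
    have "- g \<in> L" by (rule unit_group_minus[OF L m g])
    moreover have "\<bar>g $ 1\<bar> = cos (pi - t)"
      using False gt u cos_ge_zero[of "pi - t"] by simp
    ultimately show ?thesis using that[of "- u" "pi - t"] u gt False c by simp
  qed
qed

text \<open>Up to sign, \<open>a\<close> has the least angle among the noncentral elements; its
  order separates the cases. The gap is what the commutator estimate yields, stated as an assumption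
  that conjugate groups inherit.\<close>

locale gapped_group =
  fixes L :: "(real^4) set" and a :: "real^4"
  assumes L: "unit_group L" and minus_one: "- q1 \<in> L"
    and gap: "g \<in> L \<Longrightarrow> \<bar>g $ 1\<bar> \<ge> sqrt 3 / 2 \<Longrightarrow> g = q1 \<or> g = - q1"
    and a: "a \<in> L" "0 \<le> a $ 1" "a \<noteq> q1"
    and max: "g \<in> L \<Longrightarrow> g \<noteq> q1 \<Longrightarrow> g \<noteq> - q1 \<Longrightarrow> \<bar>g $ 1\<bar> \<le> a $ 1"
    and not_line: "\<not> preserves_line L"
begin

lemma minus: "g \<in> L \<Longrightarrow> - g \<in> L"
  by (rule unit_group_minus[OF L minus_one])

definition "axes t = {u \<in> pure_units. qcis u t \<in> L}"

lemma axes_minus: "u \<in> axes t \<Longrightarrow> - u \<in> axes t"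
  using unit_groupD(4)[OF L, of "qcis u t"] by (simp add: axes_def qcnj_qcis qcis_minus)

lemma axes_conj: "g \<in> L \<Longrightarrow> u \<in> axes t \<Longrightarrow> g \<star> u \<star> qcnj g \<in> axes t"
  using unit_group_conj[OF L, of g "qcis u t"] unit_groupD(1)[OF L, of g]
  by (simp add: axes_def conj_qcis conj_pure_units)

lemma Re_values:
  assumes "g \<in> L"
  shows "\<bar>g $ 1\<bar> \<in> {0, 1/2, sqrt 2 / 2, phi / 2, (phi - 1) / 2, 1}"
proof -
  obtain u t where u: "u \<in> pure_units" "0 \<le> t" "t \<le> pi / 2" "qcis u t \<in> L" "\<bar>g $ 1\<bar> = cos t"
    using pure_units_from_polar[OF L minus_one assms] by metis
  have "t = 0 \<or> t \<in> {pi / 2, pi / 3, pi / 4, pi / 5, 2 * pi / 5}"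
    using unit_group_angles[OF L minus_one gap u(1,4) _ u(3)] u(2) by fastforce
  then have "cos t \<in> {cos (pi / 2), cos (pi / 3), cos (pi / 4), cos (pi / 5), cos (2 * pi / 5), cos 0}"
    by blast
  then show ?thesis unfolding u(5) cos_60 cos_45 cos_pi_fifth cos_two_pi_fifths by simp
qed

text \<open>An element of half-angle \<open>2 * pi / 5\<close> has a square of half-angle
  \<open>4 * pi / 5\<close>, with real part \<open>- (phi / 2)\<close>. So this value never occurs
  without elements of half-angle at most \<open>pi / 5\<close>.\<close>

lemma Re_phi_minus_1:
  assumes "g \<in> L" "\<bar>g $ 1\<bar> = (phi - 1) / 2"
  shows "phi / 2 \<le> a $ 1"
proof -
  have n: "g $ 1 * g $ 1 + g $ 2 * g $ 2 + g $ 3 * g $ 3 + g $ 4 * g $ 4 = 1"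
    using unit_groupD(1)[OF L assms(1)] by (simp add: norm_eq_1 inner_quat)
  have "(g \<star> g) $ 1 = 2 * (\<bar>g $ 1\<bar> * \<bar>g $ 1\<bar>) - 1"
    using n by (simp add: qmul_def)
  also have "\<dots> = - (phi / 2)" unfolding assms(2) using phi_sq by (simp add: field_simps)
  finally have *: "(g \<star> g) $ 1 = - (phi / 2)" .
  then have "g \<star> g \<noteq> q1" "g \<star> g \<noteq> - q1"
    using phi_bounds by (auto simp: q1_def)
  then have "\<bar>(g \<star> g) $ 1\<bar> \<le> a $ 1" using assms(1) L by (intro max) (auto simp: unit_groupD)
  then show ?thesis using * phi_bounds by simp
qed

lemma Re_bound: "g \<in> L \<Longrightarrow> \<bar>g $ 1\<bar> = 1 \<or> \<bar>g $ 1\<bar> \<le> a $ 1"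
  using max[of g] by (cases "g = q1 \<or> g = - q1") (auto simp: q1_def)

lemma Re_a_values: "a $ 1 \<in> {0, 1/2, sqrt 2 / 2, phi / 2}"
proof -
  have "sqrt 3 \<le> 2" by (rule real_le_lsqrt) simp_all
  then have "a $ 1 \<noteq> 1" using gap[OF a(1)] a(2,3) by (auto simp: q1_def)
  moreover have "a $ 1 = (phi - 1) / 2 \<Longrightarrow> False" using Re_phi_minus_1[OF a(1)] phi_bounds by simp
  ultimately show ?thesis using Re_values[OF a(1)] a(2) by auto
qed

text \<open>As no line is preserved, some group element carries the axis of \<open>a\<close> to a
  non-parallel one.\<close>

lemma two_axes:
  assumes "a $ 1 = cos t" "0 < t" "t \<le> pi / 2"
  obtains u v where "u \<in> axes t" "v \<in> axes t" "\<bar>u \<bullet> v\<bar> < 1"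
proof -
  obtain u s where u: "u \<in> pure_units" and as: "a = qcis u s" "0 \<le> s" "s \<le> pi"
    using unit_quat_polar unit_groupD(1)[OF L a(1)] by metis
  have "s = t" using assms u as cos_inj_pi[of s t] by simp
  then have ut: "u \<in> axes t" using a(1) u as by (simp add: axes_def)
  obtain g where g: "g \<in> L" "g \<star> u \<star> qcnj g \<noteq> u" "g \<star> u \<star> qcnj g \<noteq> - u"
    using not_line u unfolding preserves_line_def by blast
  have v: "g \<star> u \<star> qcnj g \<in> axes t" using axes_conj g ut by blast
  then have "\<bar>u \<bullet> (g \<star> u \<star> qcnj g)\<bar> \<noteq> 1"
    using pure_units_inner_eq_1[OF u, of "g \<star> u \<star> qcnj g"] g by (auto simp: axes_def)
  then have "\<bar>u \<bullet> (g \<star> u \<star> qcnj g)\<bar> < 1"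
    using pure_units_inner_bound[OF u, of "g \<star> u \<star> qcnj g"] v by (auto simp: axes_def)
  then show ?thesis using that[OF ut v] by blast
qed

lemma axes_mult_Re:
  assumes "u \<in> axes s" "v \<in> axes t"
  shows "qcis u s \<star> qcis v t \<in> L" "(qcis u s \<star> qcis v t) $ 1 = cos s * cos t - sin s * sin t * (u \<bullet> v)"
    "qcis u s \<star> qcis (- v) t \<in> L" "(qcis u s \<star> qcis (- v) t) $ 1 = cos s * cos t + sin s * sin t * (u \<bullet> v)"
proof -
  have "- v \<in> axes t" using assms axes_minus by blast
  then show "qcis u s \<star> qcis v t \<in> L" "qcis u s \<star> qcis (- v) t \<in> L"
    using assms L by (simp_all add: axes_def unit_groupD)
qed (use assms in \<open>simp_all add: axes_def Re_qcis_mul\<close>)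

lemma conj_gapped:
  assumes c: "norm c = 1"
  shows "gapped_group (conj_set c L) (c \<star> a \<star> qcnj c)"
proof
  have inj: "c \<star> x \<star> qcnj c = c \<star> y \<star> qcnj c \<longleftrightarrow> x = y" for x y
    using conj_inverse[OF c] by metis
  have one: "c \<star> q1 \<star> qcnj c = q1" "c \<star> - q1 \<star> qcnj c = - q1" using c by (simp_all add: qmul_simps)
  show "unit_group (conj_set c L)" using c L by (rule unit_group_conj_set)
  show "- q1 \<in> conj_set c L" using conj_setI[OF minus_one, of c] one by simp
  show "c \<star> a \<star> qcnj c \<in> conj_set c L" using a conj_setI by blast
  show "0 \<le> (c \<star> a \<star> qcnj c) $ 1" using a c by (simp add: conj_nth_1)
  show "c \<star> a \<star> qcnj c \<noteq> q1" using a inj[of a q1] one by simp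
  {
    fix g assume "g \<in> conj_set c L"
    then obtain h where h: "h \<in> L" "g = c \<star> h \<star> qcnj c" by (auto simp: conj_set_def)
    show "g = q1 \<or> g = - q1" if "sqrt 3 / 2 \<le> \<bar>g $ 1\<bar>"
      using gap[OF h(1)] that one unfolding h(2) by (auto simp: conj_nth_1 c)
    show "\<bar>g $ 1\<bar> \<le> (c \<star> a \<star> qcnj c) $ 1" if "g \<noteq> q1" "g \<noteq> - q1"
    proof -
      have "h \<noteq> q1" "h \<noteq> - q1" using that one unfolding h(2) by metis+
      then show ?thesis using max[OF h(1)] unfolding h(2) by (simp add: conj_nth_1 c)
    qed
  }
  show "\<not> preserves_line (conj_set c L)"
  proof
    assume "preserves_line (conj_set c L)"
    then obtain u where u: "u \<in> pure_units"
      "\<And>g. g \<in> conj_set c L \<Longrightarrow> g \<star> u \<star> qcnj g = u \<or> g \<star> u \<star> qcnj g = - u"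
      unfolding preserves_line_def by blast
    define v where "v = qcnj c \<star> u \<star> c"
    have v: "v \<in> pure_units" using conj_pure_units[of "qcnj c" u] u c by (simp add: v_def)
    have "g \<star> v \<star> qcnj g = v \<or> g \<star> v \<star> qcnj g = - v" if g: "g \<in> L" for g
    proof -
      have "g \<star> v \<star> qcnj g = qcnj c \<star> ((c \<star> g \<star> qcnj c) \<star> u \<star> qcnj (c \<star> g \<star> qcnj c)) \<star> c"
        using c by (simp add: v_def qmul_assoc)
      then show ?thesis using u(2)[OF conj_setI[OF g, of c]] by (auto simp: v_def qmul_simps)
    qed
    then show False using not_line v unfolding preserves_line_def by blast
  qed
qed

end

lemma octahedral_axes_cases:
  assumes "v \<in> octahedral_axes"
  shows "v \<in> {qi, - qi, qj, - qj, qk, - qk}"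
proof -
  have n: "v $ 1 = 0" "v $ 2 * v $ 2 + v $ 3 * v $ 3 + v $ 4 * v $ 4 = 1"
    using assms pure_units_inner_self[of v] by (auto simp: octahedral_axes_def inner_quat)
  have "v $ 2 \<in> {0, 1, -1}" "v $ 3 \<in> {0, 1, -1}" "v $ 4 \<in> {0, 1, -1}"
    using assms by (simp_all add: octahedral_axes_def)
  then have "(\<bar>v $ 2\<bar> = 1 \<and> v $ 3 = 0 \<and> v $ 4 = 0) \<or> (v $ 2 = 0 \<and> \<bar>v $ 3\<bar> = 1 \<and> v $ 4 = 0) \<or>
      (v $ 2 = 0 \<and> v $ 3 = 0 \<and> \<bar>v $ 4\<bar> = 1)"
    using n(2) by (elim insertE emptyE) simp_all
  moreover have "(\<bar>y\<bar> = 1) = (y = 1 \<or> y = -1)" for y :: real by auto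
  ultimately show ?thesis
    using n(1) by (auto simp: quat_eq_iff qbase)
qed

lemma inner_qbase: "x \<bullet> qi = x $ 2" "x \<bullet> qj = x $ 3" "x \<bullet> qk = x $ 4"
  by (simp_all add: inner_quat qbase)

context gapped_group
begin

text \<open>An axis may be reversed, so the product with the smaller of the two real parts is always
  available.\<close>

lemma axes_abs_inner:
  assumes "u \<in> axes t" "v \<in> axes t"
  obtains g where "g \<in> L" "g $ 1 = (cos t)\<^sup>2 - (sin t)\<^sup>2 * \<bar>u \<bullet> v\<bar>"
proof (cases "u \<bullet> v \<ge> 0")
  case True
  then show ?thesis
    using that axes_mult_Re(1,2)[OF assms] by (simp add: power2_eq_square)
next
  case False
  then show ?thesis
    using that axes_mult_Re(3,4)[OF assms] by (simp add: power2_eq_square)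
qed

lemma eq_q1:
  assumes "g \<in> L" "g $ 1 = 1"
  shows "g = q1"
proof -
  have "sqrt 3 \<le> 2" by (rule real_le_lsqrt) simp_all
  then have "g = q1 \<or> g = - q1" using assms by (intro gap) auto
  then show ?thesis using assms(2) by (auto simp: q1_def)
qed

lemma axis_if_Re:
  assumes "g \<in> L" "g $ 1 = cos t" "0 \<le> t" "t \<le> pi"
  obtains w where "w \<in> axes t" "g = qcis w t"
proof -
  obtain w s where w: "w \<in> pure_units" "0 \<le> s" "s \<le> pi" "g = qcis w s"
    using unit_quat_polar unit_groupD(1)[OF L assms(1)] by metis
  moreover have "s = t" using w assms cos_inj_pi[of s t] by simp
  ultimately show ?thesis using that[of w] assms(1) by (simp add: axes_def)
qed

lemma Re_values_order_3:
  assumes "a $ 1 = 1/2" "g \<in> L"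
  shows "\<bar>g $ 1\<bar> \<in> {0, 1/2, 1}"
  using Re_values[OF assms(2)] Re_bound[OF assms(2)] Re_phi_minus_1[OF assms(2)] assms(1)
    phi_bounds sqrt_2_bounds by auto

lemma Re_values_order_4:
  assumes "a $ 1 = sqrt 2 / 2" "g \<in> L"
  shows "\<bar>g $ 1\<bar> \<in> {0, 1/2, sqrt 2 / 2, 1}"
  using Re_values[OF assms(2)] Re_bound[OF assms(2)] Re_phi_minus_1[OF assms(2)] assms(1)
    phi_bounds sqrt_2_bounds by auto

text \<open>With \<open>d\<close> the absolute inner product, a product of the two elements has real
  part \<open>1/4 - 3/4 * d\<close>, which lies in (-1/2, 1/4]. The only admissible value there is
  0.\<close>

lemma inner_axes_order_3:
  assumes "a $ 1 = 1/2" "u \<in> axes (pi / 3)" "v \<in> axes (pi / 3)" "\<bar>u \<bullet> v\<bar> < 1"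
  shows "\<bar>u \<bullet> v\<bar> = 1 / 3"
proof -
  obtain g where g: "g \<in> L" "g $ 1 = (cos (pi / 3))\<^sup>2 - (sin (pi / 3))\<^sup>2 * \<bar>u \<bullet> v\<bar>"
    using axes_abs_inner[OF assms(2,3)] .
  have "g $ 1 = 1/4 - 3/4 * \<bar>u \<bullet> v\<bar>" unfolding g(2) cos_60 sin_60 by (simp add: power_divide)
  then show ?thesis using Re_values_order_3[OF assms(1) g(1)] assms(4) by (auto simp: abs_if split: if_splits)
qed

text \<open>Here the real part \<open>1/2 - 1/2 * d\<close> lies in (0, 1/2], and 1/2 is the only
  admissible value.\<close>

lemma inner_axes_order_4:
  assumes "a $ 1 = sqrt 2 / 2" "u \<in> axes (pi / 4)" "v \<in> axes (pi / 4)" "\<bar>u \<bullet> v\<bar> < 1"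
  shows "u \<bullet> v = 0"
proof -
  obtain g where g: "g \<in> L" "g $ 1 = (cos (pi / 4))\<^sup>2 - (sin (pi / 4))\<^sup>2 * \<bar>u \<bullet> v\<bar>"
    using axes_abs_inner[OF assms(2,3)] .
  have "g $ 1 = 1/2 - 1/2 * \<bar>u \<bullet> v\<bar>" unfolding g(2) cos_45 sin_45 by (simp add: power_divide)
  then show ?thesis using Re_values_order_4[OF assms(1) g(1)] assms(4) sqrt_2_bounds by auto
qed

text \<open>The real part is squeezed strictly between \<open>(phi - 1) / 2\<close> and
  \<open>sqrt 2 / 2\<close>, which leaves 1/2. The resulting number is \<open>1 / sqrt 5\<close>,
  the cosine of the angle between neighbouring vertices of an icosahedron.\<close>

lemma inner_axes_order_5:
  assumes "u \<in> axes (pi / 5)" "v \<in> axes (pi / 5)" "\<bar>u \<bullet> v\<bar> < 1"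
  shows "\<bar>u \<bullet> v\<bar> = (2 * phi - 1) / 5"
proof -
  obtain g where g: "g \<in> L" "g $ 1 = (cos (pi / 5))\<^sup>2 - (sin (pi / 5))\<^sup>2 * \<bar>u \<bullet> v\<bar>"
    using axes_abs_inner[OF assms(1,2)] .
  define d where "d = \<bar>u \<bullet> v\<bar>"
  have d: "0 \<le> d" "d < 1" using assms(3) by (simp_all add: d_def)
  have g1: "g $ 1 = (phi + 1) / 4 - (3 - phi) / 4 * d"
    unfolding g(2) sin_pi_fifth_sq using phi_sq by (simp add: cos_pi_fifth power2_eq_square d_def)
  define e where "e = (3 - phi) / 4 * d"
  have "e < (3 - phi) / 4 * 1"
    unfolding e_def using d phi_bounds by (intro mult_strict_left_mono) auto
  moreover have "0 \<le> e" unfolding e_def using d phi_bounds by (intro mult_nonneg_nonneg) auto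
  ultimately have lo: "(phi - 1) / 2 < g $ 1" and hi: "g $ 1 \<le> (phi + 1) / 4"
    unfolding g1 e_def[symmetric] by (simp_all add: field_simps)
  have "g $ 1 = 1 / 2"
    using Re_values[OF g(1)] lo hi phi_bounds sqrt_2_bounds by auto
  then have *: "(3 - phi) * d = phi - 1" unfolding g1 by (simp add: field_simps)
  also have "\<dots> = (3 - phi) * ((2 * phi - 1) / 5)" using phi_sq by (simp add: field_simps)
  finally show ?thesis using phi_bounds by (simp add: d_def)
qed

section \<open>Recognition of the groups from two axes in standard position\<close>

lemma standard_order_3:
  assumes a3: "a $ 1 = 1/2" and g: "qw \<in> L" "quat (1/2) (1/2) (-1/2) (-1/2) \<in> L"
  shows "L = binary_tetrahedral"
proof -
  \<comment> \<open>The quotient of the two generators is a half turn. Conjugation by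
    \<open>qw\<close> permutes the coordinate axes cyclically and yields the other two.\<close>
  have "qk = qw \<star> qcnj (quat (1/2) (1/2) (-1/2) (-1/2))" by (simp add: qexpand qbase)
  then have k: "qk \<in> L" using g L by (metis unit_groupD(3,4))
  have "qi = qw \<star> qk \<star> qcnj qw" by (simp add: qexpand qbase)
  then have i: "qi \<in> L" using g k L by (metis unit_groupD(3,4))
  have "qj = qw \<star> qi \<star> qcnj qw" by (simp add: qexpand qbase)
  then have j: "qj \<in> L" using g i L by (metis unit_groupD(3,4))
  have "L = {e \<star> t |e t. e \<in> {q1} \<and> t \<in> binary_tetrahedral}"
  proof (rule unit_group_eq_caps[OF L])
    show "binary_tetrahedral \<subseteq> L"
      using binary_tetrahedral_subset[OF L minus_one i j g(1)] .
    show "{q1} \<subseteq> L" using L by (simp add: unit_groupD)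
    show "g \<in> {q1}" if "g \<in> L" "g $ 1 \<ge> sqrt 2 / 2" for g
      using Re_values_order_3[OF a3 that(1)] that(2) sqrt_2_bounds eq_q1[OF that(1)] by auto
  qed
  then show ?thesis by simp
qed

lemma standard_order_4:
  assumes a4: "a $ 1 = sqrt 2 / 2" and g: "qi \<in> axes (pi / 4)" "qj \<in> axes (pi / 4)"
  shows "L = binary_octahedral" "axes (pi / 4) = octahedral_axes"
proof -
  have cis4: "qcis u (pi / 4) = (sqrt 2 / 2) *\<^sub>R (q1 + u)" for u
    by (simp add: qcis_def cos_45 sin_45 scaleR_add_right)
  have ci: "qcis qi (pi / 4) \<in> L" and cj: "qcis qj (pi / 4) \<in> L" using g by (auto simp: axes_def)
  have i: "qi \<in> L" and j: "qj \<in> L"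
    using unit_groupD(3)[OF L ci ci] unit_groupD(3)[OF L cj cj] by (simp_all add: qcis_add)
  have "qcis qi (pi / 4) \<star> qcis qj (pi / 4) = qw"
    by (simp add: cis4 qexpand qbase)
  then have w: "qw \<in> L" using unit_groupD(3)[OF L ci cj] by simp
  have "qw \<star> qj \<star> qcnj qw = qk" by (simp add: qexpand qbase)
  then have k: "qk \<in> axes (pi / 4)" using axes_conj[OF w g(2)] by simp
  have sub: "octahedral_axes \<subseteq> axes (pi / 4)"
  proof
    fix u assume "u \<in> octahedral_axes"
    then have "u \<in> {qi, -qi, qj, -qj, qk, -qk}" by (rule octahedral_axes_cases)
    then show "u \<in> axes (pi / 4)" using g k axes_minus by auto
  qed
  \<comment> \<open>A further axis is parallel or orthogonal to each of \<open>qi\<close>,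
    \<open>qj\<close>, \<open>qk\<close>, which leaves only 0, 1 and -1 as coordinates.\<close>
  have sup: "axes (pi / 4) \<subseteq> octahedral_axes"
  proof
    fix u assume u: "u \<in> axes (pi / 4)"
    have pu: "u \<in> pure_units" using u by (simp add: axes_def)
    have *: "u \<bullet> v \<in> {0, 1, -1}" if "v \<in> axes (pi / 4)" for v
    proof (cases "\<bar>u \<bullet> v\<bar> < 1")
      case True
      then show ?thesis using inner_axes_order_4[OF a4 u that] by simp
    next
      case False
      then have "\<bar>u \<bullet> v\<bar> = 1" using pure_units_inner_bound[OF pu, of v] that by (simp add: axes_def)
      then show ?thesis by (auto simp: abs_if split: if_splits)
    qed
    have "u $ i \<in> {0, 1, -1}" for i
      using *[OF g(1)] *[OF g(2)] *[OF k] exhaust_4[of i] pure_unitsD(2)[OF pu]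
      unfolding inner_qbase by (elim disjE) simp_all
    then show "u \<in> octahedral_axes" using pu by (simp add: octahedral_axes_def)
  qed
  show ax: "axes (pi / 4) = octahedral_axes" using sub sup by blast
  show "L = binary_octahedral"
    unfolding binary_octahedral_def
  proof (rule unit_group_eq_caps[OF L])
    show "binary_tetrahedral \<subseteq> L"
      using binary_tetrahedral_subset[OF L minus_one i j w] .
    show "octahedral_caps \<subseteq> L" using L ax by (auto simp: octahedral_caps_def unit_groupD axes_def)
    show "g \<in> octahedral_caps" if gL: "g \<in> L" and g2: "g $ 1 \<ge> sqrt 2 / 2" for g
    proof -
      have "g $ 1 = 1 \<or> g $ 1 = cos (pi / 4)"
        using Re_values_order_4[OF a4 gL] g2 sqrt_2_bounds by (auto simp: cos_45)
      then show ?thesis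
      proof
        assume "g $ 1 = cos (pi / 4)"
        then obtain w where "w \<in> axes (pi / 4)" "g = qcis w (pi / 4)" using axis_if_Re[OF gL, of "pi / 4"] by auto
        then show ?thesis using ax by (simp add: octahedral_caps_def)
      qed (use eq_q1[OF gL] in \<open>simp add: octahedral_caps_def\<close>)
    qed
  qed
qed

text \<open>Multiply a 4-fold rotation by a 5-fold one, the latter axis taken in both orientations.
  The two real parts add up to \<open>sqrt 2 * phi / 2\<close>, about 1.144, and no two admissible
  values have this sum.\<close>

lemma no_order_4_if_order_5:
  assumes "p \<in> axes (pi / 5)" "w \<in> axes (pi / 4)"
  shows False
proof -
  define d where "d = w \<bullet> p"
  define A where "A = cos (pi / 4) * cos (pi / 5)"
  define B where "B = sin (pi / 4) * sin (pi / 5)"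
  note m = axes_mult_Re[OF assms(2,1), folded d_def A_def B_def]
  have "(sin (pi / 5))\<^sup>2 \<le> 0.6\<^sup>2"
    unfolding sin_pi_fifth_sq using phi_bounds by (simp add: power2_eq_square)
  then have "sin (pi / 5) \<le> 0.6" by (rule power2_le_imp_le) simp
  moreover have "sin (pi / 5) \<ge> 0" by (intro sin_ge_zero) auto
  ultimately have "sqrt 2 / 2 * sin (pi / 5) \<le> 0.70715 * 0.6" "0 \<le> sqrt 2 / 2 * sin (pi / 5)"
    using sqrt_2_bounds by (intro mult_mono mult_nonneg_nonneg; simp)+
  then have B: "0 \<le> B" "B \<le> 0.70715 * 0.6" unfolding B_def sin_45 by simp_all
  have "1.4142 * 1.618 < sqrt 2 * phi" "sqrt 2 * phi < 1.4143 * 1.6181"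
    by (rule mult_strict_mono; use sqrt_2_bounds phi_bounds in simp)+
  then have P: "2.288 < sqrt 2 * phi" "sqrt 2 * phi < 2.289" by simp_all
  have A: "A = sqrt 2 * phi / 4" by (simp add: A_def cos_45 cos_pi_fifth)
  have "\<bar>d\<bar> \<le> 1" using assms pure_units_inner_bound by (simp add: d_def axes_def)
  then have "\<bar>B * d\<bar> \<le> B * 1" unfolding abs_mult using B by (intro mult_mono) auto
  \<comment> \<open>Positivity lets the absolute values in \<open>Re_values\<close> be
    dropped.\<close>
  then have X: "A - B * d > 0" "A + B * d > 0" using B P A by (auto simp: abs_le_iff)
  have "A - B * d \<in> {0, 1/2, sqrt 2 / 2, phi / 2, (phi - 1) / 2, 1}"
    "A + B * d \<in> {0, 1/2, sqrt 2 / 2, phi / 2, (phi - 1) / 2, 1}"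
    using Re_values[OF m(1)] Re_values[OF m(3)] X unfolding m(2,4) by simp_all
  moreover have "(A - B * d) + (A + B * d) = sqrt 2 * phi / 2" by (simp add: A)
  moreover have False
    if "x \<in> {0, 1/2, r / 2, phi / 2, (phi - 1) / 2, 1}" "y \<in> {0, 1/2, r / 2, phi / 2, (phi - 1) / 2, 1}"
      "x + y = p / 2" "14142 < 10000 * r" "10000 * r < 14143" "2288 < 1000 * p" "1000 * p < 2289"
      "1618 < 1000 * phi" "10000 * phi < 16181" for x y r p :: real
    using that by (elim insertE emptyE; argo)
  moreover have "14142 < 10000 * sqrt 2" "10000 * sqrt 2 < 14143" "2288 < 1000 * (sqrt 2 * phi)"
      "1000 * (sqrt 2 * phi) < 2289" "1618 < 1000 * phi" "10000 * phi < 16181"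
    using P sqrt_2_bounds phi_bounds by (simp_all add: mult.commute)
  ultimately show False by blast
qed

lemma standard_order_5:
  assumes g: "quat 0 0 ico_h (phi * ico_h) \<in> axes (pi / 5)" "quat 0 0 (- ico_h) (phi * ico_h) \<in> axes (pi / 5)"
  shows "L = binary_icosahedral" "axes (pi / 5) = icosahedral_axes"
proof -
  let ?p = "quat 0 0 ico_h (phi * ico_h)" and ?q = "quat 0 0 (- ico_h) (phi * ico_h)"
  let ?a = "quat (phi / 2) 0 ((phi - 1) / 2) (1/2)" and ?b = "quat (phi / 2) 0 (- ((phi - 1) / 2)) (1/2)"
  have ih: "sin (pi / 5) * ico_h = (phi - 1) / 2" using ico_h_sin by (simp add: mult.commute)
  have ip: "sin (pi / 5) * (phi * ico_h) = 1 / 2"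
  proof -
    have "sin (pi / 5) * (phi * ico_h) = phi * ((phi - 1) / 2)" unfolding ih[symmetric] by simp
    then show ?thesis using phi_sq by (simp add: algebra_simps)
  qed
  have "qcis ?p (pi / 5) = ?a" "qcis ?q (pi / 5) = ?b"
    by (simp_all add: qcis_def quat_eq_iff q1_def cos_pi_fifth ih ip)
  then have aL: "?a \<in> L" and bL: "?b \<in> L" using g by (auto simp: axes_def)
  \<comment> \<open>Two words in the 5-fold rotations about neighbouring vertices give a half turn
    and a rotation of order 3, which suffice to generate the Hurwitz units.\<close>
  have "?a \<star> ?b \<star> ?a = qk"
    unfolding qexpand qbase using phi_sq by (simp add: field_simps)
  then have k: "qk \<in> L" using aL bL L by (metis unit_groupD(3))
  have "qcnj ?b \<star> ?a \<star> ?a = qw"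
    unfolding qexpand qbase using phi_sq by (simp add: field_simps)
  then have w: "qw \<in> L" using aL bL L by (metis unit_groupD(3,4))
  have "qi = qw \<star> qk \<star> qcnj qw" by (simp add: qexpand qbase)
  then have i: "qi \<in> L" using w k L by (metis unit_groupD(3,4))
  have "qj = qw \<star> qi \<star> qcnj qw" by (simp add: qexpand qbase)
  then have j: "qj \<in> L" using w i L by (metis unit_groupD(3,4))
  have ax1: "u \<in> axes (pi / 5)" if "u $ 1 = 0" "u $ 2 = 0" "\<bar>u $ 3\<bar> = ico_h" "\<bar>u $ 4\<bar> = phi * ico_h" for u
  proof -
    have "u \<in> {?p, ?q, - ?p, - ?q}"
      using that ico_h_pos by (auto simp: quat_eq_iff abs_if split: if_splits)
    then show ?thesis using g axes_minus by auto
  qed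
  \<comment> \<open>Conjugation by \<open>qw\<close> is a cyclic permutation of the imaginary
    coordinates; it carries the four axes of \<open>ax1\<close> to the remaining eight.\<close>
  have rot: "qw \<star> quat 0 (u $ 3) (u $ 4) (u $ 2) \<star> qcnj qw = u" if "u $ 1 = 0" for u
    using that by (simp add: qexpand field_simps)
  have ax2: "u \<in> axes (pi / 5)" if "u $ 1 = 0" "\<bar>u $ 2\<bar> = phi * ico_h" "u $ 3 = 0" "\<bar>u $ 4\<bar> = ico_h" for u
    using axes_conj[OF w ax1[of "quat 0 (u $ 3) (u $ 4) (u $ 2)"]] that rot[OF that(1)] by simp
  have ax3: "u \<in> axes (pi / 5)" if "u $ 1 = 0" "\<bar>u $ 2\<bar> = ico_h" "\<bar>u $ 3\<bar> = phi * ico_h" "u $ 4 = 0" for u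
    using axes_conj[OF w ax2[of "quat 0 (u $ 3) (u $ 4) (u $ 2)"]] that rot[OF that(1)] by simp
  have sub: "icosahedral_axes \<subseteq> axes (pi / 5)"
    using ax1 ax2 ax3 by (auto simp: icosahedral_axes_def)
  have sup: "axes (pi / 5) \<subseteq> icosahedral_axes"
  proof
    fix u assume u: "u \<in> axes (pi / 5)"
    have pu: "u \<in> pure_units" using u by (simp add: axes_def)
    show "u \<in> icosahedral_axes"
    proof (rule ccontr)
      assume not: "u \<notin> icosahedral_axes"
      define \<epsilon> where "\<epsilon> = (2 * phi - 1) / 5"
      have eps: "\<epsilon> > 0" using phi_bounds by (simp add: \<epsilon>_def)
      have *: "\<bar>u \<bullet> v\<bar> = \<epsilon>" if "v \<in> icosahedral_axes" for v
      proof -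
        have v: "v \<in> axes (pi / 5)" "v \<in> pure_units" using that sub by (auto simp: axes_def)
        have "- v \<in> icosahedral_axes" using that by (simp add: icosahedral_axes_def)
        then have "\<bar>u \<bullet> v\<bar> \<noteq> 1"
          using that not pure_units_inner_eq_1[OF v(2) pu] by (auto simp: inner_commute)
        then have "\<bar>u \<bullet> v\<bar> < 1" using pure_units_inner_bound[OF pu v(2)] by simp
        then show ?thesis using inner_axes_order_5[OF u v(1)] by (simp add: \<epsilon>_def)
      qed
      \<comment> \<open>A further axis \<open>u\<close> would have inner product plus or minus
        \<open>\<epsilon>\<close> with all twelve vertices. Comparing vertices that differ in one
        sign shows that of any two coordinates of \<open>u\<close> exactly one vanishes, which is
        impossible for three coordinates.\<close>
      have both: "A = 0 \<and> \<bar>B\<bar> = \<epsilon> \<or> B = 0 \<and> \<bar>A\<bar> = \<epsilon>" if "\<bar>A + B\<bar> = \<epsilon>" "\<bar>A - B\<bar> = \<epsilon>" for A B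
        using that by (auto simp: abs_if split: if_splits)
      have h: "\<bar>ico_h\<bar> = ico_h" "\<bar>phi * ico_h\<bar> = phi * ico_h"
        using ico_h_pos phi_bounds by (simp_all add: abs_mult)
      have m: "quat 0 0 ico_h (phi * ico_h) \<in> icosahedral_axes" "quat 0 0 ico_h (- (phi * ico_h)) \<in> icosahedral_axes"
        "quat 0 (phi * ico_h) 0 ico_h \<in> icosahedral_axes" "quat 0 (phi * ico_h) 0 (- ico_h) \<in> icosahedral_axes"
        "quat 0 ico_h (phi * ico_h) 0 \<in> icosahedral_axes" "quat 0 ico_h (- (phi * ico_h)) 0 \<in> icosahedral_axes"
        by (simp_all add: icosahedral_axes_def h)
      note ms = m[THEN *]
      have 1: "u $ 3 * ico_h = 0 \<and> \<bar>u $ 4 * (phi * ico_h)\<bar> = \<epsilon> \<or> u $ 4 * (phi * ico_h) = 0 \<and> \<bar>u $ 3 * ico_h\<bar> = \<epsilon>"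
        using ms(1,2) by (intro both) (simp_all add: inner_quat)
      have 2: "u $ 2 * (phi * ico_h) = 0 \<and> \<bar>u $ 4 * ico_h\<bar> = \<epsilon> \<or> u $ 4 * ico_h = 0 \<and> \<bar>u $ 2 * (phi * ico_h)\<bar> = \<epsilon>"
        using ms(3,4) by (intro both) (simp_all add: inner_quat)
      have 3: "u $ 2 * ico_h = 0 \<and> \<bar>u $ 3 * (phi * ico_h)\<bar> = \<epsilon> \<or> u $ 3 * (phi * ico_h) = 0 \<and> \<bar>u $ 2 * ico_h\<bar> = \<epsilon>"
        using ms(5,6) by (intro both) (simp_all add: inner_quat)
      have clash: False if "\<bar>y * ico_h\<bar> = \<epsilon>" "\<bar>y * (phi * ico_h)\<bar> = \<epsilon>" for y
      proof -
        have "\<bar>y * (phi * ico_h)\<bar> = phi * \<bar>y * ico_h\<bar>"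
          using phi_bounds by (simp add: abs_mult)
        then have "phi * \<epsilon> = \<epsilon>" using that by simp
        then show False using eps phi_bounds by simp
      qed
      show False using 1 2 3 clash eps ico_h_pos phi_bounds by auto
    qed
  qed
  show ax: "axes (pi / 5) = icosahedral_axes" using sub sup by blast
  show "L = binary_icosahedral"
    unfolding binary_icosahedral_def
  proof (rule unit_group_eq_caps[OF L])
    show "binary_tetrahedral \<subseteq> L"
      using binary_tetrahedral_subset[OF L minus_one i j w] .
    show "icosahedral_caps \<subseteq> L" using L ax by (auto simp: icosahedral_caps_def unit_groupD axes_def)
    show "g \<in> icosahedral_caps" if gL: "g \<in> L" and g2: "g $ 1 \<ge> sqrt 2 / 2" for g
    proof -
      have "g $ 1 = 1 \<or> g $ 1 = cos (pi / 4) \<or> g $ 1 = cos (pi / 5)"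
        using Re_values[OF gL] g2 sqrt_2_bounds phi_bounds by (auto simp: cos_45 cos_pi_fifth)
      moreover have "g $ 1 \<noteq> cos (pi / 4)"
        using axis_if_Re[OF gL, of "pi / 4"] no_order_4_if_order_5[OF g(1)] by force
      ultimately show ?thesis
      proof (elim disjE)
        assume "g $ 1 = cos (pi / 5)"
        then obtain w where "w \<in> axes (pi / 5)" "g = qcis w (pi / 5)" using axis_if_Re[OF gL, of "pi / 5"] by auto
        then show ?thesis using ax by (simp add: icosahedral_caps_def)
      qed (use eq_q1[OF gL] in \<open>simp_all add: icosahedral_caps_def\<close>)
    qed
  qed
qed

end

text \<open>Invariance of the axes is recorded because it cannot be read off from the product sets;
  the choice of distant points on the 2-sphere relies on it. In the tetrahedral case it is derived
  at that point.\<close>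

definition polyhedral :: "(real^4) set \<Rightarrow> bool" where
  "polyhedral L \<longleftrightarrow> L = binary_tetrahedral \<or>
     L = binary_octahedral \<and> (\<forall>g\<in>L. \<forall>v\<in>octahedral_axes. g \<star> v \<star> qcnj g \<in> octahedral_axes) \<or>
     L = binary_icosahedral \<and> (\<forall>g\<in>L. \<forall>v\<in>icosahedral_axes. g \<star> v \<star> qcnj g \<in> icosahedral_axes)"

lemma (in gapped_group) conj_axes:
  assumes "norm c = 1" "u \<in> axes t"
  shows "c \<star> u \<star> qcnj c \<in> gapped_group.axes (conj_set c L) t"
proof -
  interpret C: gapped_group "conj_set c L" "c \<star> a \<star> qcnj c" using conj_gapped[OF assms(1)] .
  show ?thesis using assms conj_setI[of "qcis u t" L c]
    by (simp add: C.axes_def axes_def conj_pure_units conj_qcis)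
qed

lemma (in gapped_group) conj_polyhedral:
  obtains c where "norm c = 1" "polyhedral (conj_set c L)"
proof -
  \<comment> \<open>If every noncentral element is a half turn, any two axes are parallel or
    orthogonal, so each element sends \<open>u\<close> to \<open>u\<close> or \<open>- u\<close>.
    This is the situation of the quaternion group, which preserves a line.\<close>
  have line: False if "a $ 1 = 0"
  proof -
    obtain u v where uv: "u \<in> axes (pi / 2)" "v \<in> axes (pi / 2)" "\<bar>u \<bullet> v\<bar> < 1"
      using two_axes[of "pi / 2"] \<open>a $ 1 = 0\<close> by auto
    have pu: "u \<in> pure_units" using uv by (simp add: axes_def)
    have "g \<star> u \<star> qcnj g = u \<or> g \<star> u \<star> qcnj g = - u" if g: "g \<in> L" for g
    proof (cases "\<bar>g $ 1\<bar> = 1")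
      case True
      then have "g = q1 \<or> - g = q1" using eq_q1[OF g] eq_q1[OF minus[OF g]] by (auto simp: abs_if split: if_splits)
      then have "g = q1 \<or> g = - q1" by (metis minus_minus)
      then show ?thesis by (auto simp: qmul_simps)
    next
      case False
      then have "g $ 1 = 0" using Re_bound[OF g] \<open>a $ 1 = 0\<close> by auto
      then have "g $ 1 = cos (pi / 2)" by simp
      then obtain w where w: "w \<in> axes (pi / 2)" "g = qcis w (pi / 2)"
        using axis_if_Re[OF g, of "pi / 2"] by auto
      then have pw: "w \<in> pure_units" "g = w" by (auto simp: axes_def)
      have "g \<star> u \<star> qcnj g \<in> axes (pi / 2)" using axes_conj g uv by blast
      have gu: "g \<star> u \<in> L" using unit_groupD(3)[OF L g] uv by (simp add: axes_def)
      have r: "(g \<star> u) $ 1 = - (w \<bullet> u)" using pu pw by (simp add: qmul_def inner_quat)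
      show ?thesis
      proof (cases "\<bar>w \<bullet> u\<bar> = 1")
        case True
        then have "u = w \<or> u = - w" using pure_units_inner_eq_1 pu pw by blast
        then show ?thesis using pw by (auto simp: qmul_simps)
      next
        case False
        then have "w \<bullet> u = 0" using Re_bound[OF gu] r \<open>a $ 1 = 0\<close> by auto
        then have "u \<bullet> w = 0" by (simp add: inner_commute)
        then have "u \<star> w = - (w \<star> u)" using pw pu by (simp add: qexpand inner_quat)
        then have "w \<star> u \<star> qcnj w = - (u \<star> w \<star> qcnj w)" by (simp add: qmul_simps)
        then show ?thesis using pw by simp
      qed
    qed
    then show False using not_line pu unfolding preserves_line_def by blast
  qed
  consider "a $ 1 = 1/2" | "a $ 1 = sqrt 2 / 2" | "a $ 1 = phi / 2"
    using Re_a_values line by auto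
  then show ?thesis
  proof cases
    case 1
    obtain u v where uv: "u \<in> axes (pi / 3)" "v \<in> axes (pi / 3)" "\<bar>u \<bullet> v\<bar> < 1"
      using two_axes[of "pi / 3"] 1 by (auto simp: cos_60)
    \<comment> \<open>The obtuse orientation is chosen: then the axes point to two vertices of a
      regular tetrahedron, placed below along \<open>(1, 1, 1)\<close> and
      \<open>(1, -1, -1)\<close>.\<close>
    obtain v' where v': "v' \<in> axes (pi / 3)" "u \<bullet> v' = - 1 / 3"
    proof (cases "u \<bullet> v \<ge> 0")
      case True
      then show ?thesis using inner_axes_order_3[OF 1 uv] that[of "- v"] axes_minus[OF uv(2)] by simp
    next
      case False
      then show ?thesis using inner_axes_order_3[OF 1 uv] that[of v] uv by simp
    qed
    define s where "s = 1 / sqrt 3"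
    have s: "s * s = 1 / 3" by (simp add: s_def)
    let ?u = "quat 0 s s s" and ?v = "quat 0 s (- s) (- s)"
    have "?u \<in> pure_units" "?v \<in> pure_units"
      by (auto intro!: pure_unitsI simp: norm_eq_1 inner_quat s)
    moreover have "u \<bullet> v' = ?u \<bullet> ?v" by (simp add: inner_quat[of ?u] s v')
    ultimately obtain c where c: "norm c = 1" "c \<star> u \<star> qcnj c = ?u" "c \<star> v' \<star> qcnj c = ?v"
      using pure_units_pair_transitive[of u v' ?u ?v] uv v' by (auto simp: axes_def)
    interpret C: gapped_group "conj_set c L" "c \<star> a \<star> qcnj c" using conj_gapped[OF c(1)] .
    have s3: "sin (pi / 3) * s = 1 / 2" by (simp add: sin_60 s_def)
    have cis: "qcis ?u (pi / 3) = qw" "qcis ?v (pi / 3) = quat (1/2) (1/2) (-1/2) (-1/2)"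
      by (simp_all add: qcis_def quat_eq_iff q1_def s3 cos_60)
    have "conj_set c L = binary_tetrahedral"
    proof (rule C.standard_order_3)
      show "(c \<star> a \<star> qcnj c) $ 1 = 1/2" using 1 c by (simp add: conj_nth_1)
      show "qw \<in> conj_set c L"
        using conj_axes[OF c(1) uv(1)] by (simp add: c C.axes_def cis)
      show "quat (1/2) (1/2) (-1/2) (-1/2) \<in> conj_set c L"
        using conj_axes[OF c(1) v'(1)] unfolding c C.axes_def cis(2)[symmetric] by simp
    qed
    then show ?thesis using that c by (simp add: polyhedral_def)
  next
    case 2
    obtain u v where uv: "u \<in> axes (pi / 4)" "v \<in> axes (pi / 4)" "\<bar>u \<bullet> v\<bar> < 1"
      using two_axes[of "pi / 4"] 2 by (auto simp: cos_45)
    obtain c where c: "norm c = 1" "c \<star> u \<star> qcnj c = qi" "c \<star> v \<star> qcnj c = qj"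
      using pure_units_pair_to_ij[of u v] inner_axes_order_4[OF 2 uv] uv by (auto simp: axes_def)
    interpret C: gapped_group "conj_set c L" "c \<star> a \<star> qcnj c" using conj_gapped[OF c(1)] .
    have "conj_set c L = binary_octahedral \<and> C.axes (pi / 4) = octahedral_axes"
      using C.standard_order_4 conj_axes[OF c(1) uv(1)] conj_axes[OF c(1) uv(2)] 2 c
      by (simp add: conj_nth_1)
    moreover from this have "\<forall>g\<in>conj_set c L. \<forall>v\<in>octahedral_axes. g \<star> v \<star> qcnj g \<in> octahedral_axes"
      using C.axes_conj[of _ _ "pi / 4"] by metis
    ultimately show ?thesis using that[OF c(1)] unfolding polyhedral_def by blast
  next
    case 3
    obtain u v where uv: "u \<in> axes (pi / 5)" "v \<in> axes (pi / 5)" "\<bar>u \<bullet> v\<bar> < 1"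
      using two_axes[of "pi / 5"] 3 by (auto simp: cos_pi_fifth)
    obtain v' where v': "v' \<in> axes (pi / 5)" "u \<bullet> v' = (2 * phi - 1) / 5"
    proof (cases "u \<bullet> v \<ge> 0")
      case True
      then show ?thesis using inner_axes_order_5[OF uv] that[of v] uv by simp
    next
      case False
      then show ?thesis using inner_axes_order_5[OF uv] that[of "- v"] axes_minus[OF uv(2)] by simp
    qed
    let ?u = "quat 0 0 ico_h (phi * ico_h)" and ?v = "quat 0 0 (- ico_h) (phi * ico_h)"
    have "?u \<bullet> ?v = (2 * phi - 1) / 5"
    proof -
      have "?u \<bullet> ?v = ico_h * ico_h * (phi * phi - 1)" by (simp add: inner_quat algebra_simps)
      also have "\<dots> = ico_h * ico_h * phi" by (simp add: phi_sq)
      also have "\<dots> * 5 = (ico_h * ico_h * (phi + 2)) * (2 * phi - 1)"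
      proof -
        have "phi * 5 = (phi + 2) * (2 * phi - 1)" using phi_sq by (simp add: algebra_simps)
        then show ?thesis by simp
      qed
      finally show ?thesis by (simp add: ico_h_sq)
    qed
    moreover have "\<bar>u \<bullet> v'\<bar> < 1" unfolding v'(2) using phi_bounds by simp
    ultimately obtain c where c: "norm c = 1" "c \<star> u \<star> qcnj c = ?u" "c \<star> v' \<star> qcnj c = ?v"
      using pure_units_pair_transitive[of u v' ?u ?v] uv v' ico_axis_pure by (auto simp: axes_def)
    interpret C: gapped_group "conj_set c L" "c \<star> a \<star> qcnj c" using conj_gapped[OF c(1)] .
    have "conj_set c L = binary_icosahedral \<and> C.axes (pi / 5) = icosahedral_axes"
      using C.standard_order_5 conj_axes[OF c(1) uv(1)] conj_axes[OF c(1) v'(1)] c by simp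
    moreover from this have "\<forall>g\<in>conj_set c L. \<forall>v\<in>icosahedral_axes. g \<star> v \<star> qcnj g \<in> icosahedral_axes"
      using C.axes_conj[of _ _ "pi / 5"] by metis
    ultimately show ?thesis using that[OF c(1)] unfolding polyhedral_def by blast
  qed
qed

text \<open>If \<open>L\<close> accumulates at \<open>q1\<close> it contains a circle, and together
  with a circle about another axis this fills the sphere. Otherwise the noncentral elements form a
  compact set, on which a least angle is attained.\<close>

theorem closed_unit_group_classification:
  assumes L: "unit_group L" and "closed L" and m: "- q1 \<in> L"
    and not_line: "\<not> preserves_line L" and "L \<noteq> sphere 0 1"
  obtains c where "norm c = 1" "polyhedral (conj_set c L)"
proof -
  have "\<exists>\<epsilon>>0. \<forall>l\<in>L. l \<noteq> q1 \<longrightarrow> dist l q1 \<ge> \<epsilon>"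
  proof (rule ccontr)
    assume "\<not> ?thesis"
    then have near: "\<exists>l\<in>L. l \<noteq> q1 \<and> dist l q1 < \<epsilon>" if "\<epsilon> > 0" for \<epsilon>
      using that by (meson not_le)
    obtain u where u: "u \<in> pure_units" "\<And>x. qcis u x \<in> L"
      using unit_group_one_parameter[OF L \<open>closed L\<close> near] by blast
    obtain g where "g \<in> L" "g \<star> u \<star> qcnj g \<noteq> u" "g \<star> u \<star> qcnj g \<noteq> - u"
      using not_line u unfolding preserves_line_def by blast
    then have "L = sphere 0 1" using circle_not_preserved_full[OF L u] by blast
    then show False using \<open>L \<noteq> sphere 0 1\<close> by simp
  qed
  then obtain \<epsilon> where \<epsilon>: "\<epsilon> > 0" "\<And>l. l \<in> L \<Longrightarrow> l \<noteq> q1 \<Longrightarrow> dist l q1 \<ge> \<epsilon>" by blast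
  \<comment> \<open>The squared distance from \<open>g\<close> to \<open>q1\<close> is
    \<open>2 - 2 * g $ 1\<close>, which turns the lower bound \<open>\<epsilon>\<close> into an
    upper bound for real parts.\<close>
  define r where "r = 1 - \<epsilon>\<^sup>2 / 2"
  have r1: "g $ 1 \<le> r" if "g \<in> L" "g \<noteq> q1" for g
  proof -
    have "(dist g q1)\<^sup>2 = 2 - 2 * g $ 1"
      using unit_groupD(1)[OF L that(1)]
      by (simp add: dist_norm power2_norm_eq_inner inner_diff_left inner_diff_right inner_q1 norm_eq_1)
        (simp add: q1_def)
    moreover have "\<epsilon>\<^sup>2 \<le> (dist g q1)\<^sup>2" using \<epsilon> that by (intro power_mono) auto
    ultimately show ?thesis by (simp add: r_def)
  qed
  have r2: "\<bar>g $ 1\<bar> \<le> r" if "g \<in> L" "g \<noteq> q1" "g \<noteq> - q1" for g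
  proof -
    have "- g \<noteq> q1" using that(3) by (metis minus_minus)
    then show ?thesis using r1[OF that(1,2)] r1[OF unit_group_minus[OF L m that(1)]] by (simp add: abs_le_iff)
  qed
  have "r < 1" using \<epsilon> by (simp add: r_def)
  define K where "K = L \<inter> {x. \<bar>x $ 1\<bar> \<le> r}"
  have KI: "g \<in> K \<longleftrightarrow> g \<in> L \<and> g \<noteq> q1 \<and> g \<noteq> - q1" for g
    using r2[of g] \<open>r < 1\<close> by (auto simp: K_def q1_def)
  have "closed {x :: real^4. \<bar>x $ 1\<bar> \<le> r}" by (intro closed_Collect_le continuous_intros)
  moreover have "compact L"
    using \<open>closed L\<close> L compact_Int_closed[OF compact_sphere, of L 0 1]
    by (simp add: unit_group_def Int_absorb1)
  ultimately have "compact K" by (simp add: K_def compact_Int_closed)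
  moreover have "K \<noteq> {}"
  proof
    assume "K = {}"
    then have "L \<subseteq> {q1, - q1}" using KI by blast
    then have "preserves_line L"
      unfolding preserves_line_def by (intro bexI[of _ qi]) (auto simp: qmul_simps)
    then show False using not_line by simp
  qed
  ultimately obtain b where b: "b \<in> K" "\<And>g. g \<in> K \<Longrightarrow> \<bar>g $ 1\<bar> \<le> \<bar>b $ 1\<bar>"
    using continuous_attains_sup[of K "\<lambda>x. \<bar>x $ 1\<bar>"] by (force intro: continuous_intros)
  define a where "a = (if b $ 1 \<ge> 0 then b else - b)"
  have a: "a \<in> L" "0 \<le> a $ 1" "a \<noteq> q1" "\<bar>b $ 1\<bar> = a $ 1"
    using b(1) unit_group_minus[OF L m, of b] unfolding KI a_def by (auto, metis minus_minus)
  have max: "\<bar>g $ 1\<bar> \<le> a $ 1" if "g \<in> L" "g \<noteq> q1" "g \<noteq> - q1" for g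
    using b(2) that a(4) KI by simp
  have "a $ 1 < sqrt 3 / 2" using unit_group_commutator_gap[OF L a(1-3) max not_line] .
  then have gap: "g = q1 \<or> g = - q1" if "g \<in> L" "sqrt 3 / 2 \<le> \<bar>g $ 1\<bar>" for g
    using max[OF that(1)] that(2) by fastforce
  interpret gapped_group L a
    by (rule gapped_group.intro) (fact L m gap a(1) a(2) a(3) max not_line)+
  show ?thesis using conj_polyhedral that by blast
qed

section \<open>Lower bounds for orbit distances\<close>

text \<open>The cosine of the angle between a 5-fold axis of the icosahedron and a nearest 3-fold
  axis; \<open>tan (3 * pi / 10)\<close> is the cotangent of \<open>pi / 5\<close>.\<close>

definition cos_alpha :: real where "cos_alpha = tan (3 * pi / 10) / sqrt 3"

definition cos_half_alpha :: real where "cos_half_alpha = cos (arccos cos_alpha / 2)"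

lemma cos_alpha_sq: "cos_alpha\<^sup>2 = (phi + 1) / (3 * (3 - phi))"
  and cos_alpha_bounds: "0.79 < cos_alpha" "cos_alpha < 1"
proof -
  have "tan (3 * pi / 10) = 1 / tan (pi / 5)"
    using tan_cot[of "pi / 5"] by (simp add: field_simps)
  then have t: "tan (3 * pi / 10) = cos (pi / 5) / sin (pi / 5)" by (simp add: tan_def)
  have "cos_alpha\<^sup>2 = (cos (pi / 5))\<^sup>2 / ((sin (pi / 5))\<^sup>2 * 3)"
    by (simp add: cos_alpha_def t power_divide power_mult_distrib)
  also have "\<dots> = (phi * phi / 4) / ((3 - phi) / 4 * 3)"
    by (simp only: sin_pi_fifth_sq cos_pi_fifth) (simp add: power2_eq_square)
  finally show sq: "cos_alpha\<^sup>2 = (phi + 1) / (3 * (3 - phi))"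
    using phi_bounds by (simp add: phi_sq field_simps)
  have "0 < sin (pi / 5)" by (intro sin_gt_zero) auto
  then have pos: "0 < cos_alpha"
    using phi_bounds by (simp add: cos_alpha_def t cos_pi_fifth)
  have "0.79\<^sup>2 < cos_alpha\<^sup>2" "cos_alpha\<^sup>2 < 1\<^sup>2"
    unfolding sq using phi_bounds by (simp_all add: power2_eq_square field_simps)
  then show "0.79 < cos_alpha" "cos_alpha < 1"
    using pos power2_less_imp_less[of "0.79" cos_alpha] power2_less_imp_less[of cos_alpha 1] by simp_all
qed

text \<open>The number 0.946 is the threshold that the estimates for \<open>hole\<close> will have
  to meet.\<close>

lemma cos_half_alpha_sq: "2 * cos_half_alpha\<^sup>2 = 1 + cos_alpha"
  and cos_half_alpha_bound: "0.946 < cos_half_alpha"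
proof -
  have "cos (arccos cos_alpha) = cos_alpha" using cos_alpha_bounds by simp
  then show sq: "2 * cos_half_alpha\<^sup>2 = 1 + cos_alpha"
    using cos_double_cos[of "arccos cos_alpha / 2"] by (simp add: cos_half_alpha_def)
  have "0 \<le> cos_half_alpha"
    unfolding cos_half_alpha_def using arccos_bounded[of cos_alpha] cos_alpha_bounds
    by (intro cos_ge_zero) auto
  moreover have "0.946\<^sup>2 < cos_half_alpha\<^sup>2"
    using sq cos_alpha_bounds by (simp add: power2_eq_square)
  ultimately show "0.946 < cos_half_alpha" by (metis power2_less_imp_less)
qed

text \<open>The Hopf map \<open>x \<mapsto> x\<inverse> u x\<close> at most doubles distances.\<close>

lemma hopf_inner_bound:
  assumes "norm x = 1" "norm y = 1" "u \<in> pure_units"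
  shows "2 * (x \<bullet> y)\<^sup>2 \<le> 1 + (qcnj x \<star> u \<star> x) \<bullet> (qcnj y \<star> u \<star> y)"
proof -
  define z where "z = y \<star> qcnj x"
  have z: "z \<bullet> z = 1" using assms by (simp add: z_def flip: norm_eq_1)
  have z1: "z $ 1 = x \<bullet> y" by (simp add: z_def qmul_def inner_quat algebra_simps)
  have "(qcnj x \<star> u \<star> x) \<bullet> (qcnj y \<star> u \<star> y) = (u \<star> x) \<bullet> (x \<star> qcnj y \<star> u \<star> y)"
    by (simp add: inner_qmul_left qmul_assoc)
  also have "\<dots> = u \<bullet> (x \<star> qcnj y \<star> u \<star> z)" by (simp add: inner_qmul_right z_def qmul_assoc)
  also have "\<dots> = (z \<star> u) \<bullet> (u \<star> z)" by (simp add: inner_qmul_left z_def qmul_assoc)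
  also have "\<dots> = 2 * (z $ 1)\<^sup>2 - 1 + 2 * (z \<bullet> u)\<^sup>2"
    unfolding inner_qmul_swap using assms(3) z by simp
  finally show ?thesis by (simp add: z1)
qed

text \<open>Two points whose \<open>R\<close>-orbits are far apart in the projective plane. The
  absolute value is there because a group preserving a line may reverse it, so that Hopf images are
  controlled only up to sign.\<close>

definition spread_pair :: "(real^4) set \<Rightarrow> real^4 \<Rightarrow> real^4 \<Rightarrow> bool" where
  "spread_pair R p q \<longleftrightarrow> p \<in> pure_units \<and> q \<in> pure_units \<and>
     (\<forall>r\<in>R. \<bar>(r \<star> p \<star> qcnj r) \<bullet> q\<bar> \<le> cos_alpha)"

lemma preserves_line_spread_pair:
  assumes "preserves_line R"
  obtains p q where "spread_pair R p q"
proof -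
  obtain u where u: "u \<in> pure_units" "\<And>g. g \<in> R \<Longrightarrow> g \<star> u \<star> qcnj g = u \<or> g \<star> u \<star> qcnj g = - u"
    using assms unfolding preserves_line_def by blast
  obtain w where w: "w \<in> pure_units" "u \<bullet> w = 0"
    using pure_units_with_inner[OF u(1), of 0] by auto
  have "\<bar>(g \<star> u \<star> qcnj g) \<bullet> w\<bar> \<le> cos_alpha" if "g \<in> R" for g
    using u(2)[OF that] w cos_alpha_bounds by (auto simp: inner_minus_left)
  then show ?thesis using that[of u w] u w by (simp add: spread_pair_def)
qed

lemma spread_pair_conj:
  assumes c: "norm c = 1" and pq: "spread_pair (conj_set c R) p q"
  shows "spread_pair R (qcnj c \<star> p \<star> c) (qcnj c \<star> q \<star> c)"
proof -
  have pure: "qcnj c \<star> v \<star> c \<in> pure_units" if "v \<in> pure_units" for v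
    using conj_pure_units[of "qcnj c" v] c that by simp
  have "\<bar>(r \<star> (qcnj c \<star> p \<star> c) \<star> qcnj r) \<bullet> (qcnj c \<star> q \<star> c)\<bar> \<le> cos_alpha" if r: "r \<in> R" for r
  proof -
    have "(r \<star> (qcnj c \<star> p \<star> c) \<star> qcnj r) \<bullet> (qcnj c \<star> q \<star> c)
      = ((c \<star> r \<star> qcnj c) \<star> p \<star> qcnj (c \<star> r \<star> qcnj c)) \<bullet> q"
    proof -
      have "(r \<star> (qcnj c \<star> p \<star> c) \<star> qcnj r) \<bullet> (qcnj c \<star> q \<star> c)
        = (c \<star> (r \<star> (qcnj c \<star> p \<star> c) \<star> qcnj r) \<star> qcnj c) \<bullet> (c \<star> (qcnj c \<star> q \<star> c) \<star> qcnj c)"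
        by (simp only: inner_conj[OF c])
      then show ?thesis using c by (simp add: qmul_assoc)
    qed
    moreover have "\<bar>((c \<star> r \<star> qcnj c) \<star> p \<star> qcnj (c \<star> r \<star> qcnj c)) \<bullet> q\<bar> \<le> cos_alpha"
      using pq conj_setI[OF r, of c] unfolding spread_pair_def by blast
    ultimately show ?thesis by (simp only:)
  qed
  then show ?thesis using pq pure by (simp add: spread_pair_def)
qed

text \<open>The diagonal \<open>q\<close> is a 3-fold axis of all three standard groups;
  \<open>p\<close> is a coordinate axis, or a vertex in the icosahedral case. The bound by the sum
  of absolute coordinates treats all signs at once and gives exactly \<open>cos_alpha\<close> for
  the icosahedron.\<close>

lemma polyhedral_spread_pair:
  assumes R: "unit_group R" "polyhedral R"
  obtains p q where "spread_pair R p q"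
proof -
  define s where "s = 1 / sqrt 3"
  have s: "s * s = 1 / 3" "s > 0" by (simp_all add: s_def)
  define q where "q = quat 0 s s s"
  have q: "q \<in> pure_units" by (auto intro!: pure_unitsI simp: norm_eq_1 inner_quat s q_def)
  have vq: "\<bar>v \<bullet> q\<bar> \<le> s * (\<bar>v $ 2\<bar> + \<bar>v $ 3\<bar> + \<bar>v $ 4\<bar>)" for v
  proof -
    have "v \<bullet> q = s * (v $ 2 + v $ 3 + v $ 4)" by (simp add: q_def inner_quat algebra_simps)
    then have "\<bar>v \<bullet> q\<bar> = s * \<bar>v $ 2 + v $ 3 + v $ 4\<bar>" using s by (simp add: abs_mult)
    also have "\<dots> \<le> s * (\<bar>v $ 2\<bar> + \<bar>v $ 3\<bar> + \<bar>v $ 4\<bar>)" using s by (intro mult_left_mono) auto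
    finally show ?thesis .
  qed
  have s1: "s \<le> cos_alpha"
  proof -
    have "s\<^sup>2 \<le> 0.6\<^sup>2" using s(1) by (simp add: power2_eq_square)
    then have "s \<le> 0.6" by (rule power2_le_imp_le) simp
    then show ?thesis using cos_alpha_bounds by simp
  qed
  have oct: "\<bar>v \<bullet> q\<bar> \<le> cos_alpha" if "v \<in> octahedral_axes" for v
  proof -
    have "\<bar>v $ 2\<bar> + \<bar>v $ 3\<bar> + \<bar>v $ 4\<bar> = 1"
      using octahedral_axes_cases[OF that] by (auto simp: qbase)
    then show ?thesis using vq[of v] s1 by simp
  qed
  have ico: "\<bar>v \<bullet> q\<bar> \<le> cos_alpha" if "v \<in> icosahedral_axes" for v
  proof -
    have "\<bar>v $ 2\<bar> + \<bar>v $ 3\<bar> + \<bar>v $ 4\<bar> = ico_h * (phi + 1)"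
      using that by (auto simp: icosahedral_axes_def algebra_simps)
    then have "\<bar>v \<bullet> q\<bar> \<le> s * (ico_h * (phi + 1))" using vq[of v] by simp
    also have "s * (ico_h * (phi + 1)) \<le> cos_alpha"
    proof (rule power2_le_imp_le)
      have "(s * (ico_h * (phi + 1)))\<^sup>2 * (phi + 2) = (s * s) * (ico_h * ico_h * (phi + 2)) * (phi + 1)\<^sup>2"
        by (simp add: power2_eq_square)
      also have "\<dots> = (phi + 1)\<^sup>2 / 3" by (simp add: s ico_h_sq)
      finally have "(s * (ico_h * (phi + 1)))\<^sup>2 = (phi + 1)\<^sup>2 / 3 / (phi + 2)"
        using phi_bounds by (simp add: field_simps)
      also have "\<dots> = (phi + 1) / (3 * (3 - phi))"
      proof -
        have "(phi + 1) * (3 - phi) = phi + 2" using phi_sq by (simp add: algebra_simps)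
        then have "(phi + 1)\<^sup>2 / 3 / (phi + 2) = (phi + 1)\<^sup>2 / 3 / ((phi + 1) * (3 - phi))" by simp
        also have "\<dots> = (phi + 1) / (3 * (3 - phi))"
          using phi_bounds by (simp add: power2_eq_square)
        finally show ?thesis .
      qed
      finally show "(s * (ico_h * (phi + 1)))\<^sup>2 \<le> cos_alpha\<^sup>2" by (simp add: cos_alpha_sq)
    qed (use cos_alpha_bounds in simp)
    finally show ?thesis .
  qed
  have i: "qi \<in> octahedral_axes" by (auto simp: octahedral_axes_def forall_4) (simp_all add: qi_def)
  consider "R = binary_tetrahedral" | "\<forall>g\<in>R. \<forall>v\<in>octahedral_axes. g \<star> v \<star> qcnj g \<in> octahedral_axes"
    | "\<forall>g\<in>R. \<forall>v\<in>icosahedral_axes. g \<star> v \<star> qcnj g \<in> icosahedral_axes"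
    using R(2) unfolding polyhedral_def by blast
  then show ?thesis
  proof cases
    case 1
    have iT: "qi \<in> R" unfolding 1 binary_tetrahedral_def by (auto simp: qi_def quat_def) (simp flip: qi_def quat_def)
    \<comment> \<open>A conjugate of \<open>qi\<close> is a Hurwitz unit with real part 0, and only
      the six coordinate units have this property.\<close>
    have "r \<star> qi \<star> qcnj r \<in> octahedral_axes" if r: "r \<in> R" for r
    proof -
      define v where "v = r \<star> qi \<star> qcnj r"
      have v: "v \<in> binary_tetrahedral" "v \<in> pure_units"
        using unit_group_conj[OF R(1) r iT] 1 conj_pure_units[OF unit_groupD(1)[OF R(1) r]] by (simp_all add: v_def)
      have "v \<in> {q1, - q1, qi, - qi, qj, - qj, qk, - qk}"
        using binary_tetrahedral_cases[OF v(1)] pure_unitsD(2)[OF v(2)]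
        by (metis abs_zero divide_eq_0_iff zero_neq_numeral zero_neq_one)
      then have "v \<in> {qi, - qi, qj, - qj, qk, - qk}"
        using pure_unitsD(2)[OF v(2)] by (auto simp: q1_def)
      then have "\<forall>i. v $ i \<in> {0, 1, - 1}"
        by (auto simp: forall_4 qbase)
      then show ?thesis using v by (simp add: octahedral_axes_def v_def)
    qed
    then show ?thesis using that[of qi q] q oct by (simp add: spread_pair_def)
  next
    case 2
    then show ?thesis using that[of qi q] q oct i by (simp add: spread_pair_def)
  next
    case 3
    let ?p = "quat 0 0 ico_h (phi * ico_h)"
    have "?p \<in> icosahedral_axes" using ico_h_pos phi_bounds by (simp add: icosahedral_axes_def abs_mult)
    then show ?thesis using that[of ?p q] q ico 3 ico_axis_pure(1) by (simp add: spread_pair_def)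
  qed
qed

text \<open>Phrased for the full product of \<open>L\<close> and \<open>R\<close>, which contains
  every group of pairs with these projections.\<close>

definition far_apart :: "(real^4) set \<Rightarrow> (real^4) set \<Rightarrow> bool" where
  "far_apart L R \<longleftrightarrow> (\<exists>x y. norm x = 1 \<and> norm y = 1 \<and> (\<forall>l\<in>L. \<forall>r\<in>R. (l \<star> x \<star> qcnj r) \<bullet> y \<le> cos_half_alpha))"

lemma far_apart_commute:
  assumes "far_apart L R"
  shows "far_apart R L"
proof -
  obtain x y where xy: "norm x = 1" "norm y = 1"
    "\<And>l r. l \<in> L \<Longrightarrow> r \<in> R \<Longrightarrow> (l \<star> x \<star> qcnj r) \<bullet> y \<le> cos_half_alpha"
    using assms unfolding far_apart_def by blast
  have "(r \<star> qcnj x \<star> qcnj l) \<bullet> qcnj y = (l \<star> x \<star> qcnj r) \<bullet> y" for l r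
    using inner_qcnj[of "l \<star> x \<star> qcnj r" y] by (simp add: qmul_assoc)
  then show ?thesis unfolding far_apart_def
    by (intro exI[of _ "qcnj x"] exI[of _ "qcnj y"]) (simp add: xy)
qed

text \<open>Under the Hopf map \<open>z \<mapsto> qcnj z \<star> u \<star> z\<close> the left factor
  contributes at most a sign, while the right one acts by conjugation. The points
  \<open>qcnj a\<close> and \<open>qcnj b\<close> lie over \<open>p\<close> and \<open>q\<close>, so
  their orbits are separated by at least half the angle.\<close>

lemma far_apart_line:
  assumes L: "unit_group L" "preserves_line L" and R: "unit_group R" and pq: "spread_pair R p q"
  shows "far_apart L R"
proof -
  obtain u where u: "u \<in> pure_units" "\<And>g. g \<in> L \<Longrightarrow> g \<star> u \<star> qcnj g = u \<or> g \<star> u \<star> qcnj g = - u"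
    using L unfolding preserves_line_def by blast
  obtain a where a: "norm a = 1" "a \<star> u \<star> qcnj a = p"
    using pure_units_transitive u(1) pq unfolding spread_pair_def by blast
  obtain b where b: "norm b = 1" "b \<star> u \<star> qcnj b = q"
    using pure_units_transitive u(1) pq unfolding spread_pair_def by blast
  have "(l \<star> qcnj a \<star> qcnj r) \<bullet> qcnj b \<le> cos_half_alpha" if lr: "l \<in> L" "r \<in> R" for l r
  proof -
    define z where "z = l \<star> qcnj a \<star> qcnj r"
    have z: "norm z = 1" using a unit_groupD(1)[OF L(1) lr(1)] unit_groupD(1)[OF R lr(2)] by (simp add: z_def)
    have "qcnj l \<star> u \<star> l = u \<or> qcnj l \<star> u \<star> l = - u"
      using u(2)[OF unit_groupD(4)[OF L(1) lr(1)]] by simp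
    moreover have "qcnj z \<star> u \<star> z = r \<star> (a \<star> (qcnj l \<star> u \<star> l) \<star> qcnj a) \<star> qcnj r"
      by (simp add: z_def qmul_assoc)
    ultimately have "qcnj z \<star> u \<star> z = r \<star> p \<star> qcnj r \<or> qcnj z \<star> u \<star> z = - (r \<star> p \<star> qcnj r)"
      using a by (auto simp: qmul_simps)
    then have "(qcnj z \<star> u \<star> z) \<bullet> q \<le> \<bar>(r \<star> p \<star> qcnj r) \<bullet> q\<bar>" by auto
    also have "\<dots> \<le> cos_alpha" using pq lr unfolding spread_pair_def by blast
    finally have *: "(qcnj z \<star> u \<star> z) \<bullet> q \<le> cos_alpha" .
    have "2 * (z \<bullet> qcnj b)\<^sup>2 \<le> 1 + (qcnj z \<star> u \<star> z) \<bullet> q"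
      using hopf_inner_bound[OF z _ u(1), of "qcnj b"] b by simp
    then have "(z \<bullet> qcnj b)\<^sup>2 \<le> cos_half_alpha\<^sup>2" using * cos_half_alpha_sq by simp
    then show ?thesis using cos_half_alpha_bound unfolding z_def by (auto intro: power2_le_imp_le)
  qed
  then show ?thesis unfolding far_apart_def
    using a b by (intro exI[of _ "qcnj a"] exI[of _ "qcnj b"]) simp
qed

section \<open>Estimates for two polyhedral groups\<close>

lemma inner_binary_tetrahedral_le:
  assumes t: "t \<in> binary_tetrahedral" and w: "\<And>i. \<bar>w $ i\<bar> \<le> B"
    and sum: "\<bar>w $ 1\<bar> + \<bar>w $ 2\<bar> + \<bar>w $ 3\<bar> + \<bar>w $ 4\<bar> \<le> 2 * B"
  shows "t \<bullet> w \<le> B"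
  \<comment> \<open>The eight vertices on the axes pick out one coordinate of \<open>w\<close>; the
    other sixteen give at most half the sum of the absolute values.\<close>
  using binary_tetrahedral_cases[OF t]
proof
  assume "t \<in> {q1, - q1, qi, - qi, qj, - qj, qk, - qk}"
  then show ?thesis using w[of 1] w[of 2] w[of 3] w[of 4]
    by (auto simp: inner_quat qbase)
next
  assume h: "\<forall>i. \<bar>t $ i\<bar> = 1/2"
  have "t $ i * w $ i \<le> \<bar>w $ i\<bar> / 2" for i
    using abs_ge_self[of "t $ i * w $ i"] h by (simp add: abs_mult)
  from this[of 1] this[of 2] this[of 3] this[of 4] show ?thesis
    unfolding inner_quat using sum by linarith
qed

text \<open>Moving \<open>e\<close> to the other side of the inner product replaces \<open>w\<close>
  by a multiple of \<open>w - v \<star> w\<close>. As \<open>v\<close> permutes the coordinates up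
  to sign, the new coordinates are sums and differences of two old ones; hence the hypothesis on
  pairs.\<close>

lemma inner_octahedral_cap_le:
  assumes e: "e \<in> octahedral_caps" and t: "t \<in> binary_tetrahedral"
    and w: "\<And>i. \<bar>w $ i\<bar> \<le> B" and sum: "\<bar>w $ 1\<bar> + \<bar>w $ 2\<bar> + \<bar>w $ 3\<bar> + \<bar>w $ 4\<bar> \<le> 2 * B"
    and pair: "\<And>i j. i \<noteq> j \<Longrightarrow> \<bar>w $ i\<bar> + \<bar>w $ j\<bar> \<le> sqrt 2 * B"
  shows "(e \<star> t) \<bullet> w \<le> B"
proof (cases "e = q1")
  case True
  then show ?thesis using inner_binary_tetrahedral_le[OF t w sum] by simp
next
  case False
  then obtain v where v: "v \<in> octahedral_axes" "e = qcis v (pi / 4)"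
    using e by (auto simp: octahedral_caps_def)
  then have pv: "v \<in> pure_units" by (simp add: octahedral_axes_def)
  define x where "x = w - v \<star> w"
  have "qcnj e \<star> w = (sqrt 2 / 2) *\<^sub>R x"
    using pv by (simp add: v x_def qcis_def cos_45 sin_45 pure_units_qcnj qmul_simps scaleR_diff_right)
  then have ew: "(e \<star> t) \<bullet> w = (sqrt 2 / 2) * (t \<bullet> x)" by (simp add: inner_qmul_left)
  define C where "C = sqrt 2 * B"
  have p: "\<bar>w $ 1\<bar> + \<bar>w $ 2\<bar> \<le> C" "\<bar>w $ 1\<bar> + \<bar>w $ 3\<bar> \<le> C" "\<bar>w $ 1\<bar> + \<bar>w $ 4\<bar> \<le> C"
    "\<bar>w $ 2\<bar> + \<bar>w $ 3\<bar> \<le> C" "\<bar>w $ 2\<bar> + \<bar>w $ 4\<bar> \<le> C" "\<bar>w $ 3\<bar> + \<bar>w $ 4\<bar> \<le> C"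
    unfolding C_def by (rule pair; simp)+
  have x: "\<And>i. \<bar>x $ i\<bar> \<le> C \<and> \<bar>x $ 1\<bar> + \<bar>x $ 2\<bar> + \<bar>x $ 3\<bar> + \<bar>x $ 4\<bar> \<le> 2 * C"
  proof -
    have *: "(\<bar>x $ 1\<bar> \<le> C \<and> \<bar>x $ 2\<bar> \<le> C \<and> \<bar>x $ 3\<bar> \<le> C \<and> \<bar>x $ 4\<bar> \<le> C) \<and> \<bar>x $ 1\<bar> + \<bar>x $ 2\<bar> + \<bar>x $ 3\<bar> + \<bar>x $ 4\<bar> \<le> 2 * C"
      using octahedral_axes_cases[OF v(1)] unfolding x_def
      by (elim insertE emptyE; simp add: qmul_def qbase; use p in argo)
    then show "\<bar>x $ i\<bar> \<le> C \<and> \<bar>x $ 1\<bar> + \<bar>x $ 2\<bar> + \<bar>x $ 3\<bar> + \<bar>x $ 4\<bar> \<le> 2 * C" for i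
      using exhaust_4[of i] by auto
  qed
  then have "t \<bullet> x \<le> C" by (intro inner_binary_tetrahedral_le[OF t]) auto
  then have "(sqrt 2 / 2) * (t \<bullet> x) \<le> (sqrt 2 / 2) * (sqrt 2 * B)" by (simp add: C_def)
  also have "\<dots> = B" by simp
  finally show ?thesis unfolding ew .
qed


text \<open>Doubling removes the denominators, so that after fixing the signs all later estimates
  are linear in \<open>phi\<close>.\<close>

lemma icosahedral_cap_cases:
  assumes "e \<in> icosahedral_caps"
  obtains "e = q1"
  | a b where "\<bar>a\<bar> = 1" "\<bar>b\<bar> = 1" "2 *\<^sub>R e \<in> {quat phi 0 ((phi - 1) * a) b, quat phi b 0 ((phi - 1) * a), quat phi ((phi - 1) * a) b 0}"
proof (cases "e = q1")
  case False
  then obtain v where v: "v \<in> icosahedral_axes" "e = qcis v (pi / 5)"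
    using assms by (auto simp: icosahedral_caps_def)
  define s where "s = 2 * sin (pi / 5)"
  have sh: "s * ico_h = phi - 1" using ico_h_sin by (simp add: s_def mult.commute)
  have sp: "s * (phi * ico_h) = 1"
  proof -
    have "s * (phi * ico_h) = phi * (phi - 1)" unfolding sh[symmetric] by simp
    then show ?thesis using phi_sq by (simp add: algebra_simps)
  qed
  have e: "2 *\<^sub>R e = quat phi (s * v $ 2) (s * v $ 3) (s * v $ 4)"
    using v(1) by (simp add: v(2) quat_eq_iff qcis_def q1_def cos_pi_fifth s_def icosahedral_axes_def)
  have small: "\<exists>a. \<bar>a\<bar> = 1 \<and> s * y = (phi - 1) * a" if "\<bar>y\<bar> = ico_h" for y
  proof (cases "y \<ge> 0")
    case True
    then show ?thesis using that sh by (intro exI[of _ 1]) simp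
  next
    case False
    then have "y = - ico_h" using that by simp
    then show ?thesis using sh by (intro exI[of _ "-1"]) simp
  qed
  have large: "\<bar>s * y\<bar> = 1" if "\<bar>y\<bar> = phi * ico_h" for y
  proof -
    have "s > 0" unfolding s_def by (simp add: sin_gt_zero)
    then have "\<bar>s * y\<bar> = s * (phi * ico_h)" using that by (simp add: abs_mult)
    then show ?thesis using sp by simp
  qed
  consider "v $ 2 = 0" "\<bar>v $ 3\<bar> = ico_h" "\<bar>v $ 4\<bar> = phi * ico_h"
    | "v $ 3 = 0" "\<bar>v $ 4\<bar> = ico_h" "\<bar>v $ 2\<bar> = phi * ico_h"
    | "v $ 4 = 0" "\<bar>v $ 2\<bar> = ico_h" "\<bar>v $ 3\<bar> = phi * ico_h"
    using v(1) by (auto simp: icosahedral_axes_def)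
  then show ?thesis
  proof cases
    case 1
    obtain a where "\<bar>a\<bar> = 1" "s * v $ 3 = (phi - 1) * a" using small[OF 1(2)] by blast
    then show ?thesis using that(2)[of a "s * v $ 4"] large[OF 1(3)] e 1(1) by simp
  next
    case 2
    obtain a where "\<bar>a\<bar> = 1" "s * v $ 4 = (phi - 1) * a" using small[OF 2(2)] by blast
    then show ?thesis using that(2)[of a "s * v $ 2"] large[OF 2(3)] e 2(1) by simp
  next
    case 3
    obtain a where "\<bar>a\<bar> = 1" "s * v $ 2 = (phi - 1) * a" using small[OF 3(2)] by blast
    then show ?thesis using that(2)[of a "s * v $ 3"] large[OF 3(3)] e 3(1) by simp
  qed
qed (use that in simp)

text \<open>Found numerically: the direction of \<open>5 + 2i\<close> is about \<open>19.8\<close> degrees away from every product of a binary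
  octahedral and a binary icosahedral element, while \<open>\<alpha>/2\<close> is about \<open>18.7\<close> degrees.\<close>

definition hole :: "real^4" where "hole = (1 / sqrt 29) *\<^sub>R quat 5 2 0 0"

lemma norm_hole [simp]: "norm hole = 1"
proof -
  have "quat 5 2 0 0 \<bullet> quat 5 2 0 0 = 29" by (simp add: inner_quat)
  then have "norm (quat 5 2 0 0) = sqrt 29" by (simp only: norm_eq_sqrt_inner)
  then show ?thesis by (simp add: hole_def)
qed

text \<open>\<open>quat 10 4 0 0\<close> is \<open>hole\<close> times \<open>2 * sqrt 29\<close>.
  The critical quantity is a sum of two coordinates, \<open>7 * phi + 3\<close> or about 14.326,
  rounded up to \<open>359 / 25\<close>; the bound \<open>254 / 25\<close> is just above
  \<open>359 / 25\<close> divided by \<open>sqrt 2\<close>.\<close>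

lemma hole_icosahedral_cap:
  fixes w :: "real^4"
  assumes e: "e \<in> icosahedral_caps" and w: "w = quat 10 4 0 0 \<star> e"
  shows "\<bar>w $ i\<bar> \<le> 254 / 25" "\<bar>w $ 1\<bar> + \<bar>w $ 2\<bar> + \<bar>w $ 3\<bar> + \<bar>w $ 4\<bar> \<le> 508 / 25"
    "i \<noteq> j \<Longrightarrow> \<bar>w $ i\<bar> + \<bar>w $ j\<bar> \<le> 359 / 25"
proof -
  have ph: "809 / 500 < phi" "phi < 16181 / 10000" using phi_bounds by simp_all
  have "\<bar>w $ 1\<bar> \<le> 254 / 25 \<and> \<bar>w $ 2\<bar> \<le> 254 / 25 \<and> \<bar>w $ 3\<bar> \<le> 254 / 25 \<and> \<bar>w $ 4\<bar> \<le> 254 / 25 \<and>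
     \<bar>w $ 1\<bar> + \<bar>w $ 2\<bar> + \<bar>w $ 3\<bar> + \<bar>w $ 4\<bar> \<le> 508 / 25 \<and>
     \<bar>w $ 1\<bar> + \<bar>w $ 2\<bar> \<le> 359 / 25 \<and> \<bar>w $ 1\<bar> + \<bar>w $ 3\<bar> \<le> 359 / 25 \<and> \<bar>w $ 1\<bar> + \<bar>w $ 4\<bar> \<le> 359 / 25 \<and>
     \<bar>w $ 2\<bar> + \<bar>w $ 3\<bar> \<le> 359 / 25 \<and> \<bar>w $ 2\<bar> + \<bar>w $ 4\<bar> \<le> 359 / 25 \<and> \<bar>w $ 3\<bar> + \<bar>w $ 4\<bar> \<le> 359 / 25"
    using e
  proof (cases rule: icosahedral_cap_cases)
    case 1
    then show ?thesis by (simp add: w)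
  next
    case (2 a b)
    have w2: "w = quat 5 2 0 0 \<star> (2 *\<^sub>R e)" by (simp add: w quat_eq_iff qmul_def)
    have ab: "a = 1 \<or> a = -1" "b = 1 \<or> b = -1" using 2(1,2) by (auto simp: abs_if split: if_splits)
    consider "w = quat 5 2 0 0 \<star> quat phi 0 ((phi - 1) * a) b" | "w = quat 5 2 0 0 \<star> quat phi b 0 ((phi - 1) * a)"
      | "w = quat 5 2 0 0 \<star> quat phi ((phi - 1) * a) b 0"
      using 2(3) w2 by auto
    then show ?thesis
    proof cases
      case 1
      then have "w $ 1 = 5 * phi" "w $ 2 = 2 * phi" "w $ 3 = 5 * ((phi - 1) * a) - 2 * b" "w $ 4 = 5 * b + 2 * ((phi - 1) * a)"
        by (simp_all add: qmul_def)
      then show ?thesis using ab ph by (elim disjE; simp; argo)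
    next
      case 2
      then have "w $ 1 = 5 * phi - 2 * b" "w $ 2 = 5 * b + 2 * phi" "w $ 3 = - (2 * ((phi - 1) * a))" "w $ 4 = 5 * ((phi - 1) * a)"
        by (simp_all add: qmul_def)
      then show ?thesis using ab ph by (elim disjE; simp; argo)
    next
      case 3
      then have "w $ 1 = 5 * phi - 2 * ((phi - 1) * a)" "w $ 2 = 5 * ((phi - 1) * a) + 2 * phi" "w $ 3 = 5 * b" "w $ 4 = 2 * b"
        by (simp_all add: qmul_def)
      then show ?thesis using ab ph by (elim disjE; simp; argo)
    qed
  qed
  then show "\<bar>w $ i\<bar> \<le> 254 / 25" "\<bar>w $ 1\<bar> + \<bar>w $ 2\<bar> + \<bar>w $ 3\<bar> + \<bar>w $ 4\<bar> \<le> 508 / 25"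
    "i \<noteq> j \<Longrightarrow> \<bar>w $ i\<bar> + \<bar>w $ j\<bar> \<le> 359 / 25"
    using exhaust_4[of i] exhaust_4[of j] by (elim disjE; simp add: add.commute)+
qed

lemma inner_hole_le:
  assumes d: "d \<in> octahedral_caps" and t: "t \<in> binary_tetrahedral" and e: "e \<in> icosahedral_caps"
  shows "(d \<star> t \<star> qcnj e) \<bullet> hole \<le> cos_half_alpha"
proof -
  define w where "w = quat 10 4 0 0 \<star> e"
  have "sqrt 2 * (254 / 25) \<ge> 359 / 25" using sqrt_2_bounds by simp
  then have pair: "i \<noteq> j \<Longrightarrow> \<bar>w $ i\<bar> + \<bar>w $ j\<bar> \<le> sqrt 2 * (254 / 25)" for i j
    using hole_icosahedral_cap(3)[OF e w_def, of i j] by linarith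
  have "(d \<star> t) \<bullet> w / (2 * sqrt 29) \<le> (254 / 25) / (2 * sqrt 29)"
    by (rule divide_right_mono, rule inner_octahedral_cap_le[OF d t])
      (use hole_icosahedral_cap(1,2)[OF e w_def] pair in simp_all)
  moreover
  have "hole \<star> e = (1 / (2 * sqrt 29)) *\<^sub>R w"
    by (simp add: hole_def w_def quat_eq_iff qmul_def diff_divide_distrib add_divide_distrib)
  then have "(d \<star> t \<star> qcnj e) \<bullet> hole = (d \<star> t) \<bullet> w / (2 * sqrt 29)"
    by (simp add: inner_qmul_right[of "d \<star> t" "qcnj e"])
  ultimately have "(d \<star> t \<star> qcnj e) \<bullet> hole \<le> (254 / 25) / (2 * sqrt 29)"
    by simp
  also have "\<dots> \<le> 0.946"
  proof -
    have "5.385 \<le> sqrt 29" by (rule real_le_rsqrt) (simp add: power2_eq_square)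
    then show ?thesis by (simp add: divide_simps)
  qed
  finally show ?thesis using cos_half_alpha_bound by simp
qed

text \<open>The isometry \<open>x \<mapsto> c \<star> x \<star> qcnj d\<close> puts both groups in
  standard position and moves the first point to \<open>q1\<close> and the second to
  \<open>z\<close>. Its orbit then consists of the products that have to avoid
  \<open>z\<close>.\<close>

lemma far_apart_from_conj:
  assumes c: "norm c = 1" and d: "norm d = 1" and z: "norm z = 1"
    and far: "\<And>l r. l \<in> conj_set c L \<Longrightarrow> r \<in> conj_set d R \<Longrightarrow> (l \<star> qcnj r) \<bullet> z \<le> cos_half_alpha"
  shows "far_apart L R"
proof -
  have "(l \<star> (qcnj c \<star> d) \<star> qcnj r) \<bullet> (qcnj c \<star> z \<star> d) \<le> cos_half_alpha" if "l \<in> L" "r \<in> R" for l r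
  proof -
    have "(l \<star> (qcnj c \<star> d) \<star> qcnj r) \<bullet> (qcnj c \<star> z \<star> d)
      = (c \<star> (l \<star> (qcnj c \<star> d) \<star> qcnj r) \<star> qcnj d) \<bullet> (c \<star> (qcnj c \<star> z \<star> d) \<star> qcnj d)"
      using c d by (simp only: inner_unit_mult norm_qcnj)
    also have "\<dots> = ((c \<star> l \<star> qcnj c) \<star> qcnj (d \<star> r \<star> qcnj d)) \<bullet> z"
      using c d by (simp add: qmul_assoc)
    finally show ?thesis using far[OF conj_setI conj_setI] that by simp
  qed
  then show ?thesis unfolding far_apart_def using c d z
    by (intro exI[of _ "qcnj c \<star> d"] exI[of _ "qcnj c \<star> z \<star> d"]) simp
qed

lemma q1_caps [simp]: "q1 \<in> octahedral_caps" "q1 \<in> icosahedral_caps"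
  by (simp_all add: octahedral_caps_def icosahedral_caps_def)

lemma binary_tetrahedral_subset_both:
  "binary_tetrahedral \<subseteq> binary_octahedral" "binary_tetrahedral \<subseteq> binary_icosahedral"
proof -
  have "\<exists>e t. x = e \<star> t \<and> e \<in> P \<and> t \<in> binary_tetrahedral" if "q1 \<in> P" "x \<in> binary_tetrahedral" for x P
    using that by (intro exI[of _ q1] exI[of _ x]) simp
  then show "binary_tetrahedral \<subseteq> binary_octahedral" "binary_tetrahedral \<subseteq> binary_icosahedral"
    unfolding binary_octahedral_def binary_icosahedral_def using q1_caps by blast+
qed

lemma inner_hole_octahedral: "g \<in> binary_octahedral \<Longrightarrow> g \<bullet> hole \<le> cos_half_alpha"
  using inner_hole_le[OF _ _ q1_caps(2)] by (auto simp: binary_octahedral_def)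

lemma inner_hole_icosahedral: "g \<in> binary_icosahedral \<Longrightarrow> qcnj g \<bullet> hole \<le> cos_half_alpha"
  using inner_hole_le[OF q1_caps(1) binary_tetrahedral_qcnj] by (auto simp: binary_icosahedral_def)

text \<open>The tetrahedral factor of \<open>l\<close> is absorbed into \<open>r\<close>, because
  the tetrahedral group lies in the icosahedral one. What remains has the shape of
  \<open>inner_hole_le\<close>.\<close>

lemma inner_hole_octahedral_icosahedral:
  assumes L: "unit_group binary_octahedral" and R: "unit_group binary_icosahedral"
    and l: "l \<in> binary_octahedral" and r: "r \<in> binary_icosahedral"
  shows "(l \<star> qcnj r) \<bullet> hole \<le> cos_half_alpha"
proof -
  obtain d t where dt: "d \<in> octahedral_caps" "t \<in> binary_tetrahedral" "l = d \<star> t"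
    using l by (auto simp: binary_octahedral_def)
  have "qcnj t \<in> binary_icosahedral"
    using binary_tetrahedral_qcnj[OF dt(2)] binary_tetrahedral_subset_both by blast
  then have "r \<star> qcnj t \<in> binary_icosahedral" using R r by (simp add: unit_groupD)
  then obtain e s where es: "e \<in> icosahedral_caps" "s \<in> binary_tetrahedral" "r \<star> qcnj t = e \<star> s"
    by (auto simp: binary_icosahedral_def)
  have "l \<star> qcnj r = d \<star> qcnj (r \<star> qcnj t)" by (simp add: dt qmul_assoc)
  also have "\<dots> = d \<star> qcnj s \<star> qcnj e" unfolding es(3) by (simp add: qmul_assoc)
  finally show ?thesis using inner_hole_le dt es binary_tetrahedral_qcnj by simp
qed

lemma polyhedral_far_apart:
  assumes L: "unit_group L" "norm c = 1" "polyhedral (conj_set c L)"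
    and R: "unit_group R" "norm d = 1" "polyhedral (conj_set d R)"
  shows "far_apart L R"
proof -
  have gL: "unit_group (conj_set c L)" and gR: "unit_group (conj_set d R)"
    using L R by (simp_all add: unit_group_conj_set)
  have pL: "conj_set c L \<in> {binary_tetrahedral, binary_octahedral, binary_icosahedral}"
    and pR: "conj_set d R \<in> {binary_tetrahedral, binary_octahedral, binary_icosahedral}"
    using L R by (auto simp: polyhedral_def)
  have mult: "l \<star> qcnj r \<in> M" if "unit_group M" "l \<in> M" "r \<in> M" for M l r
    using that by (simp add: unit_groupD)
  note sub = binary_tetrahedral_subset_both
  have oct: "far_apart L R" if M: "unit_group M" "M \<subseteq> binary_octahedral" "conj_set c L \<subseteq> M" "conj_set d R \<subseteq> M" for M
    by (rule far_apart_from_conj[OF L(2) R(2) norm_hole])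
      (use M mult inner_hole_octahedral in blast)
  \<comment> \<open>In \<open>inner_hole_le\<close> the icosahedral factor appears inverted on the
    right, hence the conjugate of \<open>hole\<close> here.\<close>
  have ico: "far_apart L R" if M: "unit_group M" "M \<subseteq> binary_icosahedral" "conj_set c L \<subseteq> M" "conj_set d R \<subseteq> M" for M
  proof (rule far_apart_from_conj[OF L(2) R(2), of "qcnj hole"])
    show "(l \<star> qcnj r) \<bullet> qcnj hole \<le> cos_half_alpha" if "l \<in> conj_set c L" "r \<in> conj_set d R" for l r
    proof -
      have "l \<star> qcnj r \<in> binary_icosahedral" using mult[OF M(1), of l r] that M by blast
      then have "qcnj (l \<star> qcnj r) \<bullet> hole \<le> cos_half_alpha" by (rule inner_hole_icosahedral)
      then show ?thesis by (simp only: inner_qcnj_left)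
    qed
  qed simp
  \<comment> \<open>Unless the octahedral meets the icosahedral group, one standard group contains
    the other, and all products stay in the larger one.\<close>
  consider "conj_set c L \<subseteq> conj_set d R" | "conj_set d R \<subseteq> conj_set c L"
    | "conj_set c L = binary_octahedral" "conj_set d R = binary_icosahedral"
    | "conj_set c L = binary_icosahedral" "conj_set d R = binary_octahedral"
    using pL pR sub by auto
  then show ?thesis
  proof cases
    case 1
    then show ?thesis using oct[OF gR] ico[OF gR] pR sub by blast
  next
    case 2
    then show ?thesis using oct[OF gL] ico[OF gL] pL sub by blast
  next
    case 3
    show ?thesis
      by (rule far_apart_from_conj[OF L(2) R(2) norm_hole])
        (use 3 gL gR inner_hole_octahedral_icosahedral in simp)
  next
    case 4
    have "far_apart R L"
      by (rule far_apart_from_conj[OF R(2) L(2) norm_hole])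
        (use 4 gL gR inner_hole_octahedral_icosahedral in simp)
    then show ?thesis by (rule far_apart_commute)
  qed
qed

theorem proper_unit_groups_far_apart:
  assumes L: "unit_group L" "closed L" "- q1 \<in> L" "L \<noteq> sphere 0 1"
    and R: "unit_group R" "closed R" "- q1 \<in> R" "R \<noteq> sphere 0 1"
  shows "far_apart L R"
proof -
  have spread: "\<exists>p q. spread_pair M p q" if M: "unit_group M" "closed M" "- q1 \<in> M" "M \<noteq> sphere 0 1" for M
  proof (cases "preserves_line M")
    case True
    then show ?thesis using preserves_line_spread_pair by blast
  next
    case False
    then obtain c where c: "norm c = 1" "polyhedral (conj_set c M)"
      using closed_unit_group_classification M by blast
    then show ?thesis
      using polyhedral_spread_pair[OF unit_group_conj_set[OF c(1) M(1)] c(2)] spread_pair_conj[OF c(1)] by metis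
  qed
  show ?thesis
  proof (cases "preserves_line L \<or> preserves_line R")
    case True
    then show ?thesis using far_apart_line far_apart_commute spread L R by metis
  next
    case False
    then show ?thesis
      using closed_unit_group_classification polyhedral_far_apart L R by metis
  qed
qed

text \<open>A single group is the special case in which the right-hand group is
  \<open>{q1, - q1}\<close>. This is the form needed when orientation is reversed.\<close>

lemma proper_unit_group_far_point:
  assumes L: "unit_group L" "closed L" "- q1 \<in> L" "L \<noteq> sphere 0 1"
  obtains z where "norm z = 1" "\<And>l. l \<in> L \<Longrightarrow> l \<bullet> z \<le> cos_half_alpha"
proof -
  have "qi \<in> sphere 0 1" by simp
  moreover have "qi \<notin> {q1, - q1}" by (auto simp: quat_eq_iff qbase)
  ultimately have "{q1, - q1} \<noteq> sphere 0 1" by metis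
  moreover have "unit_group {q1, - q1}" by (auto simp: unit_group_def qmul_simps)
  ultimately have "far_apart L {q1, - q1}"
    using proper_unit_groups_far_apart[OF L, of "{q1, - q1}"] by (simp add: finite_imp_closed)
  then obtain x y where xy: "norm x = 1" "norm y = 1" "\<And>l. l \<in> L \<Longrightarrow> (l \<star> x \<star> qcnj q1) \<bullet> y \<le> cos_half_alpha"
    unfolding far_apart_def by blast
  show ?thesis
    by (rule that[of "y \<star> qcnj x"]) (use xy in \<open>simp_all add: inner_qmul_right\<close>)
qed

section \<open>Groups of pairs with a full projection\<close>

lemma unit_group_fst: "pair_group H \<Longrightarrow> unit_group (fst ` H)"
  unfolding unit_group_def
proof (intro conjI)
  assume H: "pair_group H"
  show "fst ` H \<subseteq> sphere 0 1" using pair_groupD(1)[OF H] by auto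
  show "q1 \<in> fst ` H" using pair_groupD(3)[OF H] by force
  show "\<forall>x\<in>fst ` H. \<forall>y\<in>fst ` H. x \<star> y \<in> fst ` H" using pair_groupD(4)[OF H] by force
  show "\<forall>x\<in>fst ` H. qcnj x \<in> fst ` H" using pair_groupD(5)[OF H] by force
qed

lemma pair_group_swap:
  assumes H: "pair_group H"
  shows "pair_group (prod.swap ` H)"
  unfolding pair_group_def
proof (intro conjI allI impI)
  have mem: "(a, b) \<in> prod.swap ` H \<longleftrightarrow> (b, a) \<in> H" for a b by force
  show "prod.swap ` H \<subseteq> sphere 0 1 \<times> sphere 0 1"
    using pair_groupD(1,2)[OF H] by force
  show "(q1, q1) \<in> prod.swap ` H" unfolding mem by (rule pair_groupD(3)[OF H])
  show "(a \<star> c, b \<star> d) \<in> prod.swap ` H" if "(a, b) \<in> prod.swap ` H" "(c, d) \<in> prod.swap ` H" for a b c d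
    using that unfolding mem by (rule pair_groupD(4)[OF H])
  show "(qcnj a, qcnj b) \<in> prod.swap ` H" if "(a, b) \<in> prod.swap ` H" for a b
    using that unfolding mem by (rule pair_groupD(5)[OF H])
qed

lemma closed_fst_pair_group:
  assumes "pair_group H" "closed H"
  shows "closed (fst ` H)" "compact H"
proof -
  have "H \<subseteq> sphere 0 1 \<times> sphere 0 1" using assms(1) by (simp add: pair_group_def)
  then have "bounded H" by (rule bounded_subset[rotated]) (intro bounded_Times bounded_sphere)
  then show "compact H" using assms(2) by (simp add: compact_eq_bounded_closed)
  then show "closed (fst ` H)"
    by (intro compact_imp_closed compact_continuous_image continuous_intros)
qed

lemma swap_image: "(r, l) \<in> prod.swap ` H \<longleftrightarrow> (l, r) \<in> H" "fst ` prod.swap ` H = snd ` H"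
  by (force, simp add: image_image)

lemma closed_swap_pair_group:
  assumes "pair_group H" "closed H"
  shows "closed (prod.swap ` H)"
  using closed_fst_pair_group(2)[OF assms]
  by (intro compact_imp_closed compact_continuous_image continuous_on_swap)

lemma pair_group_projections:
  assumes H: "pair_group H" "closed H" "(- q1, - q1) \<in> H"
  shows "unit_group (fst ` H)" "closed (fst ` H)" "- q1 \<in> fst ` H"
    "unit_group (snd ` H)" "closed (snd ` H)" "- q1 \<in> snd ` H"
proof -
  have sw: "pair_group (prod.swap ` H)" "closed (prod.swap ` H)"
    using pair_group_swap closed_swap_pair_group H by blast+
  show "unit_group (fst ` H)" "closed (fst ` H)"
    using unit_group_fst[OF H(1)] closed_fst_pair_group(1)[OF H(1,2)] by simp_all
  show "unit_group (snd ` H)" "closed (snd ` H)"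
    using unit_group_fst[OF sw(1)] closed_fst_pair_group(1)[OF sw] by (simp_all add: swap_image(2))
  show "- q1 \<in> fst ` H" "- q1 \<in> snd ` H" using H(3) by force+
qed

definition left_kernel :: "((real^4) \<times> (real^4)) set \<Rightarrow> (real^4) set" where
  "left_kernel H = {l. \<exists>e\<in>{q1, - q1}. (l, e) \<in> H}"

lemma unit_group_left_kernel:
  assumes H: "pair_group H"
  shows "unit_group (left_kernel H)"
  unfolding unit_group_def
proof (intro conjI ballI)
  show "left_kernel H \<subseteq> sphere 0 1" "q1 \<in> left_kernel H"
    using pair_groupD(1,3)[OF H] by (auto simp: left_kernel_def)
  show "x \<star> y \<in> left_kernel H" if "x \<in> left_kernel H" "y \<in> left_kernel H" for x y
  proof -
    obtain e f where e: "e \<in> {q1, - q1}" "(x, e) \<in> H" and f: "f \<in> {q1, - q1}" "(y, f) \<in> H"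
      using \<open>x \<in> left_kernel H\<close> \<open>y \<in> left_kernel H\<close> unfolding left_kernel_def by blast
    have "e \<star> f \<in> {q1, - q1}" using e f by (auto simp: qmul_simps)
    then show ?thesis using pair_groupD(4)[OF H e(2) f(2)] unfolding left_kernel_def by blast
  qed
  show "qcnj x \<in> left_kernel H" if "x \<in> left_kernel H" for x
  proof -
    obtain e where e: "e \<in> {q1, - q1}" "(x, e) \<in> H"
      using \<open>x \<in> left_kernel H\<close> unfolding left_kernel_def by blast
    have "qcnj e \<in> {q1, - q1}" using e by auto
    then show ?thesis using pair_groupD(5)[OF H e(2)] unfolding left_kernel_def by blast
  qed
qed

text \<open>Since the first projection is everything, the left kernel is normal in the unit sphere
  and therefore everything. Squaring a square root of \<open>l\<close> removes the sign in the
  second component.\<close>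

lemma left_kernel_full:
  assumes H: "pair_group H" and full: "fst ` H = sphere 0 1"
    and k: "k \<in> left_kernel H" "k \<noteq> q1" "k \<noteq> - q1" and "norm l = 1"
  shows "(l, q1) \<in> H"
proof -
  have "a \<star> x \<star> qcnj a \<in> left_kernel H" if a: "norm a = 1" and x: "x \<in> left_kernel H" for a x
  proof -
    have "a \<in> fst ` H" using full a by simp
    then obtain r where r: "(a, r) \<in> H" by auto
    then have nr: "norm r = 1" using pair_groupD(2)[OF H] by blast
    obtain e where e: "e \<in> {q1, - q1}" "(x, e) \<in> H" using x unfolding left_kernel_def by blast
    have "(a \<star> x \<star> qcnj a, r \<star> e \<star> qcnj r) \<in> H"
      using pair_groupD(4,5)[OF H] r e(2) by metis
    moreover have "r \<star> e \<star> qcnj r \<in> {q1, - q1}" using e(1) nr by (auto simp: qmul_simps)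
    ultimately show ?thesis unfolding left_kernel_def by blast
  qed
  then have K: "left_kernel H = sphere 0 1"
    using normal_noncentral_full[OF unit_group_left_kernel[OF H] _ k] by blast
  obtain u t where u: "u \<in> pure_units" "l = qcis u t" using unit_quat_polar[OF assms(6)] by metis
  have "qcis u (t / 2) \<in> left_kernel H" using u K by simp
  then obtain e where e: "e \<in> {q1, - q1}" "(qcis u (t / 2), e) \<in> H" unfolding left_kernel_def by blast
  have "e \<star> e = q1" using e(1) by (auto simp: qmul_simps)
  then have "(qcis u (t / 2) \<star> qcis u (t / 2), q1) \<in> H"
    using pair_groupD(4)[OF H e(2) e(2)] by simp
  then show ?thesis using u by (simp add: qcis_add)
qed

text \<open>The quaternions commuting with a pure unit form a copy of the complex numbers.\<close>

lemma commute_pure_unit_trans: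
  assumes u: "u \<in> pure_units" and x: "x \<star> u = u \<star> x" and y: "y \<star> u = u \<star> y"
  shows "x \<star> y = y \<star> x"
proof -
  obtain c where c: "norm c = 1" "c \<star> u \<star> qcnj c = qi"
    using pure_units_transitive[OF u pure_units_qbase(1)] .
  have *: "(c \<star> z \<star> qcnj c) $ 3 = 0 \<and> (c \<star> z \<star> qcnj c) $ 4 = 0" if z: "z \<star> u = u \<star> z" for z
  proof -
    have "(c \<star> z \<star> qcnj c) \<star> qi = qi \<star> (c \<star> z \<star> qcnj c)"
      unfolding c(2)[symmetric] conj_mult[OF c(1)] z by simp
    moreover have "w $ 3 = 0 \<and> w $ 4 = 0" if "w \<star> qi = qi \<star> w" for w
      using that by (simp add: qexpand qbase)
    ultimately show ?thesis by blast
  qed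
  have "(c \<star> x \<star> qcnj c) \<star> (c \<star> y \<star> qcnj c) = (c \<star> y \<star> qcnj c) \<star> (c \<star> x \<star> qcnj c)"
  proof -
    have "v \<star> w = w \<star> v" if "v $ 3 = 0 \<and> v $ 4 = 0" "w $ 3 = 0 \<and> w $ 4 = 0" for v w
      using that by (simp add: qexpand)
    then show ?thesis using *[OF x] *[OF y] by blast
  qed
  then have "c \<star> (x \<star> y) \<star> qcnj c = c \<star> (y \<star> x) \<star> qcnj c" by (simp only: conj_mult[OF c(1)])
  then show ?thesis using conj_inverse[OF c(1)] by metis
qed

lemma finite_quat_values:
  assumes "finite S"
  shows "finite {x :: real^4. \<forall>i. x $ i \<in> S}"
proof (rule finite_subset)
  show "{x :: real^4. \<forall>i. x $ i \<in> S} \<subseteq> (\<lambda>(a, b, c, d). quat a b c d) ` (S \<times> S \<times> S \<times> S)"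
  proof
    fix x :: "real^4" assume "x \<in> {x. \<forall>i. x $ i \<in> S}"
    then have "(x $ 1, x $ 2, x $ 3, x $ 4) \<in> S \<times> S \<times> S \<times> S" "x = quat (x $ 1) (x $ 2) (x $ 3) (x $ 4)"
      by (auto simp: quat_eq_iff)
    then show "x \<in> (\<lambda>(a, b, c, d). quat a b c d) ` (S \<times> S \<times> S \<times> S)" by force
  qed
qed (use assms in simp)

lemma finite_polyhedral:
  assumes "polyhedral L"
  shows "finite L"
proof -
  have T: "finite binary_tetrahedral"
    by (rule finite_subset[OF _ finite_quat_values[of "{0, 1/2, -1/2, 1, -1}"]])
      (auto simp: binary_tetrahedral_def)
  have "finite octahedral_axes"
    by (rule finite_subset[OF _ finite_quat_values[of "{0, 1, -1}"]])
      (auto simp: octahedral_axes_def)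
  then have O: "finite octahedral_caps" by (simp add: octahedral_caps_def)
  have abs_in: "y \<in> {0, p, - p, q, - q}" if "\<bar>y\<bar> = 0 \<or> \<bar>y\<bar> = p \<or> \<bar>y\<bar> = q" for y p q :: real
    using that by (auto simp: abs_if split: if_splits)
  have "\<bar>x $ i\<bar> = 0 \<or> \<bar>x $ i\<bar> = ico_h \<or> \<bar>x $ i\<bar> = phi * ico_h" if "x \<in> icosahedral_axes" for x i
    using that exhaust_4[of i] unfolding icosahedral_axes_def by auto
  then have "icosahedral_axes \<subseteq> {x. \<forall>i. x $ i \<in> {0, ico_h, - ico_h, phi * ico_h, - (phi * ico_h)}}"
    using abs_in by blast
  then have "finite icosahedral_axes"
    by (rule finite_subset) (simp only: finite_quat_values finite.intros)
  then have I: "finite icosahedral_caps" by (simp add: icosahedral_caps_def)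
  have "finite {e \<star> t |e t. e \<in> P \<and> t \<in> binary_tetrahedral}" if "finite P" for P
    using finite_image_set2[of "\<lambda>e. e \<in> P" "\<lambda>t. t \<in> binary_tetrahedral" "(\<star>)"] that T by simp
  then show ?thesis using assms T O I
    by (auto simp: polyhedral_def binary_octahedral_def binary_icosahedral_def)
qed

lemma qcis_qi_inj:
  assumes "qcis qi (inverse (real (Suc m))) = qcis qi (inverse (real (Suc n)))"
  shows "m = n"
proof -
  have eq: "cos (inverse (real (Suc m))) = cos (inverse (real (Suc n)))"
    using arg_cong[OF assms, of "\<lambda>x. x $ 1"] by simp
  have le: "inverse (real (Suc k)) \<le> pi" for k
    using pi_ge_two inverse_le_1_iff[of "real (Suc k)"] by linarith
  have "inverse (real (Suc m)) = inverse (real (Suc n))"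
    by (rule cos_inj_pi[OF _ le _ le eq]) simp_all
  then show ?thesis by simp
qed

text \<open>One noncentral element of the left kernel is enough. If the right projection preserves a
  line, squares of its elements commute, so a commutator of squares has trivial right component.
  Otherwise the right projection is finite, and two of infinitely many left components share a right
  one.\<close>

lemma full_times_proper:
  assumes H: "pair_group H" "closed H" "(- q1, - q1) \<in> H"
    and full: "fst ` H = sphere 0 1" and proper: "snd ` H \<noteq> sphere 0 1"
    and l: "norm l = 1"
  shows "(l, q1) \<in> H"
proof -
  note R = pair_group_projections(4-6)[OF H]
  have ex: "\<exists>r. (a, r) \<in> H" if "norm a = 1" for a
  proof -
    have "a \<in> fst ` H" using full that by simp
    then show ?thesis by auto
  qed
  show ?thesis
  proof (cases "preserves_line (snd ` H)")
    case True
    then obtain u where u: "u \<in> pure_units"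
      "\<And>r. r \<in> snd ` H \<Longrightarrow> r \<star> u \<star> qcnj r = u \<or> r \<star> u \<star> qcnj r = - u"
      unfolding preserves_line_def by blast
    have sq: "(r \<star> r) \<star> u = u \<star> (r \<star> r)" if r: "r \<in> snd ` H" for r
    proof -
      have nr: "norm r = 1" using unit_groupD(1)[OF R(1) r] .
      have "r \<star> r \<star> u \<star> qcnj (r \<star> r) = r \<star> (r \<star> u \<star> qcnj r) \<star> qcnj r" by (simp add: qmul_assoc)
      also have "\<dots> = u" using u(2)[OF r] by (auto simp: qmul_simps)
      finally have "r \<star> r \<star> u \<star> qcnj (r \<star> r) \<star> (r \<star> r) = u \<star> (r \<star> r)" by simp
      moreover have "norm (r \<star> r) = 1" using nr by simp
      ultimately show ?thesis using qmul_unit(6) by metis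
    qed
    let ?A = "qcis qi (pi / 4)" and ?B = "qcis qj (pi / 4)"
    \<comment> \<open>Half-angle \<open>pi / 8\<close> makes \<open>?A\<close> and \<open>?B\<close>
      squares of left components; their commutator has real part 1/2 and is not central.\<close>
    obtain r s where r: "(qcis qi (pi / 8), r) \<in> H" and s: "(qcis qj (pi / 8), s) \<in> H"
      using ex by (meson norm_qcis pure_units_qbase)
    have r2: "(?A, r \<star> r) \<in> H" and s2: "(?B, s \<star> s) \<in> H"
      using pair_groupD(4)[OF H(1) r r] pair_groupD(4)[OF H(1) s s] by (simp_all add: qcis_add)
    have "(?A \<star> ?B \<star> qcnj ?A \<star> qcnj ?B, (r \<star> r) \<star> (s \<star> s) \<star> qcnj (r \<star> r) \<star> qcnj (s \<star> s)) \<in> H"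
      using pair_groupD(4,5)[OF H(1)] r2 s2 by metis
    moreover have "(r \<star> r) \<star> (s \<star> s) \<star> qcnj (r \<star> r) \<star> qcnj (s \<star> s) = q1"
    proof -
      have rs: "r \<in> snd ` H" "s \<in> snd ` H" using r s by force+
      have n: "norm (r \<star> r) = 1" "norm (s \<star> s) = 1" using unit_groupD(1)[OF R(1)] rs by simp_all
      have "(r \<star> r) \<star> (s \<star> s) = (s \<star> s) \<star> (r \<star> r)"
        using commute_pure_unit_trans[OF u(1) sq[OF rs(1)] sq[OF rs(2)]] .
      then show ?thesis using qmul_unit(5)[OF n(1)] qmul_unit(1)[OF n(2)] by simp
    qed
    ultimately have k: "?A \<star> ?B \<star> qcnj ?A \<star> qcnj ?B \<in> left_kernel H" by (simp add: left_kernel_def)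
    have "qi \<bullet> qj = 0" by (simp add: inner_quat qbase)
    then have "(?A \<star> ?B \<star> qcnj ?A \<star> qcnj ?B) $ 1 = 1/2"
      by (subst Re_qcis_commutator) (simp_all add: sin_45 power_divide)
    then have "?A \<star> ?B \<star> qcnj ?A \<star> qcnj ?B \<noteq> q1" "?A \<star> ?B \<star> qcnj ?A \<star> qcnj ?B \<noteq> - q1"
      by (auto simp: q1_def)
    then show ?thesis using left_kernel_full[OF H(1) full k] l by blast
  next
    case False
    then obtain c where c: "norm c = 1" "polyhedral (conj_set c (snd ` H))"
      using closed_unit_group_classification R proper by blast
    have "finite (conj_set (qcnj c) (conj_set c (snd ` H)))"
      unfolding conj_set_def[of "qcnj c"] using finite_polyhedral[OF c(2)] by simp
    then have fin: "finite (snd ` H)" using c by (simp add: conj_set_inverse)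
    \<comment> \<open>All angles lie in (0, 1], below \<open>pi / 2\<close>, so two of these
      elements are neither equal nor opposite.\<close>
    define a where "a n = qcis qi (inverse (real (Suc n)))" for n
    have "\<exists>r. (a n, r) \<in> H" for n by (rule ex) (simp add: a_def)
    then obtain r where r: "\<And>n. (a n, r n) \<in> H" by metis
    have "range r \<subseteq> snd ` H" using r by force
    then have "finite (range r)" using fin finite_subset by blast
    then have "\<not> inj r" using finite_imageD[of r UNIV] by auto
    then obtain m n where mn: "m \<noteq> n" "r m = r n" unfolding inj_def by blast
    have "norm (r n) = 1" using r pair_groupD(2)[OF H(1)] by blast
    then have "(a m \<star> qcnj (a n), q1) \<in> H"
      using pair_groupD(4)[OF H(1) r pair_groupD(5)[OF H(1) r], of m n] mn by simp
    then have k: "a m \<star> qcnj (a n) \<in> left_kernel H" by (simp add: left_kernel_def)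
    have na: "norm (a n) = 1" for n by (simp add: a_def)
    have eq: "a m = e \<star> a n" if "a m \<star> qcnj (a n) = e" for e
      using that qmul_unit(6)[OF na, of "a m" n] by simp
    have "a m \<noteq> a n" using mn qcis_qi_inj by (auto simp: a_def)
    moreover have "a m \<noteq> - a n"
    proof
      assume "a m = - a n"
      then have "a m $ 1 + a n $ 1 = 0" by simp
      moreover have "a k $ 1 > 0" for k
      proof -
        have "inverse (real (Suc k)) \<le> 1" by (simp add: inverse_le_1_iff)
        moreover have "1 < pi / 2" using pi_gt3 by simp
        ultimately have "cos (inverse (real (Suc k))) > 0"
          by (intro cos_gt_zero) (simp, linarith)
        then show ?thesis by (simp add: a_def)
      qed
      ultimately show False by (metis add_pos_pos less_irrefl)
    qed
    ultimately have "a m \<star> qcnj (a n) \<noteq> q1" "a m \<star> qcnj (a n) \<noteq> - q1"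
      using eq[of q1] eq[of "- q1"] by (auto simp: qmul_simps)
    then show ?thesis using left_kernel_full[OF H(1) full k] l by blast
  qed
qed


section \<open>Graphs of automorphisms of the rotation group\<close>

definition right_kernel :: "((real^4) \<times> (real^4)) set \<Rightarrow> (real^4) set" where
  "right_kernel H = {r. \<exists>e\<in>{q1, - q1}. (e, r) \<in> H}"

text \<open>With both kernels central, \<open>H\<close> is up to signs the graph of an automorphism
  of SO(3). The goal is that this automorphism is inner.\<close>

locale graph_group =
  fixes H :: "((real^4) \<times> (real^4)) set"
  assumes H: "pair_group H" and closed: "closed H"
    and full: "fst ` H = sphere 0 1" "snd ` H = sphere 0 1"
    and kernels: "left_kernel H \<subseteq> {q1, - q1}" "right_kernel H \<subseteq> {q1, - q1}"
begin

lemmas mult = pair_groupD(4)[OF H] and cnj = pair_groupD(5)[OF H]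

lemma norms: "(l, r) \<in> H \<Longrightarrow> norm l = 1 \<and> norm r = 1"
  using pair_groupD(1,2)[OF H] by blast

lemma ex_right: "norm l = 1 \<Longrightarrow> \<exists>r. (l, r) \<in> H"
proof -
  assume "norm l = 1"
  then have "l \<in> fst ` H" using full by simp
  then show ?thesis by auto
qed

lemma right_unique:
  assumes "(l, r) \<in> H" "(l, s) \<in> H"
  shows "r = s \<or> r = - s"
proof -
  have "(l \<star> qcnj l, r \<star> qcnj s) \<in> H" using mult cnj assms by blast
  then have "r \<star> qcnj s \<in> right_kernel H" using norms[OF assms(1)] by (simp add: right_kernel_def)
  then have "r \<star> qcnj s = q1 \<or> r \<star> qcnj s = - q1" using kernels by blast
  moreover have "r = r \<star> qcnj s \<star> s" using norms[OF assms(2)] by simp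
  ultimately show ?thesis by (metis qmul.minus_left qmul_one(1))
qed

text \<open>Infinitely many elements of a compact group come arbitrarily close to each other, and
  their quotients come close to the identity.\<close>

lemma near_identity:
  assumes "\<epsilon> > 0"
  shows "\<exists>l r. (l, r) \<in> H \<and> (l, r) \<noteq> (q1, q1) \<and> dist l q1 < \<epsilon> \<and> dist r q1 < \<epsilon>"
proof -
  define a where "a n = qcis qi (inverse (real (Suc n)))" for n
  have "\<exists>r. (a n, r) \<in> H" for n by (rule ex_right) (simp add: a_def)
  then obtain r where r: "\<And>n. (a n, r n) \<in> H" by metis
  define z where "z n = (a n, r n)" for n
  have "\<forall>n. z n \<in> H" using r by (simp add: z_def)
  then obtain h k where hk: "strict_mono (k :: nat \<Rightarrow> nat)" "(z \<circ> k) \<longlonglongrightarrow> h"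
    using closed_fst_pair_group(2)[OF H closed] unfolding compact_def by metis
  then have "Cauchy (z \<circ> k)" by (intro LIMSEQ_imp_Cauchy)
  then obtain M where M: "\<And>m n. m \<ge> M \<Longrightarrow> n \<ge> M \<Longrightarrow> dist ((z \<circ> k) m) ((z \<circ> k) n) < \<epsilon>"
    using metric_CauchyD[OF _ assms] by blast
  define m n where "m = k M" and "n = k (Suc M)"
  have "m \<noteq> n" using hk(1) by (simp add: m_def n_def strict_mono_eq)
  have d: "dist (a m, r m) (a n, r n) < \<epsilon>" using M[of M "Suc M"] by (simp add: m_def n_def z_def)
  have nrm: "norm (a n) = 1" "norm (r n) = 1" using norms[OF r] by simp_all
  have shift: "dist (x \<star> qcnj y) q1 = dist x y" if "norm y = 1" for x y
  proof -
    have "(x \<star> qcnj y - q1) \<star> y = x - y" using that by (simp add: qmul_simps)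
    then show ?thesis using that by (metis dist_norm mult.right_neutral norm_qmul)
  qed
  have "(a m \<star> qcnj (a n), r m \<star> qcnj (r n)) \<in> H" using mult cnj r by blast
  moreover have "dist (a m) (a n) < \<epsilon>" "dist (r m) (r n) < \<epsilon>"
    using d dist_fst_le[of "(a m, r m)" "(a n, r n)"] dist_snd_le[of "(a m, r m)" "(a n, r n)"] by auto
  moreover have "a m \<star> qcnj (a n) \<noteq> q1"
  proof
    assume "a m \<star> qcnj (a n) = q1"
    then have "dist (a m) (a n) = 0" using shift[OF nrm(1), of "a m"] by simp
    then show False using qcis_qi_inj \<open>m \<noteq> n\<close> by (auto simp: a_def)
  qed
  ultimately show ?thesis using shift[OF nrm(1)] shift[OF nrm(2)] by (metis prod.inject)
qed

text \<open>When one component of the circle reaches \<open>- q1\<close>, the other must be central.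
  So each speed is an integer multiple of the other, and being positive they agree.\<close>

lemma circle_graph: "\<exists>u\<in>pure_units. \<exists>v\<in>pure_units. \<forall>x. (qcis u x, qcis v x) \<in> H"
proof -
  obtain u v \<kappa> \<mu> where uv: "u \<in> pure_units" "v \<in> pure_units" "0 \<le> \<kappa>" "0 \<le> \<mu>" "\<kappa> + \<mu> = 1"
    and circ: "\<And>x. (qcis u (\<kappa> * x), qcis v (\<mu> * x)) \<in> H"
    using pair_group_one_parameter[OF H closed near_identity] by metis
  have not_central: "w \<noteq> q1 \<and> w \<noteq> - q1" if "w \<in> pure_units" for w
    using pure_unitsD(2)[OF that] by (auto simp: q1_def)
  have "\<kappa> \<noteq> 0"
  proof
    assume "\<kappa> = 0"
    then have "(q1, v) \<in> H" using circ[of "pi / 2"] uv(5) by simp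
    then show False using kernels(2) not_central[OF uv(2)] unfolding right_kernel_def by blast
  qed
  have "\<mu> \<noteq> 0"
  proof
    assume "\<mu> = 0"
    then have "(u, q1) \<in> H" using circ[of "pi / 2"] uv(5) by simp
    then show False using kernels(1) not_central[OF uv(1)] unfolding left_kernel_def by blast
  qed
  have pos: "\<kappa> > 0" "\<mu> > 0" using uv \<open>\<kappa> \<noteq> 0\<close> \<open>\<mu> \<noteq> 0\<close> by simp_all
  have integral: "\<exists>i::int. t = of_int i * pi" if "w \<in> pure_units" "qcis w t = q1 \<or> qcis w t = - q1" for w t
  proof -
    have "qcis w t $ 1 = 1 \<or> qcis w t $ 1 = - 1" using that(2) by (auto simp: q1_def)
    then have "(sin t)\<^sup>2 = 0" using that(1) by (auto simp: sin_squared_eq)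
    then show ?thesis by (simp add: sin_zero_iff_int2)
  qed
  have "(- q1, qcis v (\<mu> * (pi / \<kappa>))) \<in> H" using circ[of "pi / \<kappa>"] \<open>\<kappa> \<noteq> 0\<close> by simp
  then have "qcis v (\<mu> * (pi / \<kappa>)) \<in> right_kernel H" unfolding right_kernel_def by blast
  then have "qcis v (\<mu> * (pi / \<kappa>)) = q1 \<or> qcis v (\<mu> * (pi / \<kappa>)) = - q1" using kernels(2) by blast
  from integral[OF uv(2) this] obtain i where i: "\<mu> * (pi / \<kappa>) = of_int i * pi" by blast
  have "(qcis u (\<kappa> * (pi / \<mu>)), - q1) \<in> H" using circ[of "pi / \<mu>"] \<open>\<mu> \<noteq> 0\<close> by simp
  then have "qcis u (\<kappa> * (pi / \<mu>)) \<in> left_kernel H" unfolding left_kernel_def by blast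
  then have "qcis u (\<kappa> * (pi / \<mu>)) = q1 \<or> qcis u (\<kappa> * (pi / \<mu>)) = - q1" using kernels(1) by blast
  from integral[OF uv(1) this] obtain j where j: "\<kappa> * (pi / \<mu>) = of_int j * pi" by blast
  have ij: "\<mu> = of_int i * \<kappa>" "\<kappa> = of_int j * \<mu>"
  proof -
    have "\<mu> / \<kappa> * pi = of_int i * pi" "\<kappa> / \<mu> * pi = of_int j * pi" using i j by simp_all
    then have d: "\<mu> / \<kappa> = of_int i" "\<kappa> / \<mu> = of_int j" by (simp_all only: mult_cancel_right pi_neq_zero simp_thms)
    show "\<mu> = of_int i * \<kappa>" unfolding d(1)[symmetric] using pos by simp
    show "\<kappa> = of_int j * \<mu>" unfolding d(2)[symmetric] using pos by simp
  qed
  then have "of_int j * of_int i * \<kappa> = 1 * \<kappa>" by (metis mult.assoc mult_1)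
  then have "real_of_int (j * i) = 1" using \<open>\<kappa> \<noteq> 0\<close> by simp
  then have "j * i = 1" by linarith
  moreover have "i > 0" using ij(1) pos by (metis of_int_0_less_iff zero_less_mult_pos2)
  ultimately have "i = 1" using zmult_eq_1_iff[of j i] by auto
  then have "\<mu> = \<kappa>" using ij by simp
  then have half: "\<kappa> = 1/2" "\<mu> = 1/2" using uv(5) by simp_all
  have "(qcis u x, qcis v x) \<in> H" for x using circ[of "2 * x"] by (simp add: half)
  then show ?thesis using uv by blast
qed

text \<open>Conjugation by elements of \<open>H\<close> spreads the one circle over all axes on the
  left, because the left projection is full.\<close>

lemma axis_map:
  "\<exists>f. \<forall>a\<in>pure_units. f a \<in> pure_units \<and> (\<forall>x. (qcis a x, qcis (f a) x) \<in> H)"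
proof -
  obtain u v where uv: "u \<in> pure_units" "v \<in> pure_units" "\<And>x. (qcis u x, qcis v x) \<in> H"
    using circle_graph by blast
  have "\<exists>b\<in>pure_units. \<forall>x. (qcis a x, qcis b x) \<in> H" if a: "a \<in> pure_units" for a
  proof -
    obtain l where l: "norm l = 1" "l \<star> u \<star> qcnj l = a" using pure_units_transitive[OF uv(1) a] .
    obtain r where r: "(l, r) \<in> H" using ex_right[OF l(1)] by blast
    have nr: "norm r = 1" using norms[OF r] by simp
    have "(l \<star> qcis u x \<star> qcnj l, r \<star> qcis v x \<star> qcnj r) \<in> H" for x
      using mult cnj r uv(3) by blast
    then have "(qcis a x, qcis (r \<star> v \<star> qcnj r) x) \<in> H" for x
      using l nr by (simp add: conj_qcis)
    then show ?thesis using conj_pure_units[OF nr uv(2)] by blast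
  qed
  then show ?thesis by metis
qed

text \<open>The map \<open>f\<close> of axes is an isometry compatible with the group, hence
  conjugation by some \<open>qcnj w\<close>. Then \<open>r\<close> is plus or minus
  \<open>qcnj w \<star> l \<star> w\<close>, which says that the pair fixes \<open>w\<close> up to
  sign.\<close>

lemma fixes_line:
  obtains w where "norm w = 1" "\<And>l r. (l, r) \<in> H \<Longrightarrow> l \<star> w \<star> qcnj r = w \<or> l \<star> w \<star> qcnj r = - w"
proof -
  obtain f where f: "\<And>a. a \<in> pure_units \<Longrightarrow> f a \<in> pure_units"
    "\<And>a x. a \<in> pure_units \<Longrightarrow> (qcis a x, qcis (f a) x) \<in> H" using axis_map by blast
  have isom: "f a \<bullet> f b = a \<bullet> b" if ab: "a \<in> pure_units" "b \<in> pure_units" for a b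
  proof -
    \<comment> \<open>With half-angle \<open>pi / 6\<close> both real parts are at least 1/2, so
      equality up to sign becomes equality.\<close>
    let ?l = "qcis a (pi / 6) \<star> qcis b (pi / 6)" and ?r = "qcis (f a) (pi / 6) \<star> qcis (f b) (pi / 6)"
    have lr: "(?l, ?r) \<in> H" using mult f(2) ab by blast
    obtain c s where c: "c \<in> pure_units" "?l = qcis c s"
      using unit_quat_polar norms[OF lr] by metis
    have "?r = qcis (f c) s \<or> ?r = - qcis (f c) s"
      by (rule right_unique[OF lr]) (use f(2)[OF c(1)] c(2) in simp)
    then have "?r $ 1 = qcis (f c) s $ 1 \<or> ?r $ 1 = - (qcis (f c) s $ 1)"
      by (metis vector_uminus_component)
    moreover have "qcis (f c) s $ 1 = ?l $ 1" using c f(1)[OF c(1)] by simp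
    ultimately have eq: "?r $ 1 = ?l $ 1 \<or> ?r $ 1 = - (?l $ 1)" by simp
    have Re: "?l $ 1 = 3/4 - 1/4 * (a \<bullet> b)" "?r $ 1 = 3/4 - 1/4 * (f a \<bullet> f b)"
      using ab f(1) by (simp_all add: Re_qcis_mul cos_30 sin_30)
    show ?thesis
      using eq pure_units_inner_bound[OF ab] pure_units_inner_bound[OF f(1)[OF ab(1)] f(1)[OF ab(2)]]
      unfolding Re by (auto simp: abs_le_iff)
  qed
  have "f qi \<bullet> f qj = 0" by (simp add: isom) (simp add: inner_quat qbase)
  then obtain w where w: "norm w = 1" "w \<star> f qi \<star> qcnj w = qi" "w \<star> f qj \<star> qcnj w = qj"
    using pure_units_pair_to_ij[of "f qi" "f qj"] f(1) by auto
  define g where "g a = w \<star> f a \<star> qcnj w" for a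
  have g: "g a \<in> pure_units" if "a \<in> pure_units" for a
    using conj_pure_units w f that by (simp add: g_def)
  have fg: "f a = qcnj w \<star> g a \<star> w" for a using conj_inverse[OF w(1), of "f a"] by (simp add: g_def)
  have gisom: "g a \<bullet> g b = a \<bullet> b" if "a \<in> pure_units" "b \<in> pure_units" for a b
    unfolding g_def by (simp add: inner_conj[OF w(1)] isom that)
  have gi: "g qi = qi" and gj: "g qj = qj" using w by (simp_all add: g_def)
  \<comment> \<open>An isometry fixing \<open>qi\<close> and \<open>qj\<close> might still reverse
    \<open>qk\<close>. This is excluded because \<open>qk\<close> is \<open>qj\<close> turned about
    \<open>qi\<close> by a right angle, and the turn is carried out inside \<open>H\<close>.\<close>
  have gk: "g qk = qk"
  proof -
    let ?A = "qcis qi (pi / 4)"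
    define B where "B = qcis (f qi) (pi / 4)"
    have AB: "(?A, B) \<in> H" using f(2) by (simp add: B_def)
    have AjA: "?A \<star> qj \<star> qcnj ?A = qk"
      by (simp add: qcis_def cos_45 sin_45) (simp add: qexpand qbase)
    have "w \<star> B \<star> qcnj w = ?A" using conj_qcis[OF w(1)] gi by (simp add: B_def g_def)
    then have B: "B = qcnj w \<star> ?A \<star> w" using conj_inverse[OF w(1), of B] by simp
    have "B \<star> f qj \<star> qcnj B = qcnj w \<star> (?A \<star> qj \<star> qcnj ?A) \<star> w"
      unfolding B fg[of qj] gj using w(1) by (simp add: qmul_assoc)
    then have BjB: "B \<star> f qj \<star> qcnj B = qcnj w \<star> qk \<star> w" by (simp only: AjA)
    have nB: "norm B = 1" using f(1) by (simp add: B_def)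
    have "(?A \<star> qcis qj (pi / 4) \<star> qcnj ?A, B \<star> qcis (f qj) (pi / 4) \<star> qcnj B) \<in> H"
      using mult cnj AB f(2)[OF pure_units_qbase(2)] by blast
    then have "(qcis qk (pi / 4), qcis (qcnj w \<star> qk \<star> w) (pi / 4)) \<in> H"
      using nB by (simp add: conj_qcis AjA BjB)
    from right_unique[OF this f(2)[OF pure_units_qbase(3)]]
    have *: "qcis (qcnj w \<star> qk \<star> w) (pi / 4) = qcis (f qk) (pi / 4) \<or>
        qcis (qcnj w \<star> qk \<star> w) (pi / 4) = - qcis (f qk) (pi / 4)" .
    have pk: "qcnj w \<star> qk \<star> w \<in> pure_units" using conj_pure_units[of "qcnj w" qk] w by simp
    have "qcis (qcnj w \<star> qk \<star> w) (pi / 4) $ 1 = sqrt 2 / 2" "qcis (f qk) (pi / 4) $ 1 = sqrt 2 / 2"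
      using pk f(1) by (simp_all add: cos_45)
    then have "qcis (qcnj w \<star> qk \<star> w) (pi / 4) \<noteq> - qcis (f qk) (pi / 4)" by auto
    then have "qcnj w \<star> qk \<star> w = f qk" using * by (simp add: qcis_def sin_45)
    then show ?thesis using w(1) by (simp add: g_def qmul_assoc flip: \<open>qcnj w \<star> qk \<star> w = f qk\<close>)
  qed
  have gid: "g a = a" if a: "a \<in> pure_units" for a
    using gisom[OF a pure_units_qbase(1)] gisom[OF a pure_units_qbase(2)] gisom[OF a pure_units_qbase(3)]
      pure_unitsD(2)[OF a] pure_unitsD(2)[OF g[OF a]]
    unfolding gi gj gk inner_qbase by (simp add: quat_eq_iff)
  show ?thesis
  proof (rule that[OF w(1)])
    fix l r assume lr: "(l, r) \<in> H"
    obtain c s where c: "c \<in> pure_units" "l = qcis c s"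
      using unit_quat_polar norms[OF lr] by metis
    have "r = qcis (f c) s \<or> r = - qcis (f c) s"
      by (rule right_unique[OF lr]) (use f(2)[OF c(1)] c(2) in simp)
    moreover have "qcis (f c) s = qcnj w \<star> l \<star> w"
      using conj_qcis[of "qcnj w" c s] w(1) by (simp add: fg gid c)
    ultimately have "r = qcnj w \<star> l \<star> w \<or> r = - (qcnj w \<star> l \<star> w)" by simp
    moreover have "l \<star> w \<star> qcnj (qcnj w \<star> l \<star> w) = w"
      using w(1) norms[OF lr] by (simp add: qmul_assoc)
    ultimately show "l \<star> w \<star> qcnj r = w \<or> l \<star> w \<star> qcnj r = - w"
      by (auto simp: qmul.minus_right simp del: qcnj_mul)
  qed
qed

end

lemma left_kernel_swap: "left_kernel (prod.swap ` H) = right_kernel H"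
  unfolding left_kernel_def right_kernel_def by force

theorem fst_full_cases:
  assumes H: "pair_group H" "closed H" "(- q1, - q1) \<in> H" and full: "fst ` H = sphere 0 1"
  obtains "\<And>l. norm l = 1 \<Longrightarrow> (l, q1) \<in> H" | "\<And>r. norm r = 1 \<Longrightarrow> (q1, r) \<in> H"
    | w where "norm w = 1" "\<And>l r. (l, r) \<in> H \<Longrightarrow> l \<star> w \<star> qcnj r = w \<or> l \<star> w \<star> qcnj r = - w"
proof (cases "snd ` H = sphere 0 1")
  case False
  then show ?thesis using that(1) full_times_proper[OF H full] by blast
next
  case True
  have fst_swap: "fst ` prod.swap ` H = sphere 0 1" using True by (simp add: swap_image)
  consider k where "k \<in> left_kernel H" "k \<noteq> q1" "k \<noteq> - q1" | k where "k \<in> right_kernel H" "k \<noteq> q1" "k \<noteq> - q1"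
    | "left_kernel H \<subseteq> {q1, - q1}" "right_kernel H \<subseteq> {q1, - q1}" by blast
  then show ?thesis
  proof cases
    case 1
    then show ?thesis using that(1) left_kernel_full[OF H(1) full] by blast
  next
    case 2
    then have "(r, q1) \<in> prod.swap ` H" if "norm r = 1" for r
      using left_kernel_full[OF pair_group_swap[OF H(1)] fst_swap] that unfolding left_kernel_swap by blast
    then show ?thesis using that(2) by force
  next
    case 3
    interpret graph_group H by (rule graph_group.intro) (fact H(1) H(2) full True 3)+
    show ?thesis using fixes_line that(3) by blast
  qed
qed

section \<open>Closed subgroups of the orthogonal group\<close>

lemma orthogonal_matrix_inner:
  assumes "orthogonal_matrix (A :: real^4^4)"
  shows "(A *v x) \<bullet> (A *v y) = x \<bullet> y"
  using assms orthogonal_transformation_matrix[of "(*v) A"]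
  by (simp add: orthogonal_transformation_def)

text \<open>Unit multiplications reduce to a map fixing \<open>q1\<close>, \<open>qi\<close> and
  \<open>qj\<close>. Only the sign of the last coordinate remains free, and reversing it is
  \<open>x \<mapsto> qk \<star> qcnj x \<star> qcnj qk\<close>.\<close>

lemma orthogonal_matrix_quaternion:
  fixes A :: "real^4^4"
  assumes A: "orthogonal_matrix A"
  obtains a b where "norm a = 1" "norm b = 1" "\<And>x. A *v x = a \<star> x \<star> qcnj b"
    | a b where "norm a = 1" "norm b = 1" "\<And>x. A *v x = a \<star> qcnj x \<star> qcnj b"
proof -
  define c where "c = A *v q1"
  have c: "norm c = 1" using norm_orthogonal_matrix[OF A] by (simp add: c_def)
  define g where "g x = qcnj c \<star> (A *v x)" for x
  have gin: "g x \<bullet> g y = x \<bullet> y" for x y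
    using c by (simp add: g_def inner_unit_mult orthogonal_matrix_inner[OF A])
  have g1: "g q1 = q1" using c by (simp add: g_def flip: c_def)
  have gp: "g u \<in> pure_units" if "u \<in> pure_units" for u
  proof (rule pure_unitsI)
    show "norm (g u) = 1" using gin[of u u] that by (simp add: norm_eq_1)
    show "g u $ 1 = 0" using gin[of u q1] that by (simp add: g1 inner_q1)
  qed
  have "g qi \<bullet> g qj = 0" by (simp add: gin inner_qbase) (simp add: qi_def)
  then obtain d where d: "norm d = 1" "d \<star> g qi \<star> qcnj d = qi" "d \<star> g qj \<star> qcnj d = qj"
    using pure_units_pair_to_ij[of "g qi" "g qj"] gp by auto
  define h where "h x = d \<star> g x \<star> qcnj d" for x
  have hin: "h x \<bullet> h y = x \<bullet> y" for x y by (simp add: h_def inner_conj[OF d(1)] gin)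
  have h1: "h q1 = q1" "h qi = qi" "h qj = qj" using d by (simp_all add: h_def g1)
  have comps: "h x $ 1 = x $ 1" "h x $ 2 = x $ 2" "h x $ 3 = x $ 3" for x
    using hin[of x q1] hin[of x qi] hin[of x qj] by (simp_all add: h1 inner_q1 inner_qbase)
  have "h qk $ 4 * h qk $ 4 = 1"
    using hin[of qk qk] comps[of qk] by (simp add: inner_quat) (simp add: qk_def)
  then have "(h qk $ 4)\<^sup>2 = 1" by (simp add: power2_eq_square)
  then have "h qk $ 4 = 1 \<or> h qk $ 4 = - 1" by (simp add: power2_eq_1_iff)
  moreover have "h x $ 4 * h qk $ 4 = x $ 4" for x
    using hin[of x qk] comps[of x] comps[of qk] by (simp add: inner_quat) (simp add: qk_def)
  ultimately have cases: "(\<forall>x. h x $ 4 = x $ 4) \<or> (\<forall>x. h x $ 4 = - x $ 4)"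
    by (metis mult.right_neutral mult_minus_right minus_minus)
  have Ah: "A *v x = (c \<star> qcnj d) \<star> h x \<star> d" for x
    using c d by (simp add: h_def g_def qmul_assoc)
  from cases show ?thesis
  proof
    assume "\<forall>x. h x $ 4 = x $ 4"
    then have "h x = x" for x by (simp add: quat_eq_iff comps)
    then show ?thesis using that(1)[of "c \<star> qcnj d" "qcnj d"] Ah c d by simp
  next
    assume "\<forall>x. h x $ 4 = - x $ 4"
    moreover have "qk \<star> qcnj x \<star> qcnj qk = quat (x $ 1) (x $ 2) (x $ 3) (- x $ 4)" for x
      by (simp add: qexpand qbase)
    ultimately have "h x = qk \<star> qcnj x \<star> qcnj qk" for x by (simp add: quat_eq_iff comps)
    then have "A *v x = (c \<star> qcnj d \<star> qk) \<star> qcnj x \<star> qcnj (qcnj d \<star> qk)" for x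
      unfolding Ah by (simp add: qmul_assoc)
    then show ?thesis using that(2)[of "c \<star> qcnj d \<star> qk" "qcnj d \<star> qk"] c d by simp
  qed
qed

section \<open>Passage from matrix groups to groups of pairs\<close>

definition quat_pairs :: "(real^4^4) set \<Rightarrow> ((real^4) \<times> (real^4)) set" where
  "quat_pairs G = {(a, b). norm a = 1 \<and> norm b = 1 \<and> (\<exists>A\<in>G. \<forall>x. A *v x = a \<star> x \<star> qcnj b)}"

text \<open>The set is the part of a product of spheres that a continuous map into the matrices
  sends to \<open>G\<close>.\<close>

lemma closed_quat_pairs:
  fixes G :: "(real^4^4) set"
  assumes "closed G"
  shows "closed (quat_pairs G)"
proof -
  define M where "M p = matrix (\<lambda>x. fst p \<star> x \<star> qcnj (snd p))" for p :: "(real^4) \<times> (real^4)"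
  have M: "M p *v x = fst p \<star> x \<star> qcnj (snd p)" for p x
  proof -
    have "linear (\<lambda>x. fst p \<star> x \<star> qcnj (snd p))" by (auto intro!: linearI simp: qmul_simps)
    from fun_cong[OF matrix_vector_mul(2)[OF this]] show ?thesis unfolding M_def .
  qed
  have Mu: "A = M p" if "\<forall>x. A *v x = fst p \<star> x \<star> qcnj (snd p)" for A :: "real^4^4" and p
    by (subst matrix_eq) (simp add: M that)
  have eq: "quat_pairs G = (sphere 0 1 \<times> sphere 0 1) \<inter> M -` G"
    using M Mu by (fastforce simp: quat_pairs_def)
  have "bounded_linear qcnj" using linear_qcnj by (simp add: linear_conv_bounded_linear)
  then have "continuous_on UNIV (\<lambda>p. fst p \<star> x \<star> qcnj (snd p))" for x :: "real^4"
    by (intro qmul.continuous_on bounded_linear.continuous_on[where f = qcnj] continuous_on_fst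
        continuous_on_snd continuous_on_const continuous_on_id)
  then have "continuous_on UNIV M"
    unfolding M_def matrix_def
    by (intro continuous_on_vec_lambda bounded_linear.continuous_on[OF bounded_linear_vec_nth])
  then have "closed (M -` G)" using assms by (simp add: closed_vimage)
  then show ?thesis unfolding eq by (intro closed_Int closed_Times) auto
qed

lemma orthogonal_transpose_eq:
  assumes "orthogonal_matrix (A :: real^4^4)" "A *v x = y"
  shows "transpose A *v y = x"
proof -
  have "transpose A *v y = (transpose A ** A) *v x" by (metis assms(2) matrix_vector_mul_assoc)
  then show ?thesis using assms(1) by (simp add: orthogonal_matrix_def del: transpose_matrix_vector)
qed

lemma pair_group_quat_pairs:
  fixes G :: "(real^4^4) set"
  assumes G: "subgroup G orthogonal_group"
  shows "pair_group (quat_pairs G)" "(- q1, - q1) \<in> quat_pairs G"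
proof -
  note G' = G[unfolded subgroup_orthogonal_group_iff]
  have one: "mat 1 \<in> G" using G' by blast
  show "(- q1, - q1) \<in> quat_pairs G"
    unfolding quat_pairs_def using one by (auto intro!: bexI[of _ "mat 1"] simp: qmul_simps)
  show "pair_group (quat_pairs G)"
    unfolding pair_group_def
  proof (intro conjI allI impI)
    show "quat_pairs G \<subseteq> sphere 0 1 \<times> sphere 0 1" by (auto simp: quat_pairs_def)
    show "(q1, q1) \<in> quat_pairs G"
      unfolding quat_pairs_def using one by (auto intro!: bexI[of _ "mat 1"])
  next
    fix a b c d assume "(a, b) \<in> quat_pairs G" "(c, d) \<in> quat_pairs G"
    then obtain A B where A: "A \<in> G" "\<And>x. A *v x = a \<star> x \<star> qcnj b" and B: "B \<in> G" "\<And>x. B *v x = c \<star> x \<star> qcnj d"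
      and n: "norm a = 1" "norm b = 1" "norm c = 1" "norm d = 1"
      by (auto simp: quat_pairs_def)
    have "A ** B \<in> G" using A B G' by blast
    moreover have "(A ** B) *v x = (a \<star> c) \<star> x \<star> qcnj (b \<star> d)" for x
      by (simp add: A B qmul_assoc flip: matrix_vector_mul_assoc del: transpose_matrix_vector)
    ultimately show "(a \<star> c, b \<star> d) \<in> quat_pairs G"
      unfolding quat_pairs_def using n by (auto intro!: bexI[of _ "A ** B"])
  next
    fix a b assume "(a, b) \<in> quat_pairs G"
    then obtain A where A: "A \<in> G" "\<And>x. A *v x = a \<star> x \<star> qcnj b" and n: "norm a = 1" "norm b = 1"
      by (auto simp: quat_pairs_def)
    have T: "transpose A \<in> G" using A G' by blast
    have "transpose A *v x = qcnj a \<star> x \<star> qcnj (qcnj b)" for x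
      by (rule orthogonal_transpose_eq) (use G' A n in \<open>auto simp: qmul_assoc\<close>)
    then show "(qcnj a, qcnj b) \<in> quat_pairs G"
      unfolding quat_pairs_def using n T by (auto simp del: transpose_matrix_vector)
  qed
qed

text \<open>The claims come from \<open>transpose S ** B\<close>, \<open>S ** S\<close> and
  \<open>S ** A ** transpose S\<close>, in each of which two reversing maps cancel. The last one
  shows that conjugation by \<open>S\<close> exchanges the roles of the two projections.\<close>

lemma reversing_pairs:
  fixes G :: "(real^4^4) set"
  assumes G: "subgroup G orthogonal_group"
    and s: "S \<in> G" "norm a = 1" "norm b = 1" "\<And>x. S *v x = a \<star> qcnj x \<star> qcnj b"
  shows "\<And>B c d. B \<in> G \<Longrightarrow> norm c = 1 \<Longrightarrow> norm d = 1 \<Longrightarrow> (\<And>x. B *v x = c \<star> qcnj x \<star> qcnj d) \<Longrightarrow>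
      (qcnj b \<star> d, qcnj a \<star> c) \<in> quat_pairs G"
    "(a \<star> b, b \<star> a) \<in> quat_pairs G"
    "\<And>l r. (l, r) \<in> quat_pairs G \<Longrightarrow> (a \<star> r \<star> qcnj a, b \<star> l \<star> qcnj b) \<in> quat_pairs G"
proof -
  note G' = G[unfolded subgroup_orthogonal_group_iff]
  have T: "transpose S \<in> G" using s G' by blast
  have TS: "transpose S *v z = qcnj b \<star> qcnj z \<star> a" for z
    by (rule orthogonal_transpose_eq) (use G' s in \<open>auto simp: qmul_assoc\<close>)
  show "(qcnj b \<star> d, qcnj a \<star> c) \<in> quat_pairs G"
    if B: "B \<in> G" "norm c = 1" "norm d = 1" "\<And>x. B *v x = c \<star> qcnj x \<star> qcnj d" for B c d
  proof -
    have "transpose S ** B \<in> G" using T B G' by blast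
    moreover have "(transpose S ** B) *v x = (qcnj b \<star> d) \<star> x \<star> qcnj (qcnj a \<star> c)" for x
      by (simp add: TS B qmul_assoc flip: matrix_vector_mul_assoc del: transpose_matrix_vector)
    ultimately show ?thesis unfolding quat_pairs_def using B s
      by (auto intro!: bexI[of _ "transpose S ** B"])
  qed
  show "(a \<star> b, b \<star> a) \<in> quat_pairs G"
  proof -
    have "S ** S \<in> G" using s G' by blast
    moreover have "(S ** S) *v x = (a \<star> b) \<star> x \<star> qcnj (b \<star> a)" for x
      by (simp add: s qmul_assoc flip: matrix_vector_mul_assoc del: transpose_matrix_vector)
    ultimately show ?thesis unfolding quat_pairs_def using s
      by (auto intro!: bexI[of _ "S ** S"])
  qed
  show "(a \<star> r \<star> qcnj a, b \<star> l \<star> qcnj b) \<in> quat_pairs G" if lr: "(l, r) \<in> quat_pairs G" for l r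
  proof -
    obtain A where A: "A \<in> G" "\<And>x. A *v x = l \<star> x \<star> qcnj r" and n: "norm l = 1" "norm r = 1"
      using lr by (auto simp: quat_pairs_def)
    have "S ** A ** transpose S \<in> G" using s A T G' by blast
    moreover have "(S ** A ** transpose S) *v x = (a \<star> r \<star> qcnj a) \<star> x \<star> qcnj (b \<star> l \<star> qcnj b)" for x
      by (simp add: s A TS qmul_assoc flip: matrix_vector_mul_assoc del: transpose_matrix_vector)
    ultimately show ?thesis unfolding quat_pairs_def using s n
      by (auto intro!: bexI[of _ "S ** A ** transpose S"])
  qed
qed

section \<open>Two distant orbits of a non-transitive group\<close>

lemma orbits_far_apart:
  fixes G :: "(real^4^4) set"
  assumes G: "subgroup G orthogonal_group" and "closed G"
    and not_trans: "\<not> transitive_action (subgroup_of_O G) (sphere 0 1) sphere_action"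
  obtains x y where "norm x = 1" "norm y = 1" "\<And>A. A \<in> G \<Longrightarrow> (A *v x) \<bullet> y \<le> cos_half_alpha"
proof -
  note witness = that
  note G' = G[unfolded subgroup_orthogonal_group_iff]
  define H where "H = quat_pairs G"
  have H: "pair_group H" "closed H" "(- q1, - q1) \<in> H"
    unfolding H_def using pair_group_quat_pairs[OF G] closed_quat_pairs \<open>closed G\<close> by auto
  have sw: "pair_group (prod.swap ` H)" "closed (prod.swap ` H)" "(- q1, - q1) \<in> prod.swap ` H"
    using pair_group_swap closed_swap_pair_group H by (auto simp: swap_image)
  note swap_mem = swap_image(1)
  have trans: False if "\<And>x y. norm x = 1 \<Longrightarrow> norm y = 1 \<Longrightarrow> \<exists>A\<in>G. A *v x = y"
  proof -
    have "transitive_action (subgroup_of_O G) (sphere 0 1) sphere_action"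
      unfolding transitive_action_def transitive_action_axioms_def
      using sphere_action_group_action[OF G] that by (auto simp: sphere_action_def)
    then show False using not_trans by simp
  qed
  have left: False if "\<And>l. norm l = 1 \<Longrightarrow> (l, q1) \<in> H"
  proof (rule trans)
    fix x y :: "real^4" assume xy: "norm x = 1" "norm y = 1"
    then have "(y \<star> qcnj x, q1) \<in> H" by (intro that) simp
    then obtain A where "A \<in> G" "\<And>z. A *v z = (y \<star> qcnj x) \<star> z" by (auto simp: H_def quat_pairs_def)
    moreover from this xy have "A *v x = y" by (simp flip: qmul_assoc)
    ultimately show "\<exists>A\<in>G. A *v x = y" by blast
  qed
  have right: False if "\<And>r. norm r = 1 \<Longrightarrow> (q1, r) \<in> H"
  proof (rule trans)
    fix x y :: "real^4" assume xy: "norm x = 1" "norm y = 1"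
    then have "(q1, qcnj y \<star> x) \<in> H" by (intro that) simp
    then obtain A where "A \<in> G" "\<And>z. A *v z = z \<star> (qcnj x \<star> y)" by (auto simp: H_def quat_pairs_def)
    moreover from this xy have "A *v x = y" by (simp flip: qmul_assoc)
    ultimately show "\<exists>A\<in>G. A *v x = y" by blast
  qed
  define rev where "rev S a b \<longleftrightarrow> S \<in> G \<and> norm a = 1 \<and> norm b = 1 \<and> (\<forall>x. S *v x = a \<star> qcnj x \<star> qcnj b)" for S a b
  \<comment> \<open>Any two reversing maps differ by a pair, so they all send \<open>w\<close> to
    one \<open>v\<close> or its negative. The orbit of \<open>w\<close> has at most four points, and
    some \<open>y\<close> in 4-space is orthogonal to all of them.\<close>
  have line: thesis if w: "norm w = 1" "\<And>l r. (l, r) \<in> H \<Longrightarrow> l \<star> w \<star> qcnj r = w \<or> l \<star> w \<star> qcnj r = - w" for w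
  proof -
    have pos: "A *v w \<in> {w, - w}" if "A \<in> G" "norm c = 1" "norm d = 1" "\<And>x. A *v x = c \<star> x \<star> qcnj d" for A c d
    proof -
      have "(c, d) \<in> H" using that by (auto simp: H_def quat_pairs_def)
      then show ?thesis using w(2)[of c d] that(4)[of w] by auto
    qed
    have "\<exists>v. \<forall>A c d. rev A c d \<longrightarrow> A *v w \<in> {v, - v}"
    proof (cases "\<exists>S a b. rev S a b")
      case True
      then obtain S a b where s: "S \<in> G" "norm a = 1" "norm b = 1" "\<And>x. S *v x = a \<star> qcnj x \<star> qcnj b"
        unfolding rev_def by blast
      have "A *v w \<in> {S *v w, - (S *v w)}" if "rev A c d" for A c d
      proof -
        have A: "A \<in> G" "norm c = 1" "norm d = 1" "\<And>x. A *v x = c \<star> qcnj x \<star> qcnj d"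
          using that by (auto simp: rev_def)
        have "(qcnj b \<star> d, qcnj a \<star> c) \<in> H"
          unfolding H_def by (rule reversing_pairs(1)[OF G s A])
        then have "(qcnj b \<star> d) \<star> w \<star> qcnj (qcnj a \<star> c) = w \<or> (qcnj b \<star> d) \<star> w \<star> qcnj (qcnj a \<star> c) = - w"
          by (rule w(2))
        moreover have "A *v w = S *v ((qcnj b \<star> d) \<star> w \<star> qcnj (qcnj a \<star> c))"
          using s by (simp add: A qmul_assoc)
        moreover have "S *v (- w) = - (S *v w)" by (rule linear_neg[OF matrix_vector_mul_linear])
        ultimately show ?thesis by auto
      qed
      then show ?thesis by blast
    qed blast
    then obtain v where v: "\<And>A c d. rev A c d \<Longrightarrow> A *v w \<in> {v, - v}" by blast
    have "dim (span {w, v}) < DIM(real^4)"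
      using dim_le_card[of "{w, v}" "{w, v}"] card_insert_le_m1[of 2 "{v}" w] by (simp add: span_superset)
    then obtain z where z: "z \<noteq> 0" "\<And>t. t \<in> span {w, v} \<Longrightarrow> orthogonal z t"
      using orthogonal_to_subspace_exists[of "{w, v}"] by auto
    define y where "y = (1 / norm z) *\<^sub>R z"
    have y: "norm y = 1" "w \<bullet> y = 0" "v \<bullet> y = 0"
      using z(1) z(2)[of w] z(2)[of v]
      by (simp_all add: y_def orthogonal_def inner_commute span_base)
    have "(A *v w) \<bullet> y \<le> cos_half_alpha" if A: "A \<in> G" for A
    proof -
      have "orthogonal_matrix A" using A G' by blast
      then have "A *v w \<in> {w, - w, v, - v}"
      proof (cases rule: orthogonal_matrix_quaternion)
        case (1 c d)
        then show ?thesis using pos[OF A 1] by blast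
      next
        case (2 c d)
        then have "rev A c d" using A by (simp add: rev_def)
        then show ?thesis using v by blast
      qed
      then show ?thesis using y cos_half_alpha_bound by auto
    qed
    then show thesis by (rule witness[OF w(1) y(1)])
  qed
  show ?thesis
  proof (cases "fst ` H = sphere 0 1 \<or> snd ` H = sphere 0 1")
    case True
    then show ?thesis
    proof
      assume "fst ` H = sphere 0 1"
      then show ?thesis using fst_full_cases[OF H] left right line by metis
    next
      assume "snd ` H = sphere 0 1"
      then have full: "fst ` prod.swap ` H = sphere 0 1" by (simp add: swap_image)
      show ?thesis
      proof (rule fst_full_cases[OF sw full])
        show ?thesis if "\<And>l. norm l = 1 \<Longrightarrow> (l, q1) \<in> prod.swap ` H"
          using right that unfolding swap_mem by blast
        show ?thesis if "\<And>r. norm r = 1 \<Longrightarrow> (q1, r) \<in> prod.swap ` H"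
          using left that unfolding swap_mem by blast
        fix w assume w: "norm w = 1" "\<And>l r. (l, r) \<in> prod.swap ` H \<Longrightarrow> l \<star> w \<star> qcnj r = w \<or> l \<star> w \<star> qcnj r = - w"
        show ?thesis
        proof (rule line[of "qcnj w"])
          show "norm (qcnj w) = 1" using w by simp
          fix l r assume "(l, r) \<in> H"
          then have "(r, l) \<in> prod.swap ` H" by (simp only: swap_mem)
          then have "r \<star> w \<star> qcnj l = w \<or> r \<star> w \<star> qcnj l = - w" by (rule w(2))
          then have "qcnj (r \<star> w \<star> qcnj l) = qcnj w \<or> qcnj (r \<star> w \<star> qcnj l) = qcnj (- w)" by metis
          then show "l \<star> qcnj w \<star> qcnj r = qcnj w \<or> l \<star> qcnj w \<star> qcnj r = - qcnj w"
            by (simp add: qmul_assoc)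
        qed
      qed
    qed
  next
    case proper: False
    note L = pair_group_projections(1-3)[OF H] and R = pair_group_projections(4-6)[OF H]
    show ?thesis
    proof (cases "\<exists>S a b. rev S a b")
      case True
      then obtain S a b where s: "S \<in> G" "norm a = 1" "norm b = 1" "\<And>x. S *v x = a \<star> qcnj x \<star> qcnj b"
        unfolding rev_def by blast
      have swapL: "a \<star> r \<star> qcnj a \<in> fst ` H" if "(l, r) \<in> H" for l r
        using reversing_pairs(3)[OF G s, of l r] that unfolding H_def by force
      have ab: "a \<star> b \<in> fst ` H" using reversing_pairs(2)[OF G s] unfolding H_def by force
      obtain z where z: "norm z = 1" "\<And>l. l \<in> fst ` H \<Longrightarrow> l \<bullet> z \<le> cos_half_alpha"
        using proper_unit_group_far_point[OF L] proper by blast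
      \<comment> \<open>The exchange of projections lets the right factor of each map be rewritten
        as a left factor once it is applied to \<open>a\<close>. So the orbit of \<open>a\<close>
        lies in a single coset of the first projection, a proper closed group.\<close>
      have in_L: "(A *v a) \<star> qcnj a \<in> fst ` H" if A: "A \<in> G" for A
      proof -
        have "orthogonal_matrix A" using A G' by blast
        then show ?thesis
        proof (cases rule: orthogonal_matrix_quaternion)
          case (1 c d)
          then have cd: "(c, d) \<in> H" using A by (auto simp: H_def quat_pairs_def)
          then have "c \<in> fst ` H" by force
          then have "c \<star> qcnj (a \<star> d \<star> qcnj a) \<in> fst ` H"
            using swapL[OF cd] L(1) by (simp add: unit_groupD del: qcnj_mul)
          then show ?thesis by (simp add: 1 qmul_assoc)
        next
          case (2 c d)
          have lr: "(qcnj b \<star> d, qcnj a \<star> c) \<in> H"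
            unfolding H_def by (rule reversing_pairs(1)[OF G s A 2])
          then have "qcnj b \<star> d \<in> fst ` H" by force
          moreover have "a \<star> (qcnj a \<star> c) \<star> qcnj a \<in> fst ` H" using swapL[OF lr] .
          ultimately have "(a \<star> (qcnj a \<star> c) \<star> qcnj a) \<star> (qcnj (qcnj b \<star> d) \<star> qcnj (a \<star> b)) \<in> fst ` H"
            using ab L(1) by (simp add: unit_groupD del: qcnj_mul)
          then show ?thesis using s by (simp add: 2 qmul_assoc)
        qed
      qed
      show ?thesis
      proof (rule that[of a "z \<star> a"])
        show "(A *v a) \<bullet> (z \<star> a) \<le> cos_half_alpha" if "A \<in> G" for A
        proof -
          have "(A *v a) \<bullet> (z \<star> a) = ((A *v a) \<star> qcnj a) \<bullet> z" by (simp add: inner_qmul_right)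
          then show ?thesis using z(2)[OF in_L[OF that]] by simp
        qed
      qed (use s z in simp_all)
    next
      case no_reversing: False
      have "far_apart (fst ` H) (snd ` H)" using proper_unit_groups_far_apart[OF L _ R] proper by blast
      then obtain x y where xy: "norm x = 1" "norm y = 1"
        "\<And>l r. l \<in> fst ` H \<Longrightarrow> r \<in> snd ` H \<Longrightarrow> (l \<star> x \<star> qcnj r) \<bullet> y \<le> cos_half_alpha"
        unfolding far_apart_def by blast
      show ?thesis
      proof (rule that[OF xy(1,2)])
        fix A assume A: "A \<in> G"
        then have "orthogonal_matrix A" using G' by blast
        then show "(A *v x) \<bullet> y \<le> cos_half_alpha"
        proof (cases rule: orthogonal_matrix_quaternion)
          case (1 c d)
          then have "(c, d) \<in> H" using A by (auto simp: H_def quat_pairs_def)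
          then have "c \<in> fst ` H" "d \<in> snd ` H" by force+
          then show ?thesis using xy(3) by (simp add: 1)
        next
          case (2 c d)
          then show ?thesis using no_reversing A unfolding rev_def by blast
        qed
      qed
    qed
  qed
qed

theorem theoremA:
  fixes G :: "(real^4^4) set"
  assumes "subgroup G orthogonal_group"
    and "closed G"
    and "\<not> transitive_action (subgroup_of_O G) (sphere 0 1 :: (real^4) set) sphere_action"
  shows "sphere_orbit_space_diameter G \<ge> arccos (tan (3 * pi / 10) / sqrt 3) / 2"
proof -
  note G' = assms(1)[unfolded subgroup_orthogonal_group_iff]
  obtain x y where xy: "norm x = 1" "norm y = 1" "\<And>A. A \<in> G \<Longrightarrow> (A *v x) \<bullet> y \<le> cos_half_alpha"
    by (rule orbits_far_apart[OF assms]) (rule that)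
  let ?X = "(\<lambda>A. A *v x) ` G" and ?Y = "(\<lambda>A. A *v y) ` G"
  obtain A B where AB: "A \<in> G" "B \<in> G" "orbital_dist ?X ?Y = sphere_dist (A *v x) (B *v y)"
    using orbital_dist_attained[OF assms(1,2) xy(1,2)] by metis
  have oB: "orthogonal_matrix B" and T: "transpose B \<in> G" using AB G' by auto
  \<comment> \<open>The bound is known for the fixed vector \<open>y\<close> only; the inverse of
    \<open>B\<close> moves the second orbit point back to it.\<close>
  have "(A *v x) \<bullet> (B *v y) = ((transpose B ** A) *v x) \<bullet> y"
    by (metis dot_lmul_matrix inner_commute matrix_vector_mul_assoc transpose_matrix_vector transpose_transpose)
  moreover have "transpose B ** A \<in> G" using T AB G' by blast
  ultimately have le: "(A *v x) \<bullet> (B *v y) \<le> cos_half_alpha" using xy(3) by simp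
  have bound: "\<bar>(A *v x) \<bullet> (B *v y)\<bar> \<le> 1"
    using Cauchy_Schwarz_ineq2[of "A *v x" "B *v y"] AB G' xy by (simp add: norm_orthogonal_matrix)
  have "arccos cos_alpha / 2 = arccos cos_half_alpha"
    unfolding cos_half_alpha_def using arccos_bounded[of cos_alpha] cos_alpha_bounds
    by (subst arccos_cos) auto
  also have "\<dots> \<le> arccos ((A *v x) \<bullet> (B *v y))"
    using le bound by (intro arccos_le_arccos) (auto simp: abs_le_iff cos_half_alpha_def)
  also have "\<dots> = orbital_dist ?X ?Y" by (simp add: AB sphere_dist_def)
  also have "\<dots> \<le> sphere_orbit_space_diameter G"
    unfolding sphere_orbit_space_diameter_def
    by (rule cSup_upper[OF _ orbital_dist_set_bdd_above[OF assms(1,2)]])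
      (use xy in \<open>auto simp: sphere_orbit_space_eq\<close>)
  finally show ?thesis by (simp add: cos_alpha_def)
qed

end
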